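(* Let $(\tau:X\to \mathsf{SSub},\ \psi:b\to \prod_{x\in X}\tau(x))$ and $(\mu:Y\to\mathsf{SSub},\ \nu:c\to\prod_{y\in Y}\mu(y))$ be networks of open systems, and let $$((\varphi,\Phi),f):(\tau:X\to \mathsf{SSub},\ \psi:b\to \textstyle\prod_{x\in X}\tau(x))\to(\mu:Y\to\mathsf{SSub},\ \nu:c\to\prod_{y\in Y}\mu(y))$$ be a map of networks of open systems (so $\varphi:X\to Y$, $\Phi(x):\mu(\varphi(x))\to\tau(x)$ for $x\in X$, and $f:c\to b$). Then the linear maps $\nu^*\circ \mathsf{Crl}_\mu:\bigoplus_{y\in Y}\mathsf{Crl}(\mu(y))\to\mathsf{Crl}(c)$ and $\psi^*\circ\mathsf{Crl}_\tau:\bigoplus_{x\in X}\mathsf{Crl}(\tau(x))\to\mathsf{Crl}(b)$ form a 2-cell, in the double category of vector spaces, linear maps and linear relations, from the linear relation $\odot(\varphi,\mathsf{Crl}\circ\Phi)$ (from $\bigoplus_{y\in Y}\mathsf{Crl}(\mu(y))$ to $\bigoplus_{x\in X}\mathsf{Crl}(\tau(x))$) to the linear relation $\mathsf{Crl}(f)$ (from $\mathsf{Crl}(c)$ to $\mathsf{Crl}(b)$). That is, $$\big((\psi^*\circ\mathsf{Crl}_\tau)\times(\nu^*\circ\mathsf{Crl}_\mu)\big)\big(\odot(\varphi,\mathsf{Crl}\circ\Phi)\big)\subseteq \mathsf{Crl}(f).$$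
   Context: Manifolds and maps are smooth. A surjective submersion is written $a=(a_{\mathsf{tot}}\xrightarrow{p_a}a_{\mathsf{st}})$ (total space and state space). $\mathsf{SSub}$ is the category of surjective submersions; a morphism (map of submersions) $f:a\to b$ is a pair of smooth maps $f_{\mathsf{tot}}:a_{\mathsf{tot}}\to b_{\mathsf{tot}}$, $f_{\mathsf{st}}:a_{\mathsf{st}}\to b_{\mathsf{st}}$ with $p_b\circ f_{\mathsf{tot}}=f_{\mathsf{st}}\circ p_a$. It has finite products: total spaces, state spaces and submersions are multiplied. Open systems: $\mathsf{Crl}(a)$ is the real vector space of smooth maps $F:a_{\mathsf{tot}}\to T a_{\mathsf{st}}$ with $F(q)\in T_{p_a(q)}a_{\mathsf{st}}$ for all $q$. For a map $f:a\to b$, open systems $F\in\mathsf{Crl}(a)$ and $G\in\mathsf{Crl}(b)$ are $f$-related if $Tf_{\mathsf{st}}\circ F=G\circ f_{\mathsf{tot}}$, and $\mathsf{Crl}(f):=\{(G,F)\in\mathsf{Crl}(b)\times\mathsf{Crl}(a)\mid F,G\text{ are }f\text{-related}\}$. A linear relation from a vector space $V$ to a vector space $W$ is a linear subspace $R\subseteq W\times V$. In the double category of vector spaces, linear maps and linear relations, a 2-cell from a relation $R\subseteq W\times V$ to a relation $S\subseteq Y\times X$ is a pair of linear maps $h:V\to X$, $g:W\to Y$ with $(g\times h)(R)\subseteq S$. Interconnection morphism: a map of submersions $\varphi:a\to b$ with $\varphi_{\mathsf{st}}$ a diffeomorphism. It induces the linear map $\varphi^*:\mathsf{Crl}(b)\to\mathsf{Crl}(a)$,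 $\varphi^*F=T(\varphi_{\mathsf{st}})^{-1}\circ F\circ\varphi_{\mathsf{tot}}$. Lists: a list of submersions is a map $\tau:X\to\mathsf{SSub}$ from a finite set $X$ to objects. A morphism $(\varphi,\Phi)$ of lists from $\tau:X\to\mathsf{SSub}$ to $\mu:Y\to\mathsf{SSub}$ is a map of sets $\varphi:X\to Y$ together with maps of submersions $\Phi(x):\mu(\varphi(x))\to\tau(x)$ for all $x\in X$. It induces the map of submersions $\mathbb{P}(\varphi,\Phi):\prod_{y\in Y}\mu(y)\to\prod_{x\in X}\tau(x)$ uniquely determined by $\pi_x\circ\mathbb{P}(\varphi,\Phi)=\Phi(x)\circ\pi_{\varphi(x)}$ for all $x\in X$, where $\pi$ denotes canonical projections. For a list $\tau:X\to\mathsf{SSub}$, $\mathsf{Crl}_\tau:\bigoplus_{x\in X}\mathsf{Crl}(\tau(x))\to\mathsf{Crl}(\prod_{x\in X}\tau(x))$ is the linear map determined by $T(\pi_a)_{\mathsf{st}}\circ\mathsf{Crl}_\tau((F_x)_{x\in X})=F_a\circ(\pi_a)_{\mathsf{tot}}$ for all $a\in X$ (i.e. it sends a family of open systems to the product open system). For a morphism of lists $(\varphi,\Phi)$ from $\tau:X\to\mathsf{SSub}$ to $\mu:Y\to\mathsf{SSub}$ (that is, a map of finite sets $\varphi:X\to Y$ together with maps of submersions $\Phi(x):\mu(\varphi(x))\to\tau(x)$ for all $x\in X$), $$\odot(\varphi,\mathsf{Crl}\circ\Phi)=\{((F_x)_{x\in X},(G_y)_{y\in Y})\in\textstyle\bigoplus_{x}\mathsf{Crl}(\tau(x))\times\bigoplus_y\mathsf{Crl}(\mu(y))\mid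 (F_x,G_{\varphi(x)})\in\mathsf{Crl}(\Phi(x))\ \text{for all }x\in X\}.$$ A network of open systems is a list of submersions $\tau:X\to\mathsf{SSub}$ together with an interconnection morphism $\psi:b\to\prod_{x\in X}\tau(x)$. A map of networks from $(\tau:X\to\mathsf{SSub},\psi:b\to\prod_x\tau(x))$ to $(\mu:Y\to\mathsf{SSub},\nu:c\to\prod_y\mu(y))$ is a morphism of lists $(\varphi,\Phi)$ from $\tau$ to $\mu$ together with a map of submersions $f:c\to b$ such that $\psi\circ f=\mathbb{P}(\varphi,\Phi)\circ\nu$. *)

theory Defs
  imports "Jordan_Normal_Form.VS_Connect" "HOL-Analysis.Analysis"
begin

section \<open>Calculus on coordinate spaces\<close>

text \<open>
  The model spaces are \<open>\<real>\<^sup>I\<close> for a finite index set \<open>I\<close>, realised as the functions vanishing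
  outside \<open>I\<close> (compare \<^const>\<open>Euclidean_space\<close>, which is the case \<open>I = {..<n}\<close>).  Arbitrary finite
  index sets are used instead of initial segments because then
  \<open>\<Prod>\<^sub>x \<real>\<^bsup>I x\<^esup>\<close> is \<open>\<real>\<^bsup>Sigma X I\<^esup>\<close> and \<open>\<real>\<^sup>I \<times> \<real>\<^sup>I\<close> is \<open>\<real>\<^bsup>I <+> I\<^esup>\<close>, without any renumbering.
\<close>

definition coord_space :: "'i set \<Rightarrow> ('i \<Rightarrow> real) topology" where
  "coord_space I = subtopology (powertop_real UNIV) {x. \<forall>i. i \<notin> I \<longrightarrow> x i = 0}"

definition partial_deriv :: "'i \<Rightarrow> (('i \<Rightarrow> real) \<Rightarrow> real) \<Rightarrow> ('i \<Rightarrow> real) \<Rightarrow> real" where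
  "partial_deriv i g x = deriv (\<lambda>t. g (x(i := t))) (x i)"

text \<open>\<open>C_k I k S g\<close>: all partial derivatives of \<open>g\<close> up to order \<open>k\<close> exist and are continuous on the
  open set \<open>S\<close> of \<open>\<real>\<^sup>I\<close>.\<close>

primrec C_k :: "'i set \<Rightarrow> nat \<Rightarrow> ('i \<Rightarrow> real) set \<Rightarrow> (('i \<Rightarrow> real) \<Rightarrow> real) \<Rightarrow> bool" where
  "C_k I 0 S g \<longleftrightarrow> continuous_map (subtopology (coord_space I) S) euclideanreal g"
| "C_k I (Suc k) S g \<longleftrightarrow> continuous_map (subtopology (coord_space I) S) euclideanreal g \<and>
     (\<forall>i\<in>I. (\<forall>x\<in>S. (\<lambda>t. g (x(i := t))) field_differentiable at (x i)) \<and>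
             C_k I k S (partial_deriv i g))"

definition smooth_coord ::
  "'i set \<Rightarrow> 'j set \<Rightarrow> ('i \<Rightarrow> real) set \<Rightarrow> (('i \<Rightarrow> real) \<Rightarrow> 'j \<Rightarrow> real) \<Rightarrow> bool" where
  "smooth_coord I J S g \<longleftrightarrow> (\<forall>j\<in>J. \<forall>k. C_k I k S (\<lambda>x. g x j))"

text \<open>The Jacobian matrix of \<open>g : \<real>\<^sup>I \<rightarrow> \<real>\<^sup>J\<close> at \<open>x\<close>, applied to the vector \<open>v\<close>.\<close>

definition jacobian ::
  "'i set \<Rightarrow> 'j set \<Rightarrow> (('i \<Rightarrow> real) \<Rightarrow> 'j \<Rightarrow> real) \<Rightarrow> ('i \<Rightarrow> real) \<Rightarrow> ('i \<Rightarrow> real) \<Rightarrow> 'j \<Rightarrow> real" where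
  "jacobian I J g x v =
     (\<lambda>j. if j \<in> J then \<Sum>i\<in>I. partial_deriv i (\<lambda>y. g y j) x * v i else 0)"


section \<open>Smooth manifolds\<close>

text \<open>
  A manifold is given by a set of points and an atlas, which need not be maximal; a chart is a
  pair of its domain and its coordinate map (only the values on the domain matter).  The topology
  is the one induced by the atlas.
\<close>

type_synonym ('p, 'i) chart = "'p set \<times> ('p \<Rightarrow> 'i \<Rightarrow> real)"

record ('p, 'i) mfd =
  points :: "'p set"
  coords :: "'i set"
  atlas :: "('p, 'i) chart set"

definition mfd_topology :: "('p, 'i) mfd \<Rightarrow> 'p topology" where
  "mfd_topology M = topology (\<lambda>W. W \<subseteq> points M \<and>
     (\<forall>(U, \<phi>)\<in>atlas M. openin (coord_space (coords M)) (\<phi> ` (U \<inter> W))))"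

definition manifold :: "('p, 'i) mfd \<Rightarrow> bool" where
  "manifold M \<longleftrightarrow>
     finite (coords M) \<and>
     (\<Union>(U, \<phi>)\<in>atlas M. U) = points M \<and>
     (\<forall>(U, \<phi>)\<in>atlas M. inj_on \<phi> U \<and> openin (coord_space (coords M)) (\<phi> ` U)) \<and>
     (\<forall>(U, \<phi>)\<in>atlas M. \<forall>(V, \<psi>)\<in>atlas M.
        openin (coord_space (coords M)) (\<phi> ` (U \<inter> V)) \<and>
        smooth_coord (coords M) (coords M) (\<phi> ` (U \<inter> V)) (\<psi> \<circ> inv_into U \<phi>)) \<and>
     Hausdorff_space (mfd_topology M) \<and>
     second_countable (mfd_topology M)"

definition smooth_map :: "('p, 'i) mfd \<Rightarrow> ('q, 'j) mfd \<Rightarrow> ('p \<Rightarrow> 'q) \<Rightarrow> bool" where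
  "smooth_map M N f \<longleftrightarrow>
     continuous_map (mfd_topology M) (mfd_topology N) f \<and>
     (\<forall>p\<in>points M. f p \<in> points N) \<and>
     (\<forall>(U, \<phi>)\<in>atlas M. \<forall>(V, \<psi>)\<in>atlas N.
        smooth_coord (coords M) (coords N) (\<phi> ` (U \<inter> f -` V)) (\<psi> \<circ> f \<circ> inv_into U \<phi>))"

definition diffeomorphism :: "('p, 'i) mfd \<Rightarrow> ('q, 'j) mfd \<Rightarrow> ('p \<Rightarrow> 'q) \<Rightarrow> bool" where
  "diffeomorphism M N f \<longleftrightarrow>
     smooth_map M N f \<and> bij_betw f (points M) (points N) \<and>
     smooth_map N M (inv_into (points M) f)"

definition prod_mfd :: "'x set \<Rightarrow> ('x \<Rightarrow> ('p, 'i) mfd) \<Rightarrow> ('x \<Rightarrow> 'p, 'x \<times> 'i) mfd" where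
  "prod_mfd X M = \<lparr>
     points = (\<Pi>\<^sub>E x\<in>X. points (M x)),
     coords = Sigma X (\<lambda>x. coords (M x)),
     atlas = (\<lambda>c. (\<Pi>\<^sub>E x\<in>X. fst (c x), \<lambda>q (x, i). if x \<in> X then snd (c x) (q x) i else 0))
               ` (\<Pi>\<^sub>E x\<in>X. atlas (M x))\<rparr>"


section \<open>Tangent bundles\<close>

text \<open>
  A tangent vector at \<open>p\<close> is a family of coordinate vectors, one for each chart around \<open>p\<close>, which
  transform by the Jacobians of the coordinate changes.  Families are extended by zero to all
  other charts, so that addition and scaling are pointwise and zero is the zero function.  Points of the
  tangent bundle are pairs of a base point and a tangent vector there.
\<close>

definition charts_at :: "('p, 'i) mfd \<Rightarrow> 'p \<Rightarrow> ('p, 'i) chart set" where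
  "charts_at M p = {c \<in> atlas M. p \<in> fst c}"

definition tangent_space :: "('p, 'i) mfd \<Rightarrow> 'p \<Rightarrow> (('p, 'i) chart \<Rightarrow> 'i \<Rightarrow> real) set" where
  "tangent_space M p = {v.
     (\<forall>c. c \<notin> charts_at M p \<longrightarrow> v c = (\<lambda>i. 0)) \<and>
     (\<forall>c\<in>charts_at M p. v c \<in> topspace (coord_space (coords M))) \<and>
     (\<forall>(U, \<phi>)\<in>charts_at M p. \<forall>(V, \<psi>)\<in>charts_at M p.
        v (V, \<psi>) = jacobian (coords M) (coords M) (\<psi> \<circ> inv_into U \<phi>) (\<phi> p) (v (U, \<phi>)))}"

type_synonym ('p, 'i) tangent = "'p \<times> (('p, 'i) chart \<Rightarrow> 'i \<Rightarrow> real)"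

definition tangent_bundle :: "('p, 'i) mfd \<Rightarrow> (('p, 'i) tangent, 'i + 'i) mfd" where
  "tangent_bundle M = \<lparr>
     points = Sigma (points M) (tangent_space M),
     coords = coords M <+> coords M,
     atlas = (\<lambda>(U, \<phi>). (Sigma U (tangent_space M), \<lambda>(p, v). case_sum (\<phi> p) (v (U, \<phi>))))
               ` atlas M\<rparr>"

text \<open>The differential \<open>T f\<close> is computed in some chart around the base point; for smooth \<open>f\<close> the result
  does not depend on the choice.\<close>

definition tangent_map ::
  "('p, 'i) mfd \<Rightarrow> ('q, 'j) mfd \<Rightarrow> ('p \<Rightarrow> 'q) \<Rightarrow> ('p, 'i) tangent \<Rightarrow> ('q, 'j) tangent" where
  "tangent_map M N f = (\<lambda>(p, v). (f p, \<lambda>d.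
     if d \<in> charts_at N (f p) then
       (let c = (SOME c. c \<in> charts_at M p)
        in jacobian (coords M) (coords N) (snd d \<circ> f \<circ> inv_into (fst c) (snd c)) (snd c p) (v c))
     else (\<lambda>j. 0)))"


section \<open>Surjective submersions\<close>

record ('p, 'i, 'q, 'j) ssub =
  tot :: "('p, 'i) mfd"
  st :: "('q, 'j) mfd"
  proj :: "'p \<Rightarrow> 'q"

definition surjective_submersion :: "('p, 'i, 'q, 'j) ssub \<Rightarrow> bool" where
  "surjective_submersion a \<longleftrightarrow>
     manifold (tot a) \<and> manifold (st a) \<and>
     smooth_map (tot a) (st a) (proj a) \<and>
     proj a ` points (tot a) = points (st a) \<and>
     (\<forall>q\<in>points (tot a). \<forall>w\<in>tangent_space (st a) (proj a q). \<exists>v\<in>tangent_space (tot a) q.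
        tangent_map (tot a) (st a) (proj a) (q, v) = (proj a q, w))"

record ('p, 'p', 'q, 'q') ssub_map =
  map_tot :: "'p \<Rightarrow> 'p'"
  map_st :: "'q \<Rightarrow> 'q'"

definition map_of_submersions ::
  "('p, 'i, 'q, 'j) ssub \<Rightarrow> ('p', 'i', 'q', 'j') ssub \<Rightarrow> ('p, 'p', 'q, 'q') ssub_map \<Rightarrow> bool" where
  "map_of_submersions a b f \<longleftrightarrow>
     smooth_map (tot a) (tot b) (map_tot f) \<and>
     smooth_map (st a) (st b) (map_st f) \<and>
     (\<forall>q\<in>points (tot a). proj b (map_tot f q) = map_st f (proj a q))"

definition ssub_comp ::
  "('p', 'p'', 'q', 'q'') ssub_map \<Rightarrow> ('p, 'p', 'q, 'q') ssub_map \<Rightarrow> ('p, 'p'', 'q, 'q'') ssub_map"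
  (infixl \<open>\<circ>\<^sub>s\<close> 55) where
  "g \<circ>\<^sub>s f = \<lparr>map_tot = map_tot g \<circ> map_tot f, map_st = map_st g \<circ> map_st f\<rparr>"

text \<open>Maps are HOL functions with unspecified values off the carrier, so equality of morphisms with
  domain \<open>a\<close> is agreement on the points of \<open>a\<close>.\<close>

definition ssub_map_eq ::
  "('p, 'i, 'q, 'j) ssub \<Rightarrow> ('p, 'p', 'q, 'q') ssub_map \<Rightarrow> ('p, 'p', 'q, 'q') ssub_map \<Rightarrow> bool" where
  "ssub_map_eq a f g \<longleftrightarrow>
     (\<forall>q\<in>points (tot a). map_tot f q = map_tot g q) \<and>
     (\<forall>m\<in>points (st a). map_st f m = map_st g m)"

definition prod_ssub ::
  "'x set \<Rightarrow> ('x \<Rightarrow> ('p, 'i, 'q, 'j) ssub) \<Rightarrow> ('x \<Rightarrow> 'p, 'x \<times> 'i, 'x \<Rightarrow> 'q, 'x \<times> 'j) ssub" where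
  "prod_ssub X \<tau> = \<lparr>
     tot = prod_mfd X (\<lambda>x. tot (\<tau> x)),
     st = prod_mfd X (\<lambda>x. st (\<tau> x)),
     proj = (\<lambda>q. \<lambda>x\<in>X. proj (\<tau> x) (q x))\<rparr>"

definition prod_proj :: "'x \<Rightarrow> ('x \<Rightarrow> 'p, 'p, 'x \<Rightarrow> 'q, 'q) ssub_map" where
  "prod_proj x = \<lparr>map_tot = (\<lambda>q. q x), map_st = (\<lambda>m. m x)\<rparr>"


section \<open>Open systems\<close>

abbreviation real_field :: "real ring" where
  "real_field \<equiv> class_ring"

text \<open>Open systems are extensional functions on the total space, so that they are determined by their
  values there.  The \<^const>\<open>mult\<close> and \<^const>\<open>one\<close> fields of a module record play no role.\<close>

definition Crl ::
  "('p, 'i, 'q, 'j) ssub \<Rightarrow> (real, 'p \<Rightarrow> ('q, 'j) tangent) module" where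
  "Crl a = \<lparr>
     carrier = {F \<in> extensional (points (tot a)).
        smooth_map (tot a) (tangent_bundle (st a)) F \<and>
        (\<forall>q\<in>points (tot a). fst (F q) = proj a q)},
     monoid.mult = (\<lambda>F G. undefined),
     one = undefined,
     zero = (\<lambda>q\<in>points (tot a). (proj a q, \<lambda>c i. 0)),
     add = (\<lambda>F G. \<lambda>q\<in>points (tot a). (proj a q, \<lambda>c i. snd (F q) c i + snd (G q) c i)),
     module.smult = (\<lambda>r F. \<lambda>q\<in>points (tot a). (proj a q, \<lambda>c i. r * snd (F q) c i))\<rparr>"

definition related ::
  "('p, 'i, 'q, 'j) ssub \<Rightarrow> ('p', 'i', 'q', 'j') ssub \<Rightarrow> ('p, 'p', 'q, 'q') ssub_map \<Rightarrow>
   ('p \<Rightarrow> ('q, 'j) tangent) \<Rightarrow> ('p' \<Rightarrow> ('q', 'j') tangent) \<Rightarrow> bool" where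
  "related a b f F G \<longleftrightarrow>
     (\<forall>q\<in>points (tot a). tangent_map (st a) (st b) (map_st f) (F q) = G (map_tot f q))"

definition Crl_rel ::
  "('p, 'i, 'q, 'j) ssub \<Rightarrow> ('p', 'i', 'q', 'j') ssub \<Rightarrow> ('p, 'p', 'q, 'q') ssub_map \<Rightarrow>
   (('p' \<Rightarrow> ('q', 'j') tangent) \<times> ('p \<Rightarrow> ('q, 'j) tangent)) set" where
  "Crl_rel a b f = {(G, F) \<in> carrier (Crl b) \<times> carrier (Crl a). related a b f F G}"

definition interconnection ::
  "('p, 'i, 'q, 'j) ssub \<Rightarrow> ('p', 'i', 'q', 'j') ssub \<Rightarrow> ('p, 'p', 'q, 'q') ssub_map \<Rightarrow> bool" where
  "interconnection a b \<phi> \<longleftrightarrow>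
     map_of_submersions a b \<phi> \<and> diffeomorphism (st a) (st b) (map_st \<phi>)"

definition pullback ::
  "('p, 'i, 'q, 'j) ssub \<Rightarrow> ('p', 'i', 'q', 'j') ssub \<Rightarrow> ('p, 'p', 'q, 'q') ssub_map \<Rightarrow>
   ('p' \<Rightarrow> ('q', 'j') tangent) \<Rightarrow> 'p \<Rightarrow> ('q, 'j) tangent" where
  "pullback a b \<phi> F = (\<lambda>q\<in>points (tot a).
     inv_into (points (tangent_bundle (st a))) (tangent_map (st a) (st b) (map_st \<phi>))
       (F (map_tot \<phi> q)))"


section \<open>Lists of submersions and networks\<close>

text \<open>Only used for finite \<open>X\<close>, where the direct sum is the full product.\<close>

definition family_sum :: "'x set \<Rightarrow> ('x \<Rightarrow> ('r, 'v) module) \<Rightarrow> ('r, 'x \<Rightarrow> 'v) module" where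
  "family_sum X V = \<lparr>
     carrier = (\<Pi>\<^sub>E x\<in>X. carrier (V x)),
     monoid.mult = (\<lambda>v w. undefined),
     one = undefined,
     zero = (\<lambda>x\<in>X. \<zero>\<^bsub>V x\<^esub>),
     add = (\<lambda>v w. \<lambda>x\<in>X. v x \<oplus>\<^bsub>V x\<^esub> w x),
     module.smult = (\<lambda>r v. \<lambda>x\<in>X. r \<odot>\<^bsub>V x\<^esub> v x)\<rparr>"

definition Crl_sum ::
  "'x set \<Rightarrow> ('x \<Rightarrow> ('p, 'i, 'q, 'j) ssub) \<Rightarrow> (real, 'x \<Rightarrow> 'p \<Rightarrow> ('q, 'j) tangent) module" where
  "Crl_sum X \<tau> = family_sum X (\<lambda>x. Crl (\<tau> x))"

definition list_of_submersions :: "'x set \<Rightarrow> ('x \<Rightarrow> ('p, 'i, 'q, 'j) ssub) \<Rightarrow> bool" where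
  "list_of_submersions X \<tau> \<longleftrightarrow> finite X \<and> (\<forall>x\<in>X. surjective_submersion (\<tau> x))"

definition list_morphism ::
  "'x set \<Rightarrow> ('x \<Rightarrow> ('p, 'i, 'q, 'j) ssub) \<Rightarrow> 'y set \<Rightarrow> ('y \<Rightarrow> ('p', 'i', 'q', 'j') ssub) \<Rightarrow>
   ('x \<Rightarrow> 'y) \<Rightarrow> ('x \<Rightarrow> ('p', 'p, 'q', 'q) ssub_map) \<Rightarrow> bool" where
  "list_morphism X \<tau> Y \<mu> \<phi> \<Phi> \<longleftrightarrow>
     \<phi> \<in> X \<rightarrow> Y \<and> (\<forall>x\<in>X. map_of_submersions (\<mu> (\<phi> x)) (\<tau> x) (\<Phi> x))"

definition list_map ::
  "'x set \<Rightarrow> ('x \<Rightarrow> 'y) \<Rightarrow> ('x \<Rightarrow> ('p', 'p, 'q', 'q) ssub_map) \<Rightarrow>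
   ('y \<Rightarrow> 'p', 'x \<Rightarrow> 'p, 'y \<Rightarrow> 'q', 'x \<Rightarrow> 'q) ssub_map" where
  "list_map X \<phi> \<Phi> = \<lparr>
     map_tot = (\<lambda>q. \<lambda>x\<in>X. map_tot (\<Phi> x) (q (\<phi> x))),
     map_st = (\<lambda>m. \<lambda>x\<in>X. map_st (\<Phi> x) (m (\<phi> x)))\<rparr>"

text \<open>\<open>list_map X \<phi> \<Phi>\<close> is \<open>\<P>(\<phi>, \<Phi>)\<close>: it satisfies the equations
  \<open>\<pi>\<^sub>x \<circ> \<P>(\<phi>, \<Phi>) = \<Phi>(x) \<circ> \<pi>\<^bsub>\<phi>(x)\<^esub>\<close> and is determined by them among maps into the product.\<close>

lemma list_map_proj:
  assumes "x \<in> X"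
  shows "prod_proj x \<circ>\<^sub>s list_map X \<phi> \<Phi> = \<Phi> x \<circ>\<^sub>s prod_proj (\<phi> x)"
  using assms by (simp add: ssub_comp_def list_map_def prod_proj_def fun_eq_iff)

lemma list_map_unique:
  assumes "map_of_submersions (prod_ssub Y \<mu>) (prod_ssub X \<tau>) P"
    and "\<And>x. x \<in> X \<Longrightarrow>
      ssub_map_eq (prod_ssub Y \<mu>) (prod_proj x \<circ>\<^sub>s P) (\<Phi> x \<circ>\<^sub>s prod_proj (\<phi> x))"
  shows "ssub_map_eq (prod_ssub Y \<mu>) P (list_map X \<phi> \<Phi>)"
proof -
  have "map_tot P q = map_tot (list_map X \<phi> \<Phi>) q" if q: "q \<in> points (tot (prod_ssub Y \<mu>))" for q
  proof
    fix x
    have "map_tot P q \<in> (\<Pi>\<^sub>E x\<in>X. points (tot (\<tau> x)))"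
      using assms(1) q
      by (simp add: map_of_submersions_def smooth_map_def prod_ssub_def prod_mfd_def)
    then show "map_tot P q x = map_tot (list_map X \<phi> \<Phi>) q x"
      using assms(2)[of x] q
      by (cases "x \<in> X") (auto simp: ssub_map_eq_def ssub_comp_def prod_proj_def list_map_def PiE_def extensional_def)
  qed
  moreover have "map_st P m = map_st (list_map X \<phi> \<Phi>) m"
    if m: "m \<in> points (st (prod_ssub Y \<mu>))" for m
  proof
    fix x
    have "map_st P m \<in> (\<Pi>\<^sub>E x\<in>X. points (st (\<tau> x)))"
      using assms(1) m
      by (simp add: map_of_submersions_def smooth_map_def prod_ssub_def prod_mfd_def)
    then show "map_st P m x = map_st (list_map X \<phi> \<Phi>) m x"
      using assms(2)[of x] m
      by (cases "x \<in> X") (auto simp: ssub_map_eq_def ssub_comp_def prod_proj_def list_map_def PiE_def extensional_def)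
  qed
  ultimately show ?thesis by (simp add: ssub_map_eq_def)
qed

definition Crl_list ::
  "'x set \<Rightarrow> ('x \<Rightarrow> ('p, 'i, 'q, 'j) ssub) \<Rightarrow>
   ('x \<Rightarrow> 'p \<Rightarrow> ('q, 'j) tangent) \<Rightarrow> ('x \<Rightarrow> 'p) \<Rightarrow> ('x \<Rightarrow> 'q, 'x \<times> 'j) tangent" where
  "Crl_list X \<tau> F = (THE H. H \<in> carrier (Crl (prod_ssub X \<tau>)) \<and>
     (\<forall>x\<in>X. related (prod_ssub X \<tau>) (\<tau> x) (prod_proj x) H (F x)))"

definition odot ::
  "'x set \<Rightarrow> ('x \<Rightarrow> ('p, 'i, 'q, 'j) ssub) \<Rightarrow> 'y set \<Rightarrow> ('y \<Rightarrow> ('p', 'i', 'q', 'j') ssub) \<Rightarrow>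
   ('x \<Rightarrow> 'y) \<Rightarrow> ('x \<Rightarrow> ('p', 'p, 'q', 'q) ssub_map) \<Rightarrow>
   (('x \<Rightarrow> 'p \<Rightarrow> ('q, 'j) tangent) \<times> ('y \<Rightarrow> 'p' \<Rightarrow> ('q', 'j') tangent)) set" where
  "odot X \<tau> Y \<mu> \<phi> \<Phi> = {(F, G) \<in> carrier (Crl_sum X \<tau>) \<times> carrier (Crl_sum Y \<mu>).
     \<forall>x\<in>X. (F x, G (\<phi> x)) \<in> Crl_rel (\<mu> (\<phi> x)) (\<tau> x) (\<Phi> x)}"

definition network ::
  "'x set \<Rightarrow> ('x \<Rightarrow> ('p, 'i, 'q, 'j) ssub) \<Rightarrow> ('pb, 'ib, 'qb, 'jb) ssub \<Rightarrow>
   ('pb, 'x \<Rightarrow> 'p, 'qb, 'x \<Rightarrow> 'q) ssub_map \<Rightarrow> bool" where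
  "network X \<tau> b \<psi> \<longleftrightarrow>
     list_of_submersions X \<tau> \<and> surjective_submersion b \<and> interconnection b (prod_ssub X \<tau>) \<psi>"

definition network_map ::
  "'x set \<Rightarrow> ('x \<Rightarrow> ('p, 'i, 'q, 'j) ssub) \<Rightarrow> ('pb, 'ib, 'qb, 'jb) ssub \<Rightarrow>
   ('pb, 'x \<Rightarrow> 'p, 'qb, 'x \<Rightarrow> 'q) ssub_map \<Rightarrow>
   'y set \<Rightarrow> ('y \<Rightarrow> ('p', 'i', 'q', 'j') ssub) \<Rightarrow> ('pc, 'ic, 'qc, 'jc) ssub \<Rightarrow>
   ('pc, 'y \<Rightarrow> 'p', 'qc, 'y \<Rightarrow> 'q') ssub_map \<Rightarrow>
   ('x \<Rightarrow> 'y) \<Rightarrow> ('x \<Rightarrow> ('p', 'p, 'q', 'q) ssub_map) \<Rightarrow> ('pc, 'pb, 'qc, 'qb) ssub_map \<Rightarrow> bool" where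
  "network_map X \<tau> b \<psi> Y \<mu> c \<nu> \<phi> \<Phi> f \<longleftrightarrow>
     list_morphism X \<tau> Y \<mu> \<phi> \<Phi> \<and> map_of_submersions c b f \<and>
     ssub_map_eq c (\<psi> \<circ>\<^sub>s f) (list_map X \<phi> \<Phi> \<circ>\<^sub>s \<nu>)"


section \<open>Linear relations and 2-cells\<close>

text \<open>A relation from \<open>V\<close> to \<open>W\<close> lives in \<open>W \<times> V\<close>, target first.  In \<open>two_cell\<close>, \<open>R\<close> goes from \<open>V\<close> to \<open>W\<close>
  and \<open>S\<close> from \<open>X\<close> to \<open>Y\<close>.\<close>

definition linear_relation :: "(real, 'v) module \<Rightarrow> (real, 'w) module \<Rightarrow> ('w \<times> 'v) set \<Rightarrow> bool" where
  "linear_relation V W R \<longleftrightarrow> VectorSpace.subspace real_field R (direct_sum W V)"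

definition two_cell ::
  "(real, 'v) module \<Rightarrow> (real, 'w) module \<Rightarrow> (real, 'x) module \<Rightarrow> (real, 'y) module \<Rightarrow>
   ('w \<times> 'v) set \<Rightarrow> ('y \<times> 'x) set \<Rightarrow> ('v \<Rightarrow> 'x) \<Rightarrow> ('w \<Rightarrow> 'y) \<Rightarrow> bool" where
  "two_cell V W X Y R S h g \<longleftrightarrow>
     linear_relation V W R \<and> linear_relation X Y S \<and>
     VectorSpace.linear_map real_field V X h \<and> VectorSpace.linear_map real_field W Y g \<and>
     map_prod g h ` R \<subseteq> S"

end

theory Submission
  imports Defs
begin

text \<open>
  Why the theorem holds.  Both linear maps in the 2-cell produce open systems that are
  \<^emph>\<open>characterised by relatedness\<close>.  A tangent vector of a product manifold is the same thing as a
  family of tangent vectors of the factors, via the maps \<open>T \<pi>\<^sub>x\<close> (\<open>tangent_prod_eqI\<close>,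
  \<open>tangent_prod_exists\<close>), so \<open>Crl_list X \<tau> F\<close> is the unique open system on the product that is
  \<open>\<pi>\<^sub>x\<close>-related to \<open>F x\<close> for all \<open>x\<close>.  For an interconnection \<open>\<psi>\<close> the map \<open>T \<psi>\<^sub>s\<^sub>t\<close> is bijective, so
  \<open>\<psi>\<^sup>* F\<close> is the unique open system that is \<open>\<psi>\<close>-related to \<open>F\<close>.  Relatedness is compatible with sums
  and scalar multiples because tangent maps are linear on fibres; this makes \<open>odot\<close> and \<open>Crl_rel\<close>
  subspaces and, by uniqueness, makes the two maps linear.

  For the inclusion take \<open>(F, G)\<close> in \<open>odot\<close> and a point \<open>q\<close> of the total space of \<open>c\<close>, and write \<open>w\<close> for the
  value of \<open>\<nu>\<^sup>* (Crl_list Y \<mu> G)\<close> at \<open>q\<close>.  The vectors \<open>T f\<^sub>s\<^sub>t w\<close> and \<open>\<psi>\<^sup>* (Crl_list X \<tau> F)\<close> at \<open>f\<^sub>t\<^sub>o\<^sub>t q\<close> have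
  to be compared.  Since \<open>T \<psi>\<^sub>s\<^sub>t\<close> is injective and the \<open>T \<pi>\<^sub>x\<close> are jointly injective, it is enough to
  compare them after applying \<open>T (\<pi>\<^sub>x \<circ> \<psi>\<^sub>s\<^sub>t)\<close>.  The commuting square of the network map turns
  \<open>\<pi>\<^sub>x \<circ> \<psi> \<circ> f\<close> into \<open>\<Phi> x \<circ> \<pi>\<^bsub>\<phi> x\<^esub> \<circ> \<nu>\<close>, so functoriality of \<open>T\<close> carries the first vector to the image of
  \<open>G (\<phi> x)\<close> under \<open>T (\<Phi> x)\<^sub>s\<^sub>t\<close>, which is a value of \<open>F x\<close> by the hypothesis on \<open>(F, G)\<close>; the square on
  total spaces says that it is the value belonging to the second vector (\<open>related_assembly\<close>).

  The rest is the differential geometry that this argument presupposes.  Smoothness is given through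
  iterated partial derivatives in charts, so the multivariate chain rule (\<open>deriv_along_curve\<close>,
  \<open>C_k_compose\<close>, \<open>jacobian_compose\<close>) comes first; it yields that smoothness can be tested in one pair of
  charts around each point (\<open>smooth_map_localI\<close>), that tangent maps do not depend on the chosen chart
  (\<open>tangent_map_chart\<close>) and are functorial (\<open>tangent_map_compose\<close>), and that tangent bundles and finite
  products have compatible atlases.
\<close>


section \<open>Functions with continuous iterated partial derivatives\<close>

definition coord_vecs :: "'i set \<Rightarrow> ('i \<Rightarrow> real) set" where
  "coord_vecs I = {x. \<forall>i. i \<notin> I \<longrightarrow> x i = 0}"

definition smooth_fun :: "'i set \<Rightarrow> ('i \<Rightarrow> real) set \<Rightarrow> (('i \<Rightarrow> real) \<Rightarrow> real) \<Rightarrow> bool" where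
  "smooth_fun I S g \<longleftrightarrow> (\<forall>k. C_k I k S g)"

lemma smooth_coord_iff: "smooth_coord I J S g \<longleftrightarrow> (\<forall>j\<in>J. smooth_fun I S (\<lambda>x. g x j))"
  by (simp add: smooth_coord_def smooth_fun_def)

lemma coord_space_eq: "coord_space I = top_of_set (coord_vecs I)"
  by (simp add: coord_space_def coord_vecs_def euclidean_product_topology)

lemma topspace_coord_space [simp]: "topspace (coord_space I) = coord_vecs I"
  by (simp add: coord_space_eq)

lemma subtopology_coord_space: "S \<subseteq> coord_vecs I \<Longrightarrow> subtopology (coord_space I) S = top_of_set S"
  by (simp add: coord_space_eq subtopology_subtopology inf_absorb2)

lemma open_coord_subset: "openin (coord_space I) S \<Longrightarrow> S \<subseteq> coord_vecs I"
  using openin_subset by fastforce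

lemma coord_vecs_upd: "x \<in> coord_vecs I \<Longrightarrow> i \<in> I \<Longrightarrow> x(i := t) \<in> coord_vecs I"
  by (auto simp: coord_vecs_def)

lemma continuous_on_fun_upd: "continuous_on UNIV (\<lambda>t. (x(i := t)) :: 'i \<Rightarrow> real)"
proof (rule continuous_on_coordinatewise_then_product)
  show "continuous_on UNIV (\<lambda>t. (x(i := t)) j)" for j
    by (cases "j = i") auto
qed

lemma eventually_upd_in_open:
  assumes S: "openin (coord_space I) S" and x: "x \<in> S" and i: "i \<in> I"
  shows "\<forall>\<^sub>F t in nhds (x i). x(i := t) \<in> S"
proof -
  obtain T where T: "open T" "S = coord_vecs I \<inter> T"
    using S by (auto simp: coord_space_eq openin_open)
  have "open ((\<lambda>t. x(i := t)) -` T)"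
    using continuous_on_fun_upd[of x i] T(1) by (simp add: continuous_on_open_vimage)
  moreover have "x i \<in> (\<lambda>t. x(i := t)) -` T" using x T by simp
  ultimately have "\<forall>\<^sub>F t in nhds (x i). t \<in> (\<lambda>t. x(i := t)) -` T"
    by (rule eventually_nhds_in_open)
  then show ?thesis
    by eventually_elim (use T x i in \<open>auto intro: coord_vecs_upd\<close>)
qed

lemma partial_deriv_cong:
  assumes S: "openin (coord_space I) S" and x: "x \<in> S" and i: "i \<in> I"
    and eq: "\<And>y. y \<in> S \<Longrightarrow> g y = h y"
  shows "partial_deriv i g x = partial_deriv i h x"
    and "(\<lambda>t. g (x(i := t))) field_differentiable at (x i) \<longleftrightarrow>
         (\<lambda>t. h (x(i := t))) field_differentiable at (x i)"
proof -
  have ev: "\<forall>\<^sub>F t in nhds (x i). g (x(i := t)) = h (x(i := t))"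
    using eventually_upd_in_open[OF S x i] by eventually_elim (rule eq)
  then show "partial_deriv i g x = partial_deriv i h x"
    unfolding partial_deriv_def by (rule deriv_cong_ev) simp
  show "(\<lambda>t. g (x(i := t))) field_differentiable at (x i) \<longleftrightarrow>
         (\<lambda>t. h (x(i := t))) field_differentiable at (x i)"
    unfolding field_differentiable_def using DERIV_cong_ev[OF refl ev refl] by blast
qed

text \<open>
  A real function here is total, with arbitrary values off \<open>S\<close>.  Difference quotients at a point of an
  open set \<open>S\<close> eventually see only values on \<open>S\<close>, so these arbitrary values do not matter.
\<close>

lemma C_k_cong:
  assumes S: "openin (coord_space I) S" and "\<And>y. y \<in> S \<Longrightarrow> g y = h y"
  shows "C_k I k S g \<longleftrightarrow> C_k I k S h"
  using assms(2)
proof (induction k arbitrary: g h)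
  case 0
  show ?case
    unfolding C_k.simps
    by (intro iffI; erule continuous_map_eq) (simp_all add: 0)
next
  case (Suc k)
  have "continuous_map (subtopology (coord_space I) S) euclideanreal g =
        continuous_map (subtopology (coord_space I) S) euclideanreal h"
    by (intro iffI; erule continuous_map_eq) (simp_all add: Suc.prems)
  moreover have "C_k I k S (partial_deriv i g) = C_k I k S (partial_deriv i h)" if "i \<in> I" for i
    by (rule Suc.IH) (rule partial_deriv_cong(1)[OF S _ that Suc.prems])
  moreover have "(\<lambda>t. g (x(i := t))) field_differentiable at (x i) \<longleftrightarrow>
         (\<lambda>t. h (x(i := t))) field_differentiable at (x i)" if "i \<in> I" "x \<in> S" for x i
    by (rule partial_deriv_cong(2)[OF S that(2,1) Suc.prems])
  ultimately show ?case by simp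
qed

lemma C_k_continuous: "C_k I k S g \<Longrightarrow> S \<subseteq> coord_vecs I \<Longrightarrow> continuous_on S g"
  by (cases k) (simp_all add: subtopology_coord_space)

lemma C_k_subset: "C_k I k S g \<Longrightarrow> S' \<subseteq> S \<Longrightarrow> C_k I k S' g"
proof (induction k arbitrary: g)
  case 0
  then show ?case by (auto intro: continuous_map_from_subtopology_mono)
next
  case (Suc k)
  then show ?case by (auto intro: continuous_map_from_subtopology_mono)
qed

lemma C_k_Suc_imp: "C_k I (Suc k) S g \<Longrightarrow> C_k I k S g"
  by (induction k arbitrary: g) simp_all

text \<open>
  Derivatives are local, and continuity can be pasted along an open cover.
\<close>

lemma C_k_local:
  assumes S: "openin (coord_space I) S"
    and "\<And>x. x \<in> S \<Longrightarrow> \<exists>S'. openin (coord_space I) S' \<and> x \<in> S' \<and> S' \<subseteq> S \<and> C_k I k S' g"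
  shows "C_k I k S g"
  using assms(2)
proof (induction k arbitrary: g)
  case (0 g)
  show ?case
    unfolding C_k.simps
  proof (rule pasting_lemma[where I = "{S'. openin (coord_space I) S' \<and> S' \<subseteq> S \<and> C_k I 0 S' g}"
        and T = "\<lambda>S'. S'" and f = "\<lambda>_. g"])
    fix S' assume "S' \<in> {S'. openin (coord_space I) S' \<and> S' \<subseteq> S \<and> C_k I 0 S' g}"
    then show "openin (subtopology (coord_space I) S) S'"
      "continuous_map (subtopology (subtopology (coord_space I) S) S') euclideanreal g"
      by (auto simp: openin_open_subtopology[OF S] subtopology_subtopology inf_absorb2)
  qed (use 0 in auto)
next
  case (Suc k g)
  have IH: "C_k I k S h" if "\<And>S'. C_k I (Suc k) S' g \<Longrightarrow> C_k I k S' h" for h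
  proof (rule Suc.IH)
    fix x assume "x \<in> S"
    from Suc.prems[OF this] obtain S' where
      "openin (coord_space I) S'" "x \<in> S'" "S' \<subseteq> S" "C_k I (Suc k) S' g" by blast
    then show "\<exists>S'. openin (coord_space I) S' \<and> x \<in> S' \<and> S' \<subseteq> S \<and> C_k I k S' h"
      using that by blast
  qed
  have "C_k I k S g" by (rule IH) (rule C_k_Suc_imp)
  then have "continuous_map (subtopology (coord_space I) S) euclideanreal g"
    by (cases k) simp_all
  moreover have "C_k I k S (partial_deriv i g)" if "i \<in> I" for i
    by (rule IH) (simp add: that)
  moreover have "(\<lambda>t. g (x(i := t))) field_differentiable at (x i)" if "i \<in> I" "x \<in> S" for i x
    using Suc.prems[OF that(2)] that by auto
  ultimately show ?case by simp
qed

lemma partial_deriv_const: "partial_deriv i (\<lambda>_. c) = (\<lambda>_. 0)"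
  by (simp add: partial_deriv_def fun_eq_iff)

lemma C_k_const: "C_k I k S (\<lambda>_. c)"
  by (induction k arbitrary: c) (simp_all add: partial_deriv_const)

lemma partial_deriv_coord: "partial_deriv i (\<lambda>x. x j) = (\<lambda>_. if i = j then 1 else 0)"
  by (auto simp: partial_deriv_def fun_eq_iff)

lemma C_k_coord: "C_k I k S (\<lambda>x. x j)"
proof -
  have *: "continuous_map (subtopology (coord_space I) S) euclideanreal (\<lambda>x. x j)"
    by (auto simp: coord_space_eq subtopology_subtopology continuous_map_iff_continuous
        intro: continuous_on_product_coordinates continuous_on_subset)
  show ?thesis
  proof (cases k)
    case (Suc k')
    have "(\<lambda>t. (x(i := t)) j) field_differentiable at (x i)" for x :: "'a \<Rightarrow> real" and i
      by (cases "j = i") simp_all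
    then show ?thesis using * Suc by (simp add: partial_deriv_coord C_k_const)
  qed (use * in simp)
qed

text \<open>
  Sums and products are treated in one induction, since the derivative of a product is a sum of
  products.
\<close>

lemma C_k_add_mult:
  assumes S: "openin (coord_space I) S"
    and "C_k I k S g" "C_k I k S h"
  shows "C_k I k S (\<lambda>x. g x + h x) \<and> C_k I k S (\<lambda>x. g x * h x)"
  using assms(2,3)
proof (induction k arbitrary: g h)
  case 0
  then show ?case by (simp add: continuous_map_add continuous_map_real_mult)
next
  case (Suc k)
  note gh = C_k_Suc_imp[OF Suc.prems(1)] C_k_Suc_imp[OF Suc.prems(2)]
  have d: "(\<lambda>t. g (x(i := t))) field_differentiable at (x i)"
    "(\<lambda>t. h (x(i := t))) field_differentiable at (x i)" if "x \<in> S" "i \<in> I" for x i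
    using Suc.prems that by auto
  have p1: "partial_deriv i (\<lambda>x. g x + h x) x = partial_deriv i g x + partial_deriv i h x"
    and p2: "partial_deriv i (\<lambda>x. g x * h x) x = g x * partial_deriv i h x + partial_deriv i g x * h x"
    if "x \<in> S" "i \<in> I" for x i
    using deriv_add[OF d[OF that]] deriv_mult[OF d[OF that]]
    by (simp_all add: partial_deriv_def)
  have a1: "C_k I k S (partial_deriv i (\<lambda>x. g x + h x))" if "i \<in> I" for i
    using C_k_cong[OF S p1[OF _ that]] Suc.IH Suc.prems that by auto
  have m1: "C_k I k S (partial_deriv i (\<lambda>x. g x * h x))" if "i \<in> I" for i
    using C_k_cong[OF S p2[OF _ that]] Suc.IH gh Suc.prems that by auto
  have c: "continuous_map (subtopology (coord_space I) S) euclideanreal g"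
    "continuous_map (subtopology (coord_space I) S) euclideanreal h"
    using Suc.prems by simp_all
  show ?case
    unfolding C_k.simps
  proof (intro conjI ballI)
    fix i x assume i: "i \<in> I" and x: "x \<in> S"
    show "(\<lambda>t. g (x(i := t)) + h (x(i := t))) field_differentiable at (x i)"
      by (rule field_differentiable_add[OF d[OF x i]])
    show "(\<lambda>t. g (x(i := t)) * h (x(i := t))) field_differentiable at (x i)"
      by (rule field_differentiable_mult[OF d[OF x i]])
  qed (use c a1 m1 in \<open>simp_all add: continuous_map_add continuous_map_real_mult\<close>)
qed

lemmas C_k_add = C_k_add_mult[THEN conjunct1]
lemmas C_k_mult = C_k_add_mult[THEN conjunct2]

lemma C_k_sum:
  assumes S: "openin (coord_space I) S"
    and "finite A" "\<And>a. a \<in> A \<Longrightarrow> C_k I k S (g a)"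
  shows "C_k I k S (\<lambda>x. \<Sum>a\<in>A. g a x)"
  using assms(2,3)
proof (induction rule: finite_induct)
  case empty
  show ?case by (simp add: C_k_const)
next
  case (insert a A)
  have "C_k I k S (\<lambda>x. g a x + (\<Sum>a\<in>A. g a x))"
    by (rule C_k_add[OF S]) (use insert in auto)
  then show ?case using insert.hyps by simp
qed

text \<open>
  The topology is a product topology over a possibly infinite index type, but inside
  \<open>coord_vecs I\<close> only the finitely many coordinates in \<open>I\<close> vary, so a single radius suffices.
\<close>

lemma open_coord_contains_box:
  assumes I: "finite I" and S: "openin (coord_space I) S" and x: "x \<in> S"
  obtains \<delta> where "\<delta> > 0"
    "\<And>y. y \<in> coord_vecs I \<Longrightarrow> (\<And>i. i \<in> I \<Longrightarrow> \<bar>y i - x i\<bar> < \<delta>) \<Longrightarrow> y \<in> S"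
proof -
  obtain T where T: "openin (product_topology (\<lambda>i::'a. euclideanreal) UNIV) T" "S = coord_vecs I \<inter> T"
    using S by (auto simp: coord_space_eq openin_open euclidean_product_topology)
  obtain W where W: "x \<in> PiE UNIV W" "\<And>i. open (W i)" "PiE UNIV W \<subseteq> T"
    using product_topology_open_contains_basis[OF T(1), of x] x T(2) by auto
  have "\<exists>d>0. \<forall>t. \<bar>t - x i\<bar> < d \<longrightarrow> t \<in> W i" for i
    using W(1,2) open_real[of "W i"] unfolding open_dist dist_real_def by (metis PiE_E UNIV_I)
  then obtain d where d: "\<And>i. d i > 0" "\<And>i t. \<bar>t - x i\<bar> < d i \<Longrightarrow> t \<in> W i" by metis
  define \<delta> where "\<delta> = Min (insert 1 (d ` I))"
  have \<delta>: "\<delta> > 0" "\<And>i. i \<in> I \<Longrightarrow> \<delta> \<le> d i"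
    using I d(1) by (auto simp: \<delta>_def)
  show thesis
  proof (rule that[OF \<delta>(1)])
    fix y assume y: "y \<in> coord_vecs I" "\<And>i. i \<in> I \<Longrightarrow> \<bar>y i - x i\<bar> < \<delta>"
    have "y i \<in> W i" for i
    proof (cases "i \<in> I")
      case True
      then show ?thesis using y(2)[of i] \<delta>(2)[of i] by (intro d(2)) auto
    next
      case False
      then have "y i = x i" using y(1) x open_coord_subset[OF S] by (auto simp: coord_vecs_def)
      then show ?thesis using W(1) by auto
    qed
    then have "y \<in> T" using W(3) by auto
    then show "y \<in> S" using T y by simp
  qed
qed


section \<open>The chain rule\<close>

text \<open>
  The chain rule along a curve, from continuous partial derivatives only.  The coordinates of the
  argument are moved from \<open>\<gamma> t0\<close> to \<open>\<gamma> t\<close> one at a time: \<open>u A t\<close> has already moved those in \<open>A\<close>.  Each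
  such step changes a single coordinate, so the mean value theorem expresses the increment of \<open>g\<close> by
  a partial derivative at a nearby point, and continuity lets that point tend to \<open>\<gamma> t0\<close>.
\<close>

lemma deriv_along_curve:
  assumes J: "finite J" and T: "openin (coord_space J) T" and g: "C_k J 1 T g"
    and x0: "\<gamma> t0 \<in> T"
    and D: "\<And>j. j \<in> J \<Longrightarrow> ((\<lambda>t. \<gamma> t j) has_real_derivative d j) (at t0)"
    and ev: "\<forall>\<^sub>F t in nhds t0. \<gamma> t \<in> coord_vecs J"
  shows "((\<lambda>t. g (\<gamma> t)) has_real_derivative (\<Sum>j\<in>J. partial_deriv j g (\<gamma> t0) * d j)) (at t0)"
proof -
  define x where "x = \<gamma> t0"
  have xJ: "x \<in> coord_vecs J" using open_coord_subset[OF T] x0 x_def by auto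
  define u where "u A t = (\<lambda>j. if j \<in> A then \<gamma> t j else x j)" for A t
  have u_vecs: "u A t \<in> coord_vecs J" if "A \<subseteq> J" for A t
    using that xJ by (auto simp: u_def coord_vecs_def)
  have g_diff: "((\<lambda>s. g (y(j := s))) has_real_derivative partial_deriv j g y) (at (y j))"
    if "y \<in> T" "j \<in> J" for y j
    using g that by (simp add: partial_deriv_def DERIV_deriv_iff_field_differentiable)
  have pd_cont: "continuous_on T (partial_deriv j g)" if "j \<in> J" for j
    using g that open_coord_subset[OF T] by (simp add: subtopology_coord_space)
  have close: "\<forall>\<^sub>F t in at t0. \<forall>j\<in>J. \<bar>\<gamma> t j - x j\<bar> < \<delta>" if "\<delta> > 0" for \<delta>
  proof (rule eventually_ball_finite[OF J], rule ballI)
    fix j assume "j \<in> J"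
    then have "isCont (\<lambda>t. \<gamma> t j) t0" using D DERIV_isCont by blast
    then have "(\<lambda>t. \<gamma> t j) \<midarrow>t0\<rightarrow> x j" by (simp add: isCont_def x_def)
    from tendstoD[OF this that] show "\<forall>\<^sub>F t in at t0. \<bar>\<gamma> t j - x j\<bar> < \<delta>"
      by (simp add: dist_real_def)
  qed
  have step: "((\<lambda>t. g ((u A t)(j := \<gamma> t j)) - g (u A t)) has_real_derivative partial_deriv j g x * d j) (at t0)"
    if A: "A \<subseteq> J" and j: "j \<in> J" "j \<notin> A" for A j
  proof -
    \<comment> \<open>The slope of \<open>g\<close> in direction \<open>j\<close>, completed by its limit where the denominator vanishes, so that
      the increment of \<open>g\<close> is always \<open>q t\<close> times the increment of the coordinate.\<close>
    define q where "q t = (if \<gamma> t j = x j then partial_deriv j g x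
        else (g ((u A t)(j := \<gamma> t j)) - g (u A t)) / (\<gamma> t j - x j))" for t
    have uj: "u A t j = x j" for t using j by (simp add: u_def)
    then have ujupd: "(u A t)(j := x j) = u A t" for t by (simp add: fun_eq_iff)
    have "q \<midarrow>t0\<rightarrow> partial_deriv j g x"
    proof (rule tendstoI)
      fix e :: real assume e: "e > 0"
      define S where "S = {y \<in> T. partial_deriv j g y \<in> ball (partial_deriv j g x) e}"
      have "openin (top_of_set T) S"
        using continuous_openin_preimage_gen[OF pd_cont[OF j(1)] open_ball, of "partial_deriv j g x" e]
        by (simp add: S_def vimage_def Int_def)
      then have "openin (coord_space J) S"
        using T unfolding coord_space_eq by (rule openin_trans)
      moreover have "x \<in> S" using x0 e by (simp add: S_def x_def)
      ultimately obtain \<delta> where \<delta>: "\<delta> > 0"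
        "\<And>y. y \<in> coord_vecs J \<Longrightarrow> (\<And>i. i \<in> J \<Longrightarrow> \<bar>y i - x i\<bar> < \<delta>) \<Longrightarrow> y \<in> S"
        using open_coord_contains_box[OF J] by metis
      show "\<forall>\<^sub>F t in at t0. dist (q t) (partial_deriv j g x) < e"
        using close[OF \<delta>(1)]
      proof eventually_elim
        case (elim t)
        have seg: "(u A t)(j := s) \<in> S" if s: "\<bar>s - x j\<bar> \<le> \<bar>\<gamma> t j - x j\<bar>" for s
        proof (rule \<delta>(2))
          show "(u A t)(j := s) \<in> coord_vecs J" by (rule coord_vecs_upd[OF u_vecs[OF A] j(1)])
          show "\<bar>((u A t)(j := s)) i - x i\<bar> < \<delta>" if i: "i \<in> J" for i
            using elim i j s \<delta>(1) by (fastforce simp: u_def)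
        qed
        show ?case
        proof (cases "\<gamma> t j = x j")
          case True
          then show ?thesis using e by (simp add: q_def)
        next
          case False
          define a where "a = min (\<gamma> t j) (x j)"
          define b where "b = max (\<gamma> t j) (x j)"
          have ab: "a < b" using False by (auto simp: a_def b_def)
          have der: "((\<lambda>s. g ((u A t)(j := s))) has_real_derivative
              partial_deriv j g ((u A t)(j := s))) (at s)" if "a \<le> s" "s \<le> b" for s
          proof -
            have "(u A t)(j := s) \<in> T" using seg[of s] that by (auto simp: S_def a_def b_def)
            from g_diff[OF this j(1)] show ?thesis by simp
          qed
          obtain s where s: "a < s" "s < b"
            "g ((u A t)(j := b)) - g ((u A t)(j := a)) = (b - a) * partial_deriv j g ((u A t)(j := s))"
            using MVT2[OF ab der] by auto
          have "q t = partial_deriv j g ((u A t)(j := s))"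
            using s(3) False unfolding q_def a_def b_def
            by (cases "\<gamma> t j < x j") (auto simp: ujupd field_simps)
          moreover have "(u A t)(j := s) \<in> S"
            using s(1,2) by (intro seg) (auto simp: a_def b_def)
          ultimately show ?thesis by (simp add: S_def dist_commute)
        qed
      qed
    qed
    moreover have "(\<lambda>t. (\<gamma> t j - x j) / (t - t0)) \<midarrow>t0\<rightarrow> d j"
      using D[OF j(1)] by (simp add: has_field_derivative_iff x_def)
    ultimately have lim: "(\<lambda>t. q t * ((\<gamma> t j - x j) / (t - t0))) \<midarrow>t0\<rightarrow> partial_deriv j g x * d j"
      by (rule tendsto_mult)
    have q: "q t * (\<gamma> t j - x j) = g ((u A t)(j := \<gamma> t j)) - g (u A t)" for t
      using ujupd[of t] by (auto simp: q_def)
    have u0: "u A t0 = x" by (auto simp: u_def x_def)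
    have "(\<lambda>t. ((g ((u A t)(j := \<gamma> t j)) - g (u A t)) - (g ((u A t0)(j := \<gamma> t0 j)) - g (u A t0))) / (t - t0))
        = (\<lambda>t. q t * ((\<gamma> t j - x j) / (t - t0)))"
      by (simp add: u0 x_def[symmetric] q[symmetric])
    then show ?thesis using lim by (simp add: has_field_derivative_iff)
  qed
  have tele: "((\<lambda>t. g (u A t)) has_real_derivative (\<Sum>j\<in>A. partial_deriv j g x * d j)) (at t0)"
    if "A \<subseteq> J" for A
    using finite_subset[OF that J] that
  proof (induction rule: finite_induct)
    case empty
    show ?case by (simp add: u_def)
  next
    case (insert j A)
    have "u (insert j A) t = (u A t)(j := \<gamma> t j)" for t by (auto simp: u_def)
    then have "(\<lambda>t. g (u (insert j A) t)) = (\<lambda>t. (g ((u A t)(j := \<gamma> t j)) - g (u A t)) + g (u A t))"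
      by simp
    moreover have "((\<lambda>t. (g ((u A t)(j := \<gamma> t j)) - g (u A t)) + g (u A t)) has_real_derivative
       partial_deriv j g x * d j + (\<Sum>j\<in>A. partial_deriv j g x * d j)) (at t0)"
      using insert by (intro DERIV_add step) auto
    ultimately show ?case using insert.hyps by simp
  qed
  have "\<forall>\<^sub>F t in nhds t0. g (u J t) = g (\<gamma> t)"
    using ev
  proof eventually_elim
    case (elim t)
    have "u J t = \<gamma> t"
      using elim xJ by (auto simp: u_def coord_vecs_def)
    then show ?case by simp
  qed
  from DERIV_cong_ev[OF refl this refl] tele[OF order_refl] show ?thesis by (simp add: x_def)
qed

lemma C_k_le_1: "C_k I (Suc k) S g \<Longrightarrow> C_k I 1 S g"
  using C_k_Suc_imp by (induction k) (auto simp del: C_k.simps)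

lemma partial_deriv_compose:
  assumes J: "finite J" and S: "openin (coord_space I) S" and T: "openin (coord_space J) T"
    and h: "\<And>j. j \<in> J \<Longrightarrow> C_k I 1 S (\<lambda>x. h x j)" and hT: "\<And>x. x \<in> S \<Longrightarrow> h x \<in> T"
    and g: "C_k J 1 T g" and x: "x \<in> S" and i: "i \<in> I"
  shows "((\<lambda>t. g (h (x(i := t)))) has_real_derivative
      (\<Sum>j\<in>J. partial_deriv j g (h x) * partial_deriv i (\<lambda>x. h x j) x)) (at (x i))"
proof -
  have "((\<lambda>t. g (h (x(i := t)))) has_real_derivative
      (\<Sum>j\<in>J. partial_deriv j g (h (x(i := x i))) * partial_deriv i (\<lambda>x. h x j) x)) (at (x i))"
  proof (rule deriv_along_curve[OF J T g])
    show "h (x(i := x i)) \<in> T" using hT x by simp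
    show "((\<lambda>t. h (x(i := t)) j) has_real_derivative partial_deriv i (\<lambda>x. h x j) x) (at (x i))"
      if "j \<in> J" for j
      using h[OF that] x i by (simp add: partial_deriv_def DERIV_deriv_iff_field_differentiable)
    show "\<forall>\<^sub>F t in nhds (x i). h (x(i := t)) \<in> coord_vecs J"
      using eventually_upd_in_open[OF S x i]
      by eventually_elim (use hT open_coord_subset[OF T] in auto)
  qed
  then show ?thesis by simp
qed

text \<open>
  By the chain rule a partial derivative of \<open>g \<circ> h\<close> is a sum of products of functions to which the
  induction hypothesis applies; hence the induction runs over all \<open>g\<close>.
\<close>

lemma C_k_compose:
  assumes J: "finite J" and S: "openin (coord_space I) S" and T: "openin (coord_space J) T"
    and h: "\<And>j. j \<in> J \<Longrightarrow> C_k I k S (\<lambda>x. h x j)" and hT: "\<And>x. x \<in> S \<Longrightarrow> h x \<in> T"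
    and g: "C_k J k T g"
  shows "C_k I k S (\<lambda>x. g (h x))"
  using h g
proof (induction k arbitrary: g)
  case (0 g)
  have "continuous_on S (\<lambda>x. h x j)" for j
  proof (cases "j \<in> J")
    case True
    show ?thesis by (rule C_k_continuous[OF 0(1)[OF True] open_coord_subset[OF S]])
  next
    case False
    then have "\<And>x. x \<in> S \<Longrightarrow> h x j = 0"
      using hT open_coord_subset[OF T] by (auto simp: coord_vecs_def)
    then show ?thesis by (subst continuous_on_cong[OF refl]) auto
  qed
  then have "continuous_on S h" by (rule continuous_on_coordinatewise_then_product)
  moreover have "continuous_on T g" by (rule C_k_continuous[OF 0(2) open_coord_subset[OF T]])
  ultimately have "continuous_on S (\<lambda>x. g (h x))"
    using continuous_on_compose2[of T g S h] hT by blast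
  then show ?case using open_coord_subset[OF S] by (simp add: subtopology_coord_space)
next
  case (Suc k g)
  have h': "C_k I k S (\<lambda>x. h x j)" and h1: "C_k I 1 S (\<lambda>x. h x j)"
    and ph: "\<And>i. i \<in> I \<Longrightarrow> C_k I k S (partial_deriv i (\<lambda>x. h x j))" if "j \<in> J" for j
    using C_k_Suc_imp[OF Suc.prems(1)[OF that]] C_k_le_1[OF Suc.prems(1)[OF that]]
      Suc.prems(1)[OF that] by simp_all
  have g': "C_k J k T g" and g1: "C_k J 1 T g"
    and pg: "\<And>j. j \<in> J \<Longrightarrow> C_k J k T (partial_deriv j g)"
    using C_k_Suc_imp[OF Suc.prems(2)] C_k_le_1[OF Suc.prems(2)] Suc.prems(2) by simp_all
  have der: "((\<lambda>t. g (h (x(i := t)))) has_real_derivative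
      (\<Sum>j\<in>J. partial_deriv j g (h x) * partial_deriv i (\<lambda>x. h x j) x)) (at (x i))"
    if "x \<in> S" "i \<in> I" for x i
    by (rule partial_deriv_compose[OF J S T h1 hT g1 that])
  have "C_k I k S (\<lambda>x. g (h x))" by (rule Suc.IH[OF h' g'])
  then have "continuous_map (subtopology (coord_space I) S) euclideanreal (\<lambda>x. g (h x))"
    using C_k_continuous open_coord_subset[OF S] by (simp add: subtopology_coord_space)
  moreover have "C_k I k S (partial_deriv i (\<lambda>x. g (h x)))" if i: "i \<in> I" for i
  proof -
    have eq: "partial_deriv i (\<lambda>x. g (h x)) x =
        (\<Sum>j\<in>J. partial_deriv j g (h x) * partial_deriv i (\<lambda>x. h x j) x)" if "x \<in> S" for x
      unfolding partial_deriv_def[of i "\<lambda>x. g (h x)"] by (rule DERIV_imp_deriv[OF der[OF that i]])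
    have "C_k I k S (\<lambda>x. \<Sum>j\<in>J. partial_deriv j g (h x) * partial_deriv i (\<lambda>x. h x j) x)"
      by (rule C_k_sum[OF S J], rule C_k_mult[OF S Suc.IH[OF h' pg] ph[OF _ i]])
    then show ?thesis using C_k_cong[OF S eq] by simp
  qed
  moreover have "(\<lambda>t. g (h (x(i := t)))) field_differentiable at (x i)" if "i \<in> I" "x \<in> S" for x i
    using der[OF that(2,1)] unfolding field_differentiable_def by blast
  ultimately show ?case unfolding C_k.simps by blast
qed


section \<open>Smooth maps between coordinate spaces and their Jacobians\<close>

lemma smooth_fun_cong:
  "openin (coord_space I) S \<Longrightarrow> (\<And>y. y \<in> S \<Longrightarrow> g y = h y) \<Longrightarrow> smooth_fun I S g \<longleftrightarrow> smooth_fun I S h"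
  unfolding smooth_fun_def using C_k_cong by blast

lemma smooth_fun_subset: "smooth_fun I S g \<Longrightarrow> S' \<subseteq> S \<Longrightarrow> smooth_fun I S' g"
  unfolding smooth_fun_def using C_k_subset by blast

lemma smooth_fun_local:
  assumes "openin (coord_space I) S"
    and "\<And>x. x \<in> S \<Longrightarrow> \<exists>S'. openin (coord_space I) S' \<and> x \<in> S' \<and> S' \<subseteq> S \<and> smooth_fun I S' g"
  shows "smooth_fun I S g"
  unfolding smooth_fun_def
proof
  fix k show "C_k I k S g"
  proof (rule C_k_local[OF assms(1)])
    fix x assume "x \<in> S"
    from assms(2)[OF this]
    show "\<exists>S'. openin (coord_space I) S' \<and> x \<in> S' \<and> S' \<subseteq> S \<and> C_k I k S' g"
      by (auto simp: smooth_fun_def)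
  qed
qed

lemma smooth_fun_const: "smooth_fun I S (\<lambda>_. c)"
  by (simp add: smooth_fun_def C_k_const)

lemma smooth_fun_coord: "smooth_fun I S (\<lambda>x. x i)"
  by (simp add: smooth_fun_def C_k_coord)

lemma smooth_fun_add:
  "openin (coord_space I) S \<Longrightarrow> smooth_fun I S g \<Longrightarrow> smooth_fun I S h \<Longrightarrow> smooth_fun I S (\<lambda>x. g x + h x)"
  by (simp add: smooth_fun_def C_k_add)

lemma smooth_fun_mult:
  "openin (coord_space I) S \<Longrightarrow> smooth_fun I S g \<Longrightarrow> smooth_fun I S h \<Longrightarrow> smooth_fun I S (\<lambda>x. g x * h x)"
  by (simp add: smooth_fun_def C_k_mult)

lemma smooth_fun_sum:
  "openin (coord_space I) S \<Longrightarrow> finite A \<Longrightarrow> (\<And>a. a \<in> A \<Longrightarrow> smooth_fun I S (g a)) \<Longrightarrow>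
   smooth_fun I S (\<lambda>x. \<Sum>a\<in>A. g a x)"
  by (simp add: smooth_fun_def C_k_sum)

lemma smooth_fun_partial_deriv:
  assumes "smooth_fun I S g" "i \<in> I" shows "smooth_fun I S (partial_deriv i g)"
  unfolding smooth_fun_def
proof
  fix k
  have "C_k I (Suc k) S g" using assms(1) by (simp only: smooth_fun_def)
  then show "C_k I k S (partial_deriv i g)" using assms(2) by simp
qed

lemma smooth_fun_compose:
  assumes "finite J" "openin (coord_space I) S" "openin (coord_space J) T"
    and "smooth_coord I J S h" "\<And>x. x \<in> S \<Longrightarrow> h x \<in> T" "smooth_fun J T g"
  shows "smooth_fun I S (\<lambda>x. g (h x))"
  unfolding smooth_fun_def
proof
  fix k show "C_k I k S (\<lambda>x. g (h x))"
    by (rule C_k_compose[OF assms(1-3) _ assms(5)])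
      (use assms(4,6) in \<open>auto simp: smooth_fun_def smooth_coord_def\<close>)
qed

lemma smooth_coord_compose:
  assumes "finite J" "openin (coord_space I) S" "openin (coord_space J) T"
    and "smooth_coord I J S h" "\<And>x. x \<in> S \<Longrightarrow> h x \<in> T" "smooth_coord J K T g"
  shows "smooth_coord I K S (\<lambda>x. g (h x))"
  unfolding smooth_coord_iff
proof
  fix k assume k: "k \<in> K"
  have gk: "smooth_fun J T (\<lambda>y. g y k)"
    using assms(6)[unfolded smooth_coord_iff] k by (rule bspec)
  show "smooth_fun I S (\<lambda>x. g (h x) k)"
    by (rule smooth_fun_compose[where g = "\<lambda>y. g y k", OF assms(1-4) _ gk]) (rule assms(5))
qed

lemma smooth_coord_cong:
  assumes "openin (coord_space I) S" "\<And>x. x \<in> S \<Longrightarrow> g x = h x"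
  shows "smooth_coord I J S g \<longleftrightarrow> smooth_coord I J S h"
proof -
  have "smooth_fun I S (\<lambda>x. g x j) \<longleftrightarrow> smooth_fun I S (\<lambda>x. h x j)" for j
    by (rule smooth_fun_cong[OF assms(1)]) (simp add: assms(2))
  then show ?thesis by (simp add: smooth_coord_iff)
qed

lemma smooth_coord_eqI:
  "smooth_coord I J S g \<Longrightarrow> openin (coord_space I) S \<Longrightarrow> (\<And>x. x \<in> S \<Longrightarrow> g x = h x) \<Longrightarrow>
   smooth_coord I J S h"
  by (subst (asm) smooth_coord_cong)

lemma smooth_coord_subset:
  assumes "smooth_coord I J S g" "S' \<subseteq> S"
  shows "smooth_coord I J S' g"
  unfolding smooth_coord_iff
proof
  fix j assume "j \<in> J"
  with assms(1) have "smooth_fun I S (\<lambda>x. g x j)" unfolding smooth_coord_iff by (rule bspec)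
  then show "smooth_fun I S' (\<lambda>x. g x j)" using assms(2) by (rule smooth_fun_subset)
qed

lemma smooth_coord_continuous:
  assumes "openin (coord_space I) S" "smooth_coord I J S g" "\<And>x. x \<in> S \<Longrightarrow> g x \<in> coord_vecs J"
  shows "continuous_on S g"
proof (rule continuous_on_coordinatewise_then_product)
  fix j show "continuous_on S (\<lambda>x. g x j)"
  proof (cases "j \<in> J")
    case True
    then have "C_k I 0 S (\<lambda>x. g x j)" using assms(2) unfolding smooth_coord_def by (simp del: C_k.simps)
    then show ?thesis using open_coord_subset[OF assms(1)] by (rule C_k_continuous)
  next
    case False
    then have "\<And>x. x \<in> S \<Longrightarrow> g x j = 0" using assms(3) by (auto simp: coord_vecs_def)
    then show ?thesis by (subst continuous_on_cong[OF refl]) auto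
  qed
qed

lemma jacobian_in_coord_vecs: "jacobian I J g x v \<in> coord_vecs J"
  by (simp add: jacobian_def coord_vecs_def)

lemma jacobian_cong:
  assumes "openin (coord_space I) S" "x \<in> S" "\<And>y. y \<in> S \<Longrightarrow> g y = h y"
  shows "jacobian I J g x v = jacobian I J h x v"
proof
  fix j
  have "partial_deriv i (\<lambda>y. g y j) x = partial_deriv i (\<lambda>y. h y j) x" if "i \<in> I" for i
    by (rule partial_deriv_cong(1)[OF assms(1,2) that]) (simp add: assms(3))
  then show "jacobian I J g x v j = jacobian I J h x v j" by (simp add: jacobian_def)
qed

lemma jacobian_compose:
  assumes "finite J" and S: "openin (coord_space I) S" and "openin (coord_space J) T"
    and h: "smooth_coord I J S h" and "\<And>x. x \<in> S \<Longrightarrow> h x \<in> T" and g: "smooth_coord J K T g"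
    and x: "x \<in> S"
  shows "jacobian I K (\<lambda>x. g (h x)) x v = jacobian J K g (h x) (jacobian I J h x v)"
proof
  fix k
  show "jacobian I K (\<lambda>x. g (h x)) x v k = jacobian J K g (h x) (jacobian I J h x v) k"
  proof (cases "k \<in> K")
    case True
    have eq: "partial_deriv i (\<lambda>x. g (h x) k) x =
        (\<Sum>j\<in>J. partial_deriv j (\<lambda>y. g y k) (h x) * partial_deriv i (\<lambda>x. h x j) x)" if "i \<in> I" for i
    proof -
      have "((\<lambda>t. g (h (x(i := t))) k) has_real_derivative
      (\<Sum>j\<in>J. partial_deriv j (\<lambda>y. g y k) (h x) * partial_deriv i (\<lambda>x. h x j) x)) (at (x i))"
        by (rule partial_deriv_compose[where g = "\<lambda>y. g y k", OF assms(1-3)])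
          (use assms True that in \<open>simp_all add: smooth_coord_def del: C_k.simps One_nat_def\<close>)
      then show ?thesis unfolding partial_deriv_def[of i "\<lambda>x. g (h x) k"] by (rule DERIV_imp_deriv)
    qed
    have "jacobian I K (\<lambda>x. g (h x)) x v k =
       (\<Sum>i\<in>I. \<Sum>j\<in>J. partial_deriv j (\<lambda>y. g y k) (h x) * (partial_deriv i (\<lambda>x. h x j) x * v i))"
      using True by (simp add: jacobian_def eq sum_distrib_right mult.assoc)
    also have "\<dots> = jacobian J K g (h x) (jacobian I J h x v) k"
      using True by (subst sum.swap) (simp add: jacobian_def sum_distrib_left)
    finally show ?thesis .
  qed (simp add: jacobian_def)
qed

lemma jacobian_id:
  assumes I: "finite I" and "openin (coord_space I) S" "x \<in> S" "\<And>y. y \<in> S \<Longrightarrow> g y = y"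
    and v: "v \<in> coord_vecs I"
  shows "jacobian I I g x v = v"
proof -
  have "jacobian I I g x v = jacobian I I (\<lambda>y. y) x v"
    by (rule jacobian_cong[OF assms(2,3)]) (rule assms(4))
  also have "\<dots> = v"
    using v I by (auto simp: jacobian_def partial_deriv_coord fun_eq_iff coord_vecs_def
        if_distrib[of "\<lambda>t. t * _"] cong: if_cong)
  finally show ?thesis .
qed

lemma jacobian_add: "jacobian I J g x (\<lambda>i. v i + w i) = (\<lambda>j. jacobian I J g x v j + jacobian I J g x w j)"
  by (auto simp: jacobian_def fun_eq_iff distrib_left sum.distrib)

lemma jacobian_scale: "jacobian I J g x (\<lambda>i. r * v i) = (\<lambda>j. r * jacobian I J g x v j)"
  by (auto simp: jacobian_def fun_eq_iff sum_distrib_left mult.left_commute)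


section \<open>Manifolds and smooth maps\<close>

lemma open_coord_preimage:
  assumes A: "openin (coord_space I) A" and g: "smooth_coord I J A g"
    and "\<And>x. x \<in> A \<Longrightarrow> g x \<in> coord_vecs J" and S: "openin (coord_space J) S"
  shows "openin (coord_space I) {x \<in> A. g x \<in> S}"
proof -
  have "continuous_on A g" using assms by (intro smooth_coord_continuous)
  then have "continuous_map (top_of_set A) (coord_space J) g"
    using assms(3) by (auto simp: coord_space_eq continuous_map_in_subtopology continuous_map_iff_continuous)
  from openin_continuous_map_preimage[OF this S]
  have "openin (top_of_set A) {x \<in> A. g x \<in> S}" by simp
  then show ?thesis
    using A unfolding coord_space_eq by (rule openin_trans)
qed

text \<open>
  The conditions on charts among the axioms of a manifold.  They are inherited by finite products and
  by tangent bundles.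
\<close>

definition premanifold :: "('p, 'i) mfd \<Rightarrow> bool" where
  "premanifold M \<longleftrightarrow>
     finite (coords M) \<and>
     (\<Union>(U, \<phi>)\<in>atlas M. U) = points M \<and>
     (\<forall>(U, \<phi>)\<in>atlas M. inj_on \<phi> U \<and> openin (coord_space (coords M)) (\<phi> ` U)) \<and>
     (\<forall>(U, \<phi>)\<in>atlas M. \<forall>(V, \<psi>)\<in>atlas M.
        openin (coord_space (coords M)) (\<phi> ` (U \<inter> V)) \<and>
        smooth_coord (coords M) (coords M) (\<phi> ` (U \<inter> V)) (\<lambda>z. \<psi> (inv_into U \<phi> z)))"

lemma manifold_imp_premanifold: "manifold M \<Longrightarrow> premanifold M"
  unfolding manifold_def premanifold_def comp_def by (elim conjE, intro conjI)

lemma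
  assumes "premanifold M"
  shows premanifold_finite: "finite (coords M)"
    and chart_subset: "(U, \<phi>) \<in> atlas M \<Longrightarrow> U \<subseteq> points M"
    and chart_inj: "(U, \<phi>) \<in> atlas M \<Longrightarrow> inj_on \<phi> U"
    and chart_open: "(U, \<phi>) \<in> atlas M \<Longrightarrow> openin (coord_space (coords M)) (\<phi> ` U)"
    and transition_open: "(U, \<phi>) \<in> atlas M \<Longrightarrow> (V, \<psi>) \<in> atlas M \<Longrightarrow>
      openin (coord_space (coords M)) (\<phi> ` (U \<inter> V))"
    and transition_smooth: "(U, \<phi>) \<in> atlas M \<Longrightarrow> (V, \<psi>) \<in> atlas M \<Longrightarrow>
      smooth_coord (coords M) (coords M) (\<phi> ` (U \<inter> V)) (\<lambda>z. \<psi> (inv_into U \<phi> z))"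
  using assms by (auto simp: premanifold_def)

lemma chart_exists:
  assumes "premanifold M" "p \<in> points M"
  obtains U \<phi> where "(U, \<phi>) \<in> atlas M" "p \<in> U"
proof -
  have "p \<in> (\<Union>(U, \<phi>)\<in>atlas M. U)" using assms by (simp add: premanifold_def)
  then show thesis using that by blast
qed

lemma chart_in_coord_vecs:
  "premanifold M \<Longrightarrow> (U, \<phi>) \<in> atlas M \<Longrightarrow> p \<in> U \<Longrightarrow> \<phi> p \<in> coord_vecs (coords M)"
  using open_coord_subset[OF chart_open] by blast

lemma mem_charts_at: "(U, \<phi>) \<in> charts_at M p \<longleftrightarrow> (U, \<phi>) \<in> atlas M \<and> p \<in> U"
  by (simp add: charts_at_def)

lemma openin_mfd:
  assumes M: "premanifold M"
  shows "openin (mfd_topology M) W \<longleftrightarrow>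
    W \<subseteq> points M \<and> (\<forall>(U, \<phi>)\<in>atlas M. openin (coord_space (coords M)) (\<phi> ` (U \<inter> W)))"
proof -
  have "istopology (\<lambda>W. W \<subseteq> points M \<and>
     (\<forall>(U, \<phi>)\<in>atlas M. openin (coord_space (coords M)) (\<phi> ` (U \<inter> W))))"
    unfolding istopology_def
  proof (intro conjI allI impI)
    fix W W'
    assume W: "W \<subseteq> points M \<and> (\<forall>(U, \<phi>)\<in>atlas M. openin (coord_space (coords M)) (\<phi> ` (U \<inter> W)))"
      and W': "W' \<subseteq> points M \<and> (\<forall>(U, \<phi>)\<in>atlas M. openin (coord_space (coords M)) (\<phi> ` (U \<inter> W')))"
    show "W \<inter> W' \<subseteq> points M" using W by blast
    show "\<forall>(U, \<phi>)\<in>atlas M. openin (coord_space (coords M)) (\<phi> ` (U \<inter> (W \<inter> W')))"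
    proof safe
      fix U \<phi> assume c: "(U, \<phi>) \<in> atlas M"
      have "\<phi> ` (U \<inter> (W \<inter> W')) = \<phi> ` (U \<inter> W) \<inter> \<phi> ` (U \<inter> W')"
        using chart_inj[OF M c] by (auto dest: inj_onD)
      then show "openin (coord_space (coords M)) (\<phi> ` (U \<inter> (W \<inter> W')))"
        using W W' c by auto
    qed
  next
    fix \<K>
    assume K: "\<forall>K\<in>\<K>. K \<subseteq> points M \<and>
      (\<forall>(U, \<phi>)\<in>atlas M. openin (coord_space (coords M)) (\<phi> ` (U \<inter> K)))"
    show "\<Union>\<K> \<subseteq> points M" using K by blast
    show "\<forall>(U, \<phi>)\<in>atlas M. openin (coord_space (coords M)) (\<phi> ` (U \<inter> \<Union>\<K>))"
    proof safe
      fix U \<phi> assume c: "(U, \<phi>) \<in> atlas M"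
      have "\<phi> ` (U \<inter> \<Union>\<K>) = \<Union>((\<lambda>K. \<phi> ` (U \<inter> K)) ` \<K>)" by blast
      moreover have "openin (coord_space (coords M)) (\<phi> ` (U \<inter> K))" if "K \<in> \<K>" for K
        using K c that by fast
      then have "openin (coord_space (coords M)) (\<Union>((\<lambda>K. \<phi> ` (U \<inter> K)) ` \<K>))"
        by (intro openin_Union) auto
      ultimately show "openin (coord_space (coords M)) (\<phi> ` (U \<inter> \<Union>\<K>))" by simp
    qed
  qed
  then show ?thesis by (simp add: mfd_topology_def topology_inverse')
qed

lemma topspace_mfd:
  assumes M: "premanifold M"
  shows "topspace (mfd_topology M) = points M"
proof -
  have "openin (mfd_topology M) (points M)"
    using chart_subset[OF M] chart_open[OF M] by (auto simp: openin_mfd[OF M] inf_absorb1)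
  then have "points M \<subseteq> topspace (mfd_topology M)" by (rule openin_subset)
  moreover have "topspace (mfd_topology M) \<subseteq> points M"
    using openin_topspace[of "mfd_topology M"] unfolding openin_mfd[OF M] by (rule conjunct1)
  ultimately show ?thesis by simp
qed

lemma openin_mfd_chart:
  assumes M: "premanifold M" and U: "(U, \<phi>) \<in> atlas M"
  shows "openin (mfd_topology M) U"
proof -
  have "openin (coord_space (coords M)) (\<psi> ` (V \<inter> U))" if "(V, \<psi>) \<in> atlas M" for V \<psi>
    by (rule transition_open[OF M that U])
  then show ?thesis using chart_subset[OF M U] unfolding openin_mfd[OF M] by blast
qed

lemma transition_in_coord_vecs:
  assumes M: "premanifold M" and U: "(U, \<phi>) \<in> atlas M" and V: "(V, \<psi>) \<in> atlas M"
    and z: "z \<in> \<phi> ` (U \<inter> V)"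
  shows "\<psi> (inv_into U \<phi> z) \<in> coord_vecs (coords M)"
proof -
  obtain p where "p \<in> U" "p \<in> V" "z = \<phi> p" using z by blast
  then show ?thesis using chart_inj[OF M U] chart_in_coord_vecs[OF M V] by simp
qed

text \<open>
  Transition maps are homeomorphisms between open sets, so openness near a point can be tested in any
  one chart around it.
\<close>

lemma openin_mfdI:
  assumes M: "premanifold M" and W: "W \<subseteq> points M"
    and loc: "\<And>p. p \<in> W \<Longrightarrow> \<exists>U \<phi> S. (U, \<phi>) \<in> atlas M \<and> p \<in> U \<and>
      openin (coord_space (coords M)) S \<and> \<phi> p \<in> S \<and> S \<subseteq> \<phi> ` (U \<inter> W)"
  shows "openin (mfd_topology M) W"
  unfolding openin_mfd[OF M]
proof (intro conjI W, safe)
  fix V \<psi> assume V: "(V, \<psi>) \<in> atlas M"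
  show "openin (coord_space (coords M)) (\<psi> ` (V \<inter> W))"
  proof (subst openin_subopen, safe)
    fix p assume p: "p \<in> V" "p \<in> W"
    obtain U \<phi> S where U: "(U, \<phi>) \<in> atlas M" "p \<in> U"
      and S: "openin (coord_space (coords M)) S" "\<phi> p \<in> S" "S \<subseteq> \<phi> ` (U \<inter> W)"
      using loc[OF p(2)] by blast
    let ?S' = "{z \<in> \<psi> ` (V \<inter> U). \<phi> (inv_into V \<psi> z) \<in> S}"
    have "openin (coord_space (coords M)) ?S'"
      using transition_in_coord_vecs[OF M V U(1)]
      by (intro open_coord_preimage[OF transition_open[OF M V U(1)] transition_smooth[OF M V U(1)]] S(1))
    moreover have "\<psi> p \<in> ?S'" using p U S chart_inj[OF M V] by auto
    moreover have "?S' \<subseteq> \<psi> ` (V \<inter> W)"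
    proof safe
      fix q assume q: "q \<in> V" "q \<in> U" "\<phi> (inv_into V \<psi> (\<psi> q)) \<in> S"
      then have "\<phi> q \<in> \<phi> ` (U \<inter> W)" using chart_inj[OF M V] S(3) by auto
      then have "q \<in> W" using chart_inj[OF M U(1)] q by (auto dest: inj_onD)
      then show "\<psi> q \<in> \<psi> ` (V \<inter> W)" using q by blast
    qed
    ultimately show "\<exists>T. openin (coord_space (coords M)) T \<and> \<psi> p \<in> T \<and> T \<subseteq> \<psi> ` (V \<inter> W)"
      by blast
  qed
qed

lemma smooth_map_preimage_open:
  assumes M: "premanifold M" and f: "smooth_map M N f" and U: "(U, \<phi>) \<in> atlas M"
    and W: "openin (mfd_topology N) W"
  shows "openin (coord_space (coords M)) (\<phi> ` (U \<inter> f -` W))"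
proof -
  have "openin (mfd_topology M) {p \<in> points M. f p \<in> W}"
    using openin_continuous_map_preimage[OF conjunct1[OF f[unfolded smooth_map_def]] W]
    by (simp add: topspace_mfd[OF M])
  moreover have "U \<inter> {p \<in> points M. f p \<in> W} = U \<inter> f -` W"
    using chart_subset[OF M U] by auto
  ultimately show ?thesis using U unfolding openin_mfd[OF M] by fastforce
qed

lemma smooth_map_chart:
  assumes "smooth_map M N f" "(U, \<phi>) \<in> atlas M" "(V, \<psi>) \<in> atlas N"
  shows "smooth_coord (coords M) (coords N) (\<phi> ` (U \<inter> f -` V)) (\<lambda>z. \<psi> (f (inv_into U \<phi> z)))"
  using assms unfolding smooth_map_def comp_def by blast

lemma smooth_map_points: "smooth_map M N f \<Longrightarrow> p \<in> points M \<Longrightarrow> f p \<in> points N"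
  by (simp add: smooth_map_def)

text \<open>
  The definition of a smooth map refers to all pairs of charts.  One pair around each point suffices:
  composing with transition maps on both sides gives the expression in any other pair, and both
  continuity and smoothness are local.
\<close>

lemma smooth_map_localI:
  assumes M: "premanifold M" and N: "premanifold N"
    and pt: "\<And>p. p \<in> points M \<Longrightarrow> f p \<in> points N"
    and loc: "\<And>p. p \<in> points M \<Longrightarrow> \<exists>U \<phi> V \<psi> S. (U, \<phi>) \<in> atlas M \<and> p \<in> U \<and> (V, \<psi>) \<in> atlas N \<and>
      openin (coord_space (coords M)) S \<and> \<phi> p \<in> S \<and> S \<subseteq> \<phi> ` (U \<inter> f -` V) \<and>
      smooth_coord (coords M) (coords N) S (\<lambda>z. \<psi> (f (inv_into U \<phi> z)))"
  shows "smooth_map M N f"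
proof -
  have preim: "openin (mfd_topology M) {p \<in> points M. f p \<in> W}" if W: "openin (mfd_topology N) W" for W
  proof (rule openin_mfdI[OF M])
    fix p assume p: "p \<in> {p \<in> points M. f p \<in> W}"
    obtain U \<phi> V \<psi> S where U: "(U, \<phi>) \<in> atlas M" "p \<in> U" and V: "(V, \<psi>) \<in> atlas N"
      and S: "openin (coord_space (coords M)) S" "\<phi> p \<in> S" "S \<subseteq> \<phi> ` (U \<inter> f -` V)"
      and sm: "smooth_coord (coords M) (coords N) S (\<lambda>z. \<psi> (f (inv_into U \<phi> z)))"
      using loc[of p] p by blast
    have inv: "\<exists>q\<in>U. z = \<phi> q \<and> inv_into U \<phi> z = q \<and> f q \<in> V" if "z \<in> S" for z
      using that S(3) chart_inj[OF M U(1)] by fastforce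
    let ?S' = "{z \<in> S. \<psi> (f (inv_into U \<phi> z)) \<in> \<psi> ` (V \<inter> W)}"
    have "openin (coord_space (coords M)) ?S'"
    proof (rule open_coord_preimage[OF S(1) sm])
      show "openin (coord_space (coords N)) (\<psi> ` (V \<inter> W))"
        using W V by (auto simp: openin_mfd[OF N])
      show "\<psi> (f (inv_into U \<phi> z)) \<in> coord_vecs (coords N)" if "z \<in> S" for z
        using inv[OF that] chart_in_coord_vecs[OF N V] by auto
    qed
    moreover have "\<phi> p \<in> ?S'"
      using S(2) p inv[OF S(2)] chart_inj[OF M U(1)] U(2) by auto
    moreover have "?S' \<subseteq> \<phi> ` (U \<inter> {p \<in> points M. f p \<in> W})"
    proof
      fix z assume z: "z \<in> ?S'"
      then obtain q where q: "q \<in> U" "z = \<phi> q" "inv_into U \<phi> z = q" "f q \<in> V" using inv by blast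
      then have "\<psi> (f q) \<in> \<psi> ` (V \<inter> W)" using z by simp
      then have "f q \<in> W" using chart_inj[OF N V] q by (auto dest: inj_onD)
      then show "z \<in> \<phi> ` (U \<inter> {p \<in> points M. f p \<in> W})"
        using q chart_subset[OF M U(1)] by blast
    qed
    ultimately show "\<exists>U \<phi> S. (U, \<phi>) \<in> atlas M \<and> p \<in> U \<and> openin (coord_space (coords M)) S \<and>
        \<phi> p \<in> S \<and> S \<subseteq> \<phi> ` (U \<inter> {p \<in> points M. f p \<in> W})"
      using U by blast
  qed auto
  then have cont: "continuous_map (mfd_topology M) (mfd_topology N) f"
    using pt by (auto simp: continuous_map_def topspace_mfd[OF M] topspace_mfd[OF N])
  have "smooth_coord (coords M) (coords N) (\<phi>' ` (U' \<inter> f -` V')) (\<lambda>z. \<psi>' (f (inv_into U' \<phi>' z)))"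
    if U': "(U', \<phi>') \<in> atlas M" and V': "(V', \<psi>') \<in> atlas N" for U' \<phi>' V' \<psi>'
    unfolding smooth_coord_iff
  proof (intro ballI smooth_fun_local)
    note preim_chart = openin_mfd[OF M, THEN iffD1, OF preim, THEN conjunct2]
    have "U' \<inter> {p \<in> points M. f p \<in> V'} = U' \<inter> f -` V'"
      using chart_subset[OF M U'] by auto
    then show open': "openin (coord_space (coords M)) (\<phi>' ` (U' \<inter> f -` V'))"
      using preim_chart[OF openin_mfd_chart[OF N V']] U' by auto
    fix j z assume j: "j \<in> coords N" and "z \<in> \<phi>' ` (U' \<inter> f -` V')"
    then obtain p where p: "p \<in> U'" "f p \<in> V'" "z = \<phi>' p" by auto
    obtain U \<phi> V \<psi> S where U: "(U, \<phi>) \<in> atlas M" "p \<in> U" and V: "(V, \<psi>) \<in> atlas N"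
      and S: "openin (coord_space (coords M)) S" "\<phi> p \<in> S" "S \<subseteq> \<phi> ` (U \<inter> f -` V)"
      and sm: "smooth_coord (coords M) (coords N) S (\<lambda>z. \<psi> (f (inv_into U \<phi> z)))"
      using loc[of p] p chart_subset[OF M U'] by blast
    have inj: "inj_on \<phi>' U'" "inj_on \<phi> U" "inj_on \<psi> V"
      using U' U V chart_inj M N by blast+
    define A where "A = {y \<in> \<phi>' ` (U' \<inter> U). \<phi> (inv_into U' \<phi>' y) \<in> S}"
    define B where "B = A \<inter> \<phi>' ` (U' \<inter> f -` V')"
    have A: "openin (coord_space (coords M)) A"
      unfolding A_def
      by (intro open_coord_preimage[OF transition_open[OF M U' U(1)] transition_smooth[OF M U' U(1)]] S(1)
          transition_in_coord_vecs[OF M U' U(1)])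
    have B: "openin (coord_space (coords M)) B"
      unfolding B_def by (intro openin_Int A open')
    have inB: "\<exists>q. q \<in> U' \<and> q \<in> U \<and> y = \<phi>' q \<and> inv_into U' \<phi>' y = q \<and> inv_into U \<phi> (\<phi> q) = q \<and>
        \<phi> q \<in> S \<and> f q \<in> V \<and> f q \<in> V' \<and> inv_into V \<psi> (\<psi> (f q)) = f q"
      if yB: "y \<in> B" for y
    proof -
      have yAB: "y \<in> \<phi>' ` (U' \<inter> U)" "\<phi> (inv_into U' \<phi>' y) \<in> S" "y \<in> \<phi>' ` (U' \<inter> f -` V')"
        using yB unfolding A_def B_def by blast+
      obtain q where "q \<in> U'" "q \<in> U" "y = \<phi>' q" using yAB(1) by blast
      then have q: "q \<in> U'" "q \<in> U" "y = \<phi>' q" "inv_into U' \<phi>' y = q" "\<phi> q \<in> S"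
        using inj(1) yAB(2) by simp_all
      obtain q' where "q' \<in> U" "f q' \<in> V" "\<phi> q = \<phi> q'" using S(3) q(5) by blast
      then have "f q \<in> V" using inj(2) q(2) by (auto dest: inj_onD)
      moreover obtain q'' where "q'' \<in> U'" "f q'' \<in> V'" "y = \<phi>' q''" using yAB(3) by blast
      then have "f q \<in> V'" using inj(1) q by (auto dest: inj_onD)
      ultimately show ?thesis using q inj by auto
    qed
    have zB: "z \<in> B"
      using p U(2) S(2) inj by (auto simp: A_def B_def)
    let ?t1 = "\<lambda>y. \<phi> (inv_into U' \<phi>' y)" and ?t2 = "\<lambda>y. \<psi>' (inv_into V \<psi> y)"
    have "B \<subseteq> \<phi>' ` (U' \<inter> U)" by (auto simp: A_def B_def)
    then have t1: "smooth_coord (coords M) (coords M) B ?t1"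
      by (rule smooth_coord_subset[OF transition_smooth[OF M U' U(1)]])
    have "smooth_coord (coords M) (coords N) B (\<lambda>y. \<psi> (f (inv_into U \<phi> (?t1 y))))"
      by (rule smooth_coord_compose[OF premanifold_finite[OF M] B S(1) t1 _ sm]) (use inB in fastforce)
    then have "smooth_coord (coords M) (coords N) B (\<lambda>y. ?t2 (\<psi> (f (inv_into U \<phi> (?t1 y)))))"
      by (rule smooth_coord_compose[OF premanifold_finite[OF N] B transition_open[OF N V V'] _ _
            transition_smooth[OF N V V']])
        (use inB in fastforce)
    then have "smooth_coord (coords M) (coords N) B (\<lambda>y. \<psi>' (f (inv_into U' \<phi>' y)))"
      by (rule smooth_coord_eqI[OF _ B]) (use inB in fastforce)
    then show "\<exists>S'. openin (coord_space (coords M)) S' \<and> z \<in> S' \<and> S' \<subseteq> \<phi>' ` (U' \<inter> f -` V') \<and>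
       smooth_fun (coords M) S' (\<lambda>z. \<psi>' (f (inv_into U' \<phi>' z)) j)"
      using B zB j by (intro exI[of _ B]) (auto simp: B_def smooth_coord_iff)
  qed
  then show ?thesis
    using cont pt by (auto simp: smooth_map_def comp_def)
qed

text \<open>
  On \<open>S\<close> the chart expression of \<open>g \<circ> f\<close> is the composite of the chart expressions of \<open>f\<close> and \<open>g\<close>;
  this reduces statements about composite maps to coordinate spaces.
\<close>

lemma smooth_compose_nbhd:
  assumes M: "premanifold M" and N: "premanifold N" and L: "premanifold L"
    and f: "smooth_map M N f" and g: "smooth_map N L g"
    and U: "(U, \<phi>) \<in> atlas M" "p \<in> U" and V: "(V, \<psi>) \<in> atlas N" "f p \<in> V"
    and W: "(W, \<xi>) \<in> atlas L" "g (f p) \<in> W"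
  obtains S where "openin (coord_space (coords M)) S" "\<phi> p \<in> S"
    "S \<subseteq> \<phi> ` (U \<inter> f -` V)" "S \<subseteq> \<phi> ` (U \<inter> (\<lambda>p. g (f p)) -` W)"
    "\<And>z. z \<in> S \<Longrightarrow> \<psi> (f (inv_into U \<phi> z)) \<in> \<psi> ` (V \<inter> g -` W)"
    "\<And>z. z \<in> S \<Longrightarrow> inv_into V \<psi> (\<psi> (f (inv_into U \<phi> z))) = f (inv_into U \<phi> z)"
proof -
  let ?R = "\<psi> ` (V \<inter> g -` W)"
  have R: "openin (coord_space (coords N)) ?R"
    by (rule smooth_map_preimage_open[OF N g V(1) openin_mfd_chart[OF L W(1)]])
  define S where "S = {z \<in> \<phi> ` (U \<inter> f -` V). \<psi> (f (inv_into U \<phi> z)) \<in> ?R}"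
  have inj: "inj_on \<phi> U" "inj_on \<psi> V"
    using chart_inj[OF M U(1)] chart_inj[OF N V(1)] by auto
  have S: "openin (coord_space (coords M)) S"
    unfolding S_def
    by (rule open_coord_preimage[OF smooth_map_preimage_open[OF M f U(1) openin_mfd_chart[OF N V(1)]]
          smooth_map_chart[OF f U(1) V(1)] _ R])
      (use inj chart_in_coord_vecs[OF N V(1)] in auto)
  have inS: "\<exists>q\<in>U. z = \<phi> q \<and> inv_into U \<phi> z = q \<and> f q \<in> V \<and> g (f q) \<in> W \<and>
      inv_into V \<psi> (\<psi> (f q)) = f q" if "z \<in> S" for z
    using that inj by (auto simp: S_def dest: inj_onD)
  show thesis
  proof (rule that[OF S])
    show "\<phi> p \<in> S" using U V W inj by (auto simp: S_def)
    show "S \<subseteq> \<phi> ` (U \<inter> (\<lambda>p. g (f p)) -` W)" using inS by fastforce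
    show "inv_into V \<psi> (\<psi> (f (inv_into U \<phi> z))) = f (inv_into U \<phi> z)" if "z \<in> S" for z
      using inS[OF that] by auto
  qed (auto simp: S_def)
qed

lemma smooth_map_compose:
  assumes M: "premanifold M" and N: "premanifold N" and L: "premanifold L"
    and f: "smooth_map M N f" and g: "smooth_map N L g"
  shows "smooth_map M L (\<lambda>p. g (f p))"
proof (rule smooth_map_localI[OF M L])
  fix p assume p: "p \<in> points M"
  show gfp: "g (f p) \<in> points L" by (rule smooth_map_points[OF g smooth_map_points[OF f p]])
  obtain U \<phi> where U: "(U, \<phi>) \<in> atlas M" "p \<in> U" using chart_exists[OF M p] .
  obtain V \<psi> where V: "(V, \<psi>) \<in> atlas N" "f p \<in> V"
    using chart_exists[OF N smooth_map_points[OF f p]] .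
  obtain W \<xi> where W: "(W, \<xi>) \<in> atlas L" "g (f p) \<in> W"
    using chart_exists[OF L gfp] .
  obtain S where S: "openin (coord_space (coords M)) S" "\<phi> p \<in> S"
    "S \<subseteq> \<phi> ` (U \<inter> f -` V)" "S \<subseteq> \<phi> ` (U \<inter> (\<lambda>p. g (f p)) -` W)"
    and S': "\<And>z. z \<in> S \<Longrightarrow> \<psi> (f (inv_into U \<phi> z)) \<in> \<psi> ` (V \<inter> g -` W)"
      "\<And>z. z \<in> S \<Longrightarrow> inv_into V \<psi> (\<psi> (f (inv_into U \<phi> z))) = f (inv_into U \<phi> z)"
    by (rule smooth_compose_nbhd[OF M N L f g U V W]) blast
  have "smooth_coord (coords M) (coords N) S (\<lambda>z. \<psi> (f (inv_into U \<phi> z)))"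
    using smooth_map_chart[OF f U(1) V(1)] S(3) by (rule smooth_coord_subset)
  then have "smooth_coord (coords M) (coords L) S
      (\<lambda>z. \<xi> (g (inv_into V \<psi> (\<psi> (f (inv_into U \<phi> z))))))"
    by (rule smooth_coord_compose[OF premanifold_finite[OF N] S(1)
          smooth_map_preimage_open[OF N g V(1) openin_mfd_chart[OF L W(1)]] _ _
          smooth_map_chart[OF g V(1) W(1)]])
      (rule S'(1))
  then have "smooth_coord (coords M) (coords L) S (\<lambda>z. \<xi> (g (f (inv_into U \<phi> z))))"
    by (rule smooth_coord_eqI[OF _ S(1)]) (simp add: S'(2))
  then show "\<exists>U \<phi> V \<psi> S. (U, \<phi>) \<in> atlas M \<and> p \<in> U \<and> (V, \<psi>) \<in> atlas L \<and>
      openin (coord_space (coords M)) S \<and> \<phi> p \<in> S \<and> S \<subseteq> \<phi> ` (U \<inter> (\<lambda>p. g (f p)) -` V) \<and>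
      smooth_coord (coords M) (coords L) S (\<lambda>z. \<psi> (g (f (inv_into U \<phi> z))))"
    using U W S by blast
qed

lemma smooth_map_id:
  assumes M: "premanifold M"
  shows "smooth_map M M (\<lambda>p. p)"
proof (rule smooth_map_localI[OF M M])
  fix p assume p: "p \<in> points M"
  obtain U \<phi> where U: "(U, \<phi>) \<in> atlas M" "p \<in> U" using chart_exists[OF M p] .
  have "openin (coord_space (coords M)) (\<phi> ` U)"
    "smooth_coord (coords M) (coords M) (\<phi> ` U) (\<lambda>z. \<phi> (inv_into U \<phi> z))"
    using chart_open[OF M U(1)] transition_smooth[OF M U(1) U(1)] by simp_all
  moreover have "\<phi> ` U \<subseteq> \<phi> ` (U \<inter> (\<lambda>p. p) -` U)" by auto
  ultimately show "\<exists>U \<phi> V \<psi> S. (U, \<phi>) \<in> atlas M \<and> p \<in> U \<and> (V, \<psi>) \<in> atlas M \<and>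
      openin (coord_space (coords M)) S \<and> \<phi> p \<in> S \<and> S \<subseteq> \<phi> ` (U \<inter> (\<lambda>p. p) -` V) \<and>
      smooth_coord (coords M) (coords M) S (\<lambda>z. \<psi> (inv_into U \<phi> z))"
    using U by blast
qed


section \<open>Tangent spaces and tangent maps\<close>

lemma smooth_fun_jacobian:
  assumes I: "finite I" and S: "openin (coord_space K) S" and T: "openin (coord_space I) T"
    and g: "smooth_coord I J T g" and h: "smooth_coord K I S h" and hT: "\<And>z. z \<in> S \<Longrightarrow> h z \<in> T"
    and w: "smooth_coord K I S w" and j: "j \<in> J"
  shows "smooth_fun K S (\<lambda>z. jacobian I J g (h z) (w z) j)"
proof -
  have "smooth_fun K S (\<lambda>z. partial_deriv i (\<lambda>y. g y j) (h z) * w z i)" if i: "i \<in> I" for i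
  proof (rule smooth_fun_mult[OF S])
    have "smooth_fun I T (\<lambda>y. g y j)" using g[unfolded smooth_coord_iff] j by (rule bspec)
    then have pg: "smooth_fun I T (partial_deriv i (\<lambda>y. g y j))" using i by (rule smooth_fun_partial_deriv)
    show "smooth_fun K S (\<lambda>z. partial_deriv i (\<lambda>y. g y j) (h z))"
      by (rule smooth_fun_compose[OF I S T h _ pg]) (rule hT)
    show "smooth_fun K S (\<lambda>z. w z i)" using w[unfolded smooth_coord_iff] i by (rule bspec)
  qed
  then have "smooth_fun K S (\<lambda>z. \<Sum>i\<in>I. partial_deriv i (\<lambda>y. g y j) (h z) * w z i)"
    by (rule smooth_fun_sum[OF S I])
  then show ?thesis using j by (simp add: jacobian_def)
qed

text \<open>
  The chain rule in charts.  Taking \<open>f\<close> or \<open>g\<close> to be the identity gives the behaviour of Jacobians under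
  a change of charts.
\<close>

lemma jacobian_local_compose:
  assumes M: "premanifold M" and N: "premanifold N" and L: "premanifold L"
    and f: "smooth_map M N f" and g: "smooth_map N L g"
    and U: "(U, \<phi>) \<in> atlas M" "p \<in> U" and V: "(V, \<psi>) \<in> atlas N" "f p \<in> V"
    and W: "(W, \<xi>) \<in> atlas L" "g (f p) \<in> W"
  shows "jacobian (coords M) (coords L) (\<lambda>z. \<xi> (g (f (inv_into U \<phi> z)))) (\<phi> p) v =
    jacobian (coords N) (coords L) (\<lambda>y. \<xi> (g (inv_into V \<psi> y))) (\<psi> (f p))
      (jacobian (coords M) (coords N) (\<lambda>z. \<psi> (f (inv_into U \<phi> z))) (\<phi> p) v)"
proof -
  obtain S where S: "openin (coord_space (coords M)) S" "\<phi> p \<in> S"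
    "S \<subseteq> \<phi> ` (U \<inter> f -` V)"
    and S': "\<And>z. z \<in> S \<Longrightarrow> \<psi> (f (inv_into U \<phi> z)) \<in> \<psi> ` (V \<inter> g -` W)"
      "\<And>z. z \<in> S \<Longrightarrow> inv_into V \<psi> (\<psi> (f (inv_into U \<phi> z))) = f (inv_into U \<phi> z)"
    by (rule smooth_compose_nbhd[OF M N L f g U V W]) blast
  have "smooth_coord (coords M) (coords N) S (\<lambda>z. \<psi> (f (inv_into U \<phi> z)))"
    using smooth_map_chart[OF f U(1) V(1)] S(3) by (rule smooth_coord_subset)
  then have "jacobian (coords M) (coords L) (\<lambda>z. \<xi> (g (inv_into V \<psi> (\<psi> (f (inv_into U \<phi> z)))))) (\<phi> p) v =
    jacobian (coords N) (coords L) (\<lambda>y. \<xi> (g (inv_into V \<psi> y))) (\<psi> (f (inv_into U \<phi> (\<phi> p))))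
      (jacobian (coords M) (coords N) (\<lambda>z. \<psi> (f (inv_into U \<phi> z))) (\<phi> p) v)"
    by (rule jacobian_compose[OF premanifold_finite[OF N] S(1)
          smooth_map_preimage_open[OF N g V(1) openin_mfd_chart[OF L W(1)]] _ _
          smooth_map_chart[OF g V(1) W(1)] S(2)])
      (rule S'(1))
  moreover have "jacobian (coords M) (coords L) (\<lambda>z. \<xi> (g (inv_into V \<psi> (\<psi> (f (inv_into U \<phi> z)))))) (\<phi> p) v =
      jacobian (coords M) (coords L) (\<lambda>z. \<xi> (g (f (inv_into U \<phi> z)))) (\<phi> p) v"
    by (rule jacobian_cong[OF S(1,2)]) (simp add: S'(2))
  moreover have "inv_into U \<phi> (\<phi> p) = p" using chart_inj[OF M U(1)] U(2) by simp
  ultimately show ?thesis by simp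
qed

lemma tangent_space_iff:
  "v \<in> tangent_space M p \<longleftrightarrow>
     (\<forall>U \<phi>. \<not> ((U, \<phi>) \<in> atlas M \<and> p \<in> U) \<longrightarrow> v (U, \<phi>) = (\<lambda>i. 0)) \<and>
     (\<forall>U \<phi>. (U, \<phi>) \<in> atlas M \<and> p \<in> U \<longrightarrow> v (U, \<phi>) \<in> coord_vecs (coords M)) \<and>
     (\<forall>U \<phi> V \<psi>. (U, \<phi>) \<in> atlas M \<and> p \<in> U \<longrightarrow> (V, \<psi>) \<in> atlas M \<and> p \<in> V \<longrightarrow>
        v (V, \<psi>) = jacobian (coords M) (coords M) (\<lambda>z. \<psi> (inv_into U \<phi> z)) (\<phi> p) (v (U, \<phi>)))"
  unfolding tangent_space_def charts_at_def comp_def topspace_coord_space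
  by (auto simp: split_paired_all split_beta)

lemma tangent_coherent:
  assumes "v \<in> tangent_space M p" "(U, \<phi>) \<in> atlas M" "p \<in> U" "(V, \<psi>) \<in> atlas M" "p \<in> V"
  shows "v (V, \<psi>) = jacobian (coords M) (coords M) (\<lambda>z. \<psi> (inv_into U \<phi> z)) (\<phi> p) (v (U, \<phi>))"
  using assms unfolding tangent_space_iff by blast

lemma tangent_in_coord_vecs:
  assumes "v \<in> tangent_space M p" "(U, \<phi>) \<in> atlas M" "p \<in> U"
  shows "v (U, \<phi>) \<in> coord_vecs (coords M)"
  using assms unfolding tangent_space_iff by blast

lemma tangent_off_chart:
  assumes "v \<in> tangent_space M p" "\<not> ((U, \<phi>) \<in> atlas M \<and> p \<in> U)"
  shows "v (U, \<phi>) = (\<lambda>i. 0)"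
  using assms unfolding tangent_space_iff by blast

lemma fun_pair_eqI: "(\<And>x y. f (x, y) = g (x, y)) \<Longrightarrow> f = g"
  by auto

lemma tangent_eqI:
  assumes v: "v \<in> tangent_space M p" and w: "w \<in> tangent_space M p"
    and U: "(U, \<phi>) \<in> atlas M" "p \<in> U" and eq: "v (U, \<phi>) = w (U, \<phi>)"
  shows "v = w"
proof (rule fun_pair_eqI)
  fix V \<psi>
  show "v (V, \<psi>) = w (V, \<psi>)"
  proof (cases "(V, \<psi>) \<in> atlas M \<and> p \<in> V")
    case True
    then show ?thesis using tangent_coherent[OF v U] tangent_coherent[OF w U] eq by simp
  next
    case False
    then show ?thesis using tangent_off_chart[OF v] tangent_off_chart[OF w] by simp
  qed
qed

text \<open>
  Coordinates in one chart are propagated to all others by Jacobians; that the resulting family is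
  coherent is the chain rule for three charts.
\<close>

lemma tangent_vector_exists:
  assumes M: "premanifold M" and U: "(U, \<phi>) \<in> atlas M" "p \<in> U" and x: "x \<in> coord_vecs (coords M)"
  obtains v where "v \<in> tangent_space M p" "v (U, \<phi>) = x"
proof -
  define v where "v d = (if d \<in> atlas M \<and> p \<in> fst d
      then jacobian (coords M) (coords M) (\<lambda>z. snd d (inv_into U \<phi> z)) (\<phi> p) x else (\<lambda>i. 0))" for d
  note id = smooth_map_id[OF M]
  have "v \<in> tangent_space M p"
    unfolding tangent_space_iff
  proof (intro conjI allI impI; (elim conjE)?)
    fix V \<psi> V' \<psi>'
    assume V: "(V, \<psi>) \<in> atlas M" "p \<in> V" and V': "(V', \<psi>') \<in> atlas M" "p \<in> V'"
    show "v (V', \<psi>') = jacobian (coords M) (coords M) (\<lambda>z. \<psi>' (inv_into V \<psi> z)) (\<psi> p) (v (V, \<psi>))"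
      using jacobian_local_compose[OF M M M id id U V V', of x] V V' by (simp add: v_def)
  qed (auto simp: v_def jacobian_in_coord_vecs)
  moreover have "v (U, \<phi>) = x"
  proof -
    have "jacobian (coords M) (coords M) (\<lambda>z. \<phi> (inv_into U \<phi> z)) (\<phi> p) x = x"
      by (rule jacobian_id[OF premanifold_finite[OF M] chart_open[OF M U(1)] _ _ x])
        (use U in \<open>auto simp: f_inv_into_f\<close>)
    then show ?thesis using U by (simp add: v_def)
  qed
  ultimately show thesis by (rule that)
qed

lemma tangent_space_add:
  assumes "v \<in> tangent_space M p" "w \<in> tangent_space M p"
  shows "(\<lambda>c i. v c i + w c i) \<in> tangent_space M p"
  unfolding tangent_space_iff
proof (intro conjI allI impI; (elim conjE)?)
  fix U \<phi> V \<psi>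
  assume c: "(U, \<phi>) \<in> atlas M" "p \<in> U" "(V, \<psi>) \<in> atlas M" "p \<in> V"
  show "(\<lambda>i. v (V, \<psi>) i + w (V, \<psi>) i) =
     jacobian (coords M) (coords M) (\<lambda>z. \<psi> (inv_into U \<phi> z)) (\<phi> p) (\<lambda>i. v (U, \<phi>) i + w (U, \<phi>) i)"
    unfolding jacobian_add tangent_coherent[OF assms(1) c] tangent_coherent[OF assms(2) c] ..
next
  fix U \<phi> assume "(U, \<phi>) \<in> atlas M" "p \<in> U"
  then show "(\<lambda>i. v (U, \<phi>) i + w (U, \<phi>) i) \<in> coord_vecs (coords M)"
    using tangent_in_coord_vecs[OF assms(1)] tangent_in_coord_vecs[OF assms(2)] by (simp add: coord_vecs_def)
next
  fix U \<phi> assume c: "\<not> ((U, \<phi>) \<in> atlas M \<and> p \<in> U)"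
  show "(\<lambda>i. v (U, \<phi>) i + w (U, \<phi>) i) = (\<lambda>i. 0)"
    using tangent_off_chart[OF assms(1) c] tangent_off_chart[OF assms(2) c] by simp
qed

lemma tangent_space_scale:
  assumes "v \<in> tangent_space M p"
  shows "(\<lambda>c i. r * v c i) \<in> tangent_space M p"
  unfolding tangent_space_iff
proof (intro conjI allI impI; (elim conjE)?)
  fix U \<phi> V \<psi>
  assume c: "(U, \<phi>) \<in> atlas M" "p \<in> U" "(V, \<psi>) \<in> atlas M" "p \<in> V"
  show "(\<lambda>i. r * v (V, \<psi>) i) =
     jacobian (coords M) (coords M) (\<lambda>z. \<psi> (inv_into U \<phi> z)) (\<phi> p) (\<lambda>i. r * v (U, \<phi>) i)"
    unfolding jacobian_scale tangent_coherent[OF assms(1) c] ..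
next
  fix U \<phi> assume "(U, \<phi>) \<in> atlas M" "p \<in> U"
  then show "(\<lambda>i. r * v (U, \<phi>) i) \<in> coord_vecs (coords M)"
    using tangent_in_coord_vecs[OF assms(1)] by (simp add: coord_vecs_def)
next
  fix U \<phi> assume c: "\<not> ((U, \<phi>) \<in> atlas M \<and> p \<in> U)"
  show "(\<lambda>i. r * v (U, \<phi>) i) = (\<lambda>i. 0)"
    using tangent_off_chart[OF assms(1) c] by simp
qed

lemma tangent_space_zero: "(\<lambda>c i. 0) \<in> tangent_space M p"
  unfolding tangent_space_iff by (auto simp: coord_vecs_def jacobian_def fun_eq_iff)

lemma fst_tangent_map [simp]: "fst (tangent_map M N f w) = f (fst w)"
  by (cases w) (simp add: tangent_map_def)

lemma tangent_map_add:
  "snd (tangent_map M N f (p, \<lambda>c i. v c i + w c i)) =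
   (\<lambda>d j. snd (tangent_map M N f (p, v)) d j + snd (tangent_map M N f (p, w)) d j)"
  by (auto simp: tangent_map_def Let_def jacobian_add fun_eq_iff)

lemma tangent_map_scale:
  "snd (tangent_map M N f (p, \<lambda>c i. r * v c i)) = (\<lambda>d j. r * snd (tangent_map M N f (p, v)) d j)"
  by (auto simp: tangent_map_def Let_def jacobian_scale fun_eq_iff)

lemma tangent_map_zero: "tangent_map M N f (p, \<lambda>c i. 0) = (f p, \<lambda>d j. 0)"
  by (auto simp: tangent_map_def Let_def jacobian_def fun_eq_iff)

lemma tangent_map_off_chart:
  "\<not> ((V, \<psi>) \<in> atlas N \<and> f p \<in> V) \<Longrightarrow> snd (tangent_map M N f (p, v)) (V, \<psi>) = (\<lambda>j. 0)"
  by (auto simp: tangent_map_def charts_at_def)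

text \<open>
  Names the chart that the choice operator in \<open>tangent_map\<close> selects.  It depends on the point alone, so
  it serves all maps and all tangent vectors there.
\<close>

lemma tangent_map_some_chart:
  fixes N :: "('q, 'j) mfd"
  assumes M: "premanifold M" and p: "p \<in> points M"
  obtains U \<phi> where "(U, \<phi>) \<in> atlas M" "p \<in> U"
    "\<And>f V \<psi> v. (V, \<psi>) \<in> atlas N \<Longrightarrow> f p \<in> V \<Longrightarrow> snd (tangent_map M N f (p, v)) (V, \<psi>) =
       jacobian (coords M) (coords N) (\<lambda>z. \<psi> (f (inv_into U \<phi> z))) (\<phi> p) (v (U, \<phi>))"
proof -
  obtain U \<phi> where c: "(SOME c. c \<in> charts_at M p) = (U, \<phi>)" by fastforce
  obtain U' \<phi>' where "(U', \<phi>') \<in> atlas M" "p \<in> U'" using chart_exists[OF M p] .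
  then have "(SOME c. c \<in> charts_at M p) \<in> charts_at M p"
    using someI[of "\<lambda>c. c \<in> charts_at M p" "(U', \<phi>')"] by (simp add: mem_charts_at)
  then have "(U, \<phi>) \<in> atlas M" "p \<in> U" unfolding c mem_charts_at by simp_all
  then show thesis
    by (rule that) (simp add: tangent_map_def c mem_charts_at comp_def)
qed

text \<open>
  Independence of the chosen chart: a tangent vector transforms by the Jacobian of the coordinate
  change, and the chain rule absorbs this Jacobian.
\<close>

lemma tangent_map_chart:
  assumes M: "premanifold M" and N: "premanifold N" and f: "smooth_map M N f"
    and U: "(U, \<phi>) \<in> atlas M" "p \<in> U" and V: "(V, \<psi>) \<in> atlas N" "f p \<in> V"
    and v: "v \<in> tangent_space M p"
  shows "snd (tangent_map M N f (p, v)) (V, \<psi>) =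
    jacobian (coords M) (coords N) (\<lambda>z. \<psi> (f (inv_into U \<phi> z))) (\<phi> p) (v (U, \<phi>))"
proof -
  have p: "p \<in> points M" using chart_subset[OF M U(1)] U(2) by blast
  obtain U0 \<phi>0 where U0: "(U0, \<phi>0) \<in> atlas M" "p \<in> U0"
    and eq: "\<And>f V \<psi> v. (V, \<psi>) \<in> atlas N \<Longrightarrow> f p \<in> V \<Longrightarrow> snd (tangent_map M N f (p, v)) (V, \<psi>) =
       jacobian (coords M) (coords N) (\<lambda>z. \<psi> (f (inv_into U0 \<phi>0 z))) (\<phi>0 p) (v (U0, \<phi>0))"
    by (rule tangent_map_some_chart[OF M p]) blast
  show ?thesis
    unfolding eq[where f = f, OF V] tangent_coherent[OF v U0 U]
    by (rule jacobian_local_compose[OF M M N smooth_map_id[OF M] f U0 U V])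
qed

lemma tangent_map_in:
  assumes M: "premanifold M" and N: "premanifold N" and f: "smooth_map M N f"
    and p: "p \<in> points M" and v: "v \<in> tangent_space M p"
  shows "snd (tangent_map M N f (p, v)) \<in> tangent_space N (f p)"
proof -
  obtain U \<phi> where U: "(U, \<phi>) \<in> atlas M" "p \<in> U" using chart_exists[OF M p] .
  note chart = tangent_map_chart[OF M N f U _ _ v]
  show ?thesis
    unfolding tangent_space_iff
  proof (intro conjI allI impI; (elim conjE)?)
    fix V \<psi> V' \<psi>'
    assume V: "(V, \<psi>) \<in> atlas N" "f p \<in> V" and V': "(V', \<psi>') \<in> atlas N" "f p \<in> V'"
    show "snd (tangent_map M N f (p, v)) (V', \<psi>') =
        jacobian (coords N) (coords N) (\<lambda>z. \<psi>' (inv_into V \<psi> z)) (\<psi> (f p)) (snd (tangent_map M N f (p, v)) (V, \<psi>))"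
      unfolding chart[OF V] chart[OF V']
      by (rule jacobian_local_compose[OF M N N f smooth_map_id[OF N] U V V'])
  qed (simp_all add: tangent_map_off_chart chart jacobian_in_coord_vecs)
qed

lemma points_tangent_bundle: "points (tangent_bundle M) = Sigma (points M) (tangent_space M)"
  by (simp add: tangent_bundle_def)

lemma tangent_map_points:
  assumes M: "premanifold M" and N: "premanifold N" and f: "smooth_map M N f"
    and w: "w \<in> points (tangent_bundle M)"
  shows "tangent_map M N f w \<in> points (tangent_bundle N)"
proof -
  obtain p v where w: "w = (p, v)" "p \<in> points M" "v \<in> tangent_space M p"
    using w unfolding points_tangent_bundle by auto
  have "tangent_map M N f w = (f p, snd (tangent_map M N f (p, v)))"
    by (rule prod_eqI) (simp_all add: w)
  then show ?thesis
    using tangent_map_in[OF M N f w(2,3)] smooth_map_points[OF f w(2)]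
    unfolding points_tangent_bundle by simp
qed

lemma tangent_map_compose:
  assumes M: "premanifold M" and N: "premanifold N" and L: "premanifold L"
    and f: "smooth_map M N f" and g: "smooth_map N L g"
    and w: "w \<in> points (tangent_bundle M)"
  shows "tangent_map M L (\<lambda>p. g (f p)) w = tangent_map N L g (tangent_map M N f w)"
proof (rule prod_eqI)
  obtain p v where w: "w = (p, v)" and p: "p \<in> points M" and v: "v \<in> tangent_space M p"
    using w unfolding points_tangent_bundle by auto
  define v' where "v' = snd (tangent_map M N f (p, v))"
  have Tf: "tangent_map M N f (p, v) = (f p, v')" by (rule prod_eqI) (simp_all add: v'_def)
  have v': "v' \<in> tangent_space N (f p)" unfolding v'_def by (rule tangent_map_in[OF M N f p v])
  note gf = smooth_map_compose[OF M N L f g]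
  obtain U \<phi> where U: "(U, \<phi>) \<in> atlas M" "p \<in> U" using chart_exists[OF M p] .
  obtain V \<psi> where V: "(V, \<psi>) \<in> atlas N" "f p \<in> V"
    using chart_exists[OF N smooth_map_points[OF f p]] .
  show "snd (tangent_map M L (\<lambda>p. g (f p)) w) = snd (tangent_map N L g (tangent_map M N f w))"
  proof (rule fun_pair_eqI)
    fix W \<xi>
    show "snd (tangent_map M L (\<lambda>p. g (f p)) w) (W, \<xi>) = snd (tangent_map N L g (tangent_map M N f w)) (W, \<xi>)"
    proof (cases "(W, \<xi>) \<in> atlas L \<and> g (f p) \<in> W")
      case True
      then have W: "(W, \<xi>) \<in> atlas L" "g (f p) \<in> W" by auto
      show ?thesis
        unfolding w Tf tangent_map_chart[OF N L g V W v'] tangent_map_chart[OF M L gf U W v]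
        unfolding v'_def tangent_map_chart[OF M N f U V v]
        by (rule jacobian_local_compose[OF M N L f g U V W])
    next
      case False
      then show ?thesis by (simp add: w Tf tangent_map_off_chart)
    qed
  qed
qed simp

lemma tangent_map_cong:
  assumes M: "premanifold M" and p: "fst w \<in> points M" and eq: "\<And>q. q \<in> points M \<Longrightarrow> f q = g q"
  shows "tangent_map M N f w = tangent_map M N g w"
proof (rule prod_eqI)
  obtain p v where w: "w = (p, v)" by (cases w)
  then have p: "p \<in> points M" using p by simp
  show "fst (tangent_map M N f w) = fst (tangent_map M N g w)" using p eq w by simp
  show "snd (tangent_map M N f w) = snd (tangent_map M N g w)"
  proof (rule fun_pair_eqI)
    obtain U \<phi> where U: "(U, \<phi>) \<in> atlas M" "p \<in> U"
      and T: "\<And>f V \<psi> v. (V, \<psi>) \<in> atlas N \<Longrightarrow> f p \<in> V \<Longrightarrow> snd (tangent_map M N f (p, v)) (V, \<psi>) =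
       jacobian (coords M) (coords N) (\<lambda>z. \<psi> (f (inv_into U \<phi> z))) (\<phi> p) (v (U, \<phi>))"
      by (rule tangent_map_some_chart[OF M p]) blast
    fix V \<psi>
    show "snd (tangent_map M N f w) (V, \<psi>) = snd (tangent_map M N g w) (V, \<psi>)"
    proof (cases "(V, \<psi>) \<in> atlas N \<and> f p \<in> V")
      case True
      then have V: "(V, \<psi>) \<in> atlas N" "f p \<in> V" "g p \<in> V" using eq[OF p] by auto
      show ?thesis
        unfolding w T[where f = f, OF V(1,2)] T[where f = g, OF V(1,3)]
      proof (rule jacobian_cong[OF chart_open[OF M U(1)]])
        show "\<phi> p \<in> \<phi> ` U" using U(2) by blast
        fix y assume "y \<in> \<phi> ` U"
        then have "inv_into U \<phi> y \<in> points M"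
          using inv_into_into[of y \<phi> U] chart_subset[OF M U(1)] by blast
        then show "\<psi> (f (inv_into U \<phi> y)) = \<psi> (g (inv_into U \<phi> y))" by (simp add: eq)
      qed
    next
      case False
      then show ?thesis using eq[OF p] by (simp add: w tangent_map_off_chart)
    qed
  qed
qed

lemma tangent_map_id:
  assumes M: "premanifold M" and w: "w \<in> points (tangent_bundle M)"
    and eq: "\<And>q. q \<in> points M \<Longrightarrow> f q = q"
  shows "tangent_map M M f w = w"
proof -
  obtain p v where w: "w = (p, v)" and p: "p \<in> points M" and v: "v \<in> tangent_space M p"
    using w unfolding points_tangent_bundle by auto
  obtain U \<phi> where U: "(U, \<phi>) \<in> atlas M" "p \<in> U" using chart_exists[OF M p] .
  note id = smooth_map_id[OF M]
  have "snd (tangent_map M M (\<lambda>q. q) (p, v)) = v"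
  proof (rule tangent_eqI[OF tangent_map_in[OF M M id p v] v U])
    show "snd (tangent_map M M (\<lambda>q. q) (p, v)) (U, \<phi>) = v (U, \<phi>)"
      unfolding tangent_map_chart[OF M M id U U v] by (rule tangent_coherent[OF v U U, symmetric])
  qed
  then have "tangent_map M M (\<lambda>q. q) w = w" by (intro prod_eqI) (simp_all add: w)
  moreover have "tangent_map M M f w = tangent_map M M (\<lambda>q. q) w"
    by (rule tangent_map_cong[OF M]) (simp_all add: w p eq)
  ultimately show ?thesis by simp
qed


section \<open>The tangent bundle\<close>

lemma premanifoldI:
  assumes "finite (coords M)"
    and "\<And>p. p \<in> points M \<Longrightarrow> \<exists>U \<phi>. (U, \<phi>) \<in> atlas M \<and> p \<in> U"
    and "\<And>U \<phi>. (U, \<phi>) \<in> atlas M \<Longrightarrow> U \<subseteq> points M"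
    and "\<And>U \<phi>. (U, \<phi>) \<in> atlas M \<Longrightarrow> inj_on \<phi> U"
    and "\<And>U \<phi>. (U, \<phi>) \<in> atlas M \<Longrightarrow> openin (coord_space (coords M)) (\<phi> ` U)"
    and "\<And>U \<phi> V \<psi>. (U, \<phi>) \<in> atlas M \<Longrightarrow> (V, \<psi>) \<in> atlas M \<Longrightarrow>
      openin (coord_space (coords M)) (\<phi> ` (U \<inter> V))"
    and "\<And>U \<phi> V \<psi>. (U, \<phi>) \<in> atlas M \<Longrightarrow> (V, \<psi>) \<in> atlas M \<Longrightarrow>
      smooth_coord (coords M) (coords M) (\<phi> ` (U \<inter> V)) (\<lambda>z. \<psi> (inv_into U \<phi> z))"
  shows "premanifold M"
  unfolding premanifold_def
proof (intro conjI)
  show "(\<Union>(U, \<phi>)\<in>atlas M. U) = points M"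
    using assms(2,3) by fast
qed (use assms(1,4-7) in \<open>simp_all add: split_paired_all split_beta\<close>)

lemma open_coord_vecs: "openin (coord_space I) (coord_vecs I)"
  using openin_topspace[of "coord_space I"] by simp

lemma open_reindexed_preimage:
  assumes A: "openin (coord_space I) A" and r: "\<And>z. z \<in> coord_vecs K \<Longrightarrow> (\<lambda>i. z (r i)) \<in> coord_vecs I"
  shows "openin (coord_space K) {z \<in> coord_vecs K. (\<lambda>i. z (r i)) \<in> A}"
  by (rule open_coord_preimage[OF open_coord_vecs _ r A]) (simp_all add: smooth_coord_iff smooth_fun_coord)

text \<open>
  The coordinate map that \<open>tangent_bundle\<close> associates with the chart \<open>(U, \<phi>)\<close>.
\<close>

definition bundle_coords :: "'p set \<Rightarrow> ('p \<Rightarrow> 'i \<Rightarrow> real) \<Rightarrow> ('p, 'i) tangent \<Rightarrow> 'i + 'i \<Rightarrow> real" where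
  "bundle_coords U \<phi> = (\<lambda>(p, v). case_sum (\<phi> p) (v (U, \<phi>)))"

lemma coords_tangent_bundle: "coords (tangent_bundle M) = coords M <+> coords M"
  by (simp add: tangent_bundle_def)

lemma atlas_tangent_bundle:
  "(U', \<phi>') \<in> atlas (tangent_bundle M) \<longleftrightarrow>
   (\<exists>U \<phi>. (U, \<phi>) \<in> atlas M \<and> U' = Sigma U (tangent_space M) \<and> \<phi>' = bundle_coords U \<phi>)"
  by (auto simp: tangent_bundle_def bundle_coords_def image_iff split_beta Bex_def)

lemma case_sum_in_coord_vecs:
  "case_sum a b \<in> coord_vecs (I <+> J) \<longleftrightarrow> a \<in> coord_vecs I \<and> b \<in> coord_vecs J"
  by (auto simp: coord_vecs_def split: sum.split)

lemma bundle_coords_image: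
  assumes M: "premanifold M" and U: "(U, \<phi>) \<in> atlas M" and W: "W \<subseteq> U"
  shows "bundle_coords U \<phi> ` Sigma W (tangent_space M) =
    {z \<in> coord_vecs (coords M <+> coords M). (\<lambda>i. z (Inl i)) \<in> \<phi> ` W}"
proof (intro equalityI subsetI)
  fix z assume "z \<in> bundle_coords U \<phi> ` Sigma W (tangent_space M)"
  then obtain p v where p: "p \<in> W" "v \<in> tangent_space M p" "z = case_sum (\<phi> p) (v (U, \<phi>))"
    by (auto simp: bundle_coords_def)
  have "p \<in> U" using p W by blast
  then show "z \<in> {z \<in> coord_vecs (coords M <+> coords M). (\<lambda>i. z (Inl i)) \<in> \<phi> ` W}"
    using p chart_in_coord_vecs[OF M U] tangent_in_coord_vecs[OF p(2) U]
    by (simp add: case_sum_in_coord_vecs)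
next
  fix z assume "z \<in> {z \<in> coord_vecs (coords M <+> coords M). (\<lambda>i. z (Inl i)) \<in> \<phi> ` W}"
  then obtain p where z: "z \<in> coord_vecs (coords M <+> coords M)" and p: "p \<in> W" "(\<lambda>i. z (Inl i)) = \<phi> p"
    by blast
  have "(\<lambda>i. z (Inr i)) \<in> coord_vecs (coords M)" using z by (auto simp: coord_vecs_def)
  then obtain v where v: "v \<in> tangent_space M p" "v (U, \<phi>) = (\<lambda>i. z (Inr i))"
    using tangent_vector_exists[OF M U] W p(1) by blast
  have "z = case_sum (\<phi> p) (v (U, \<phi>))"
    unfolding p(2)[symmetric] v(2) by (auto simp: fun_eq_iff split: sum.split)
  then show "z \<in> bundle_coords U \<phi> ` Sigma W (tangent_space M)"
    using p(1) v(1) by (auto simp: bundle_coords_def)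
qed

lemma bundle_coords_inj:
  assumes M: "premanifold M" and U: "(U, \<phi>) \<in> atlas M"
  shows "inj_on (bundle_coords U \<phi>) (Sigma U (tangent_space M))"
proof (rule inj_onI)
  fix w w' assume w: "w \<in> Sigma U (tangent_space M)" and w': "w' \<in> Sigma U (tangent_space M)"
    and eq: "bundle_coords U \<phi> w = bundle_coords U \<phi> w'"
  obtain p v where pv: "w = (p, v)" "p \<in> U" "v \<in> tangent_space M p" using w by auto
  obtain p' v' where pv': "w' = (p', v')" "p' \<in> U" "v' \<in> tangent_space M p'" using w' by auto
  have e: "case_sum (\<phi> p) (v (U, \<phi>)) k = case_sum (\<phi> p') (v' (U, \<phi>)) k" for k
    using eq by (simp add: bundle_coords_def pv pv')
  have "\<phi> p = \<phi> p'" using e[of "Inl _"] by (simp add: fun_eq_iff)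
  then have p: "p = p'" using chart_inj[OF M U] pv(2) pv'(2) by (auto dest: inj_onD)
  have "v (U, \<phi>) = v' (U, \<phi>)" using e[of "Inr _"] by (simp add: fun_eq_iff)
  then show "w = w'" using tangent_eqI[OF pv(3) _ U pv(2)] pv'(3) p pv(1) pv'(1) by simp
qed

text \<open>
  A coordinate change \<open>t\<close> of \<open>M\<close> induces the coordinate change \<open>(x, w) \<mapsto> (t x, D t x w)\<close> of the bundle
  (the map \<open>?G\<close> below), which is smooth since the partial derivatives of \<open>t\<close> are.
\<close>

lemma premanifold_tangent_bundle:
  assumes M: "premanifold M"
  shows "premanifold (tangent_bundle M)"
proof (rule premanifoldI, unfold coords_tangent_bundle)
  let ?K = "coords M <+> coords M"
  have lft: "(\<lambda>i. z (Inl i)) \<in> coord_vecs (coords M)" if "z \<in> coord_vecs ?K" for z :: "'b + 'b \<Rightarrow> real"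
    using that by (auto simp: coord_vecs_def)
  have img_open: "openin (coord_space ?K) (bundle_coords U \<phi> ` Sigma W (tangent_space M))"
    if "(U, \<phi>) \<in> atlas M" "W \<subseteq> U" "openin (coord_space (coords M)) (\<phi> ` W)" for U \<phi> W
    unfolding bundle_coords_image[OF M that(1,2)] by (rule open_reindexed_preimage[OF that(3) lft])
  show "finite ?K" using premanifold_finite[OF M] by simp
  show "\<exists>U \<phi>. (U, \<phi>) \<in> atlas (tangent_bundle M) \<and> w \<in> U" if w: "w \<in> points (tangent_bundle M)" for w
  proof -
    obtain p v where p: "w = (p, v)" "p \<in> points M" "v \<in> tangent_space M p"
      using w unfolding points_tangent_bundle by auto
    obtain U \<phi> where "(U, \<phi>) \<in> atlas M" "p \<in> U" using chart_exists[OF M p(2)] .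
    then show ?thesis using p unfolding atlas_tangent_bundle by blast
  qed
  fix U' \<phi>' assume U': "(U', \<phi>') \<in> atlas (tangent_bundle M)"
  then obtain U \<phi> where U: "(U, \<phi>) \<in> atlas M" "U' = Sigma U (tangent_space M)" "\<phi>' = bundle_coords U \<phi>"
    unfolding atlas_tangent_bundle by blast
  show "U' \<subseteq> points (tangent_bundle M)"
    using chart_subset[OF M U(1)] by (auto simp: U(2) points_tangent_bundle)
  show inj: "inj_on \<phi>' U'" unfolding U(2,3) by (rule bundle_coords_inj[OF M U(1)])
  show "openin (coord_space ?K) (\<phi>' ` U')"
    unfolding U(2,3) by (rule img_open[OF U(1) order_refl chart_open[OF M U(1)]])
  fix V' \<psi>' assume V': "(V', \<psi>') \<in> atlas (tangent_bundle M)"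
  then obtain V \<psi> where V: "(V, \<psi>) \<in> atlas M" "V' = Sigma V (tangent_space M)" "\<psi>' = bundle_coords V \<psi>"
    unfolding atlas_tangent_bundle by blast
  have Int: "U' \<inter> V' = Sigma (U \<inter> V) (tangent_space M)" unfolding U V by blast
  define D where "D = \<phi>' ` (U' \<inter> V')"
  have D: "openin (coord_space ?K) D"
    unfolding D_def Int U(3) by (rule img_open[OF U(1) Int_lower1 transition_open[OF M U(1) V(1)]])
  then show "openin (coord_space ?K) (\<phi>' ` (U' \<inter> V'))" unfolding D_def .
  let ?t = "\<lambda>x. \<psi> (inv_into U \<phi> x)"
  let ?G = "\<lambda>z. case_sum (?t (\<lambda>i. z (Inl i)))
      (jacobian (coords M) (coords M) ?t (\<lambda>i. z (Inl i)) (\<lambda>i. z (Inr i)))"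
  have G: "?G z = \<psi>' (inv_into U' \<phi>' z)" if z: "z \<in> D" for z
  proof -
    obtain p v where pv: "p \<in> U" "p \<in> V" "v \<in> tangent_space M p" "z = \<phi>' (p, v)"
      using z unfolding D_def Int by auto
    have "inv_into U' \<phi>' z = (p, v)" using inj pv by (simp add: U(2))
    moreover have "inv_into U \<phi> (\<phi> p) = p" using chart_inj[OF M U(1)] pv(1) by simp
    ultimately show ?thesis
      using tangent_coherent[OF pv(3) U(1) pv(1) V(1) pv(2)]
      by (simp add: pv(4) U(3) V(3) bundle_coords_def)
  qed
  have lftD: "(\<lambda>i. z (Inl i)) \<in> \<phi> ` (U \<inter> V)" if "z \<in> D" for z
    using that unfolding D_def Int U(3) bundle_coords_image[OF M U(1) Int_lower1] by blast
  have h: "smooth_coord ?K (coords M) D (\<lambda>z i. z (Inl i))" "smooth_coord ?K (coords M) D (\<lambda>z i. z (Inr i))"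
    by (simp_all add: smooth_coord_iff smooth_fun_coord)
  note T = transition_open[OF M U(1) V(1)] and t = transition_smooth[OF M U(1) V(1)]
  have "smooth_coord ?K (coords M) D (\<lambda>z. ?t (\<lambda>i. z (Inl i)))"
    by (rule smooth_coord_compose[OF premanifold_finite[OF M] D T h(1) _ t]) (rule lftD)
  moreover have "smooth_fun ?K D
      (\<lambda>z. jacobian (coords M) (coords M) ?t (\<lambda>i. z (Inl i)) (\<lambda>i. z (Inr i)) j)" if "j \<in> coords M" for j
    by (rule smooth_fun_jacobian[OF premanifold_finite[OF M] D T t h(1) _ h(2) that]) (rule lftD)
  ultimately have "smooth_coord ?K ?K D ?G"
    unfolding smooth_coord_iff by auto
  then show "smooth_coord ?K ?K (\<phi>' ` (U' \<inter> V')) (\<lambda>z. \<psi>' (inv_into U' \<phi>' z))"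
    unfolding D_def[symmetric] by (rule smooth_coord_eqI[OF _ D]) (rule G)
qed

text \<open>
  The fibre coordinates of a smooth map into a tangent bundle.  The base map \<open>\<pi>\<close> is a separate parameter
  because it is known beforehand in the applications.
\<close>

lemma smooth_section_chart:
  assumes M: "premanifold M" and F: "smooth_map M (tangent_bundle N) F"
    and base: "\<And>p. p \<in> points M \<Longrightarrow> fst (F p) = \<pi> p"
    and U: "(U, \<phi>) \<in> atlas M" and V: "(V, \<psi>) \<in> atlas N"
  shows "smooth_coord (coords M) (coords N) (\<phi> ` (U \<inter> \<pi> -` V)) (\<lambda>z. snd (F (inv_into U \<phi> z)) (V, \<psi>))"
proof -
  have mem: "F p \<in> Sigma V (tangent_space N) \<longleftrightarrow> \<pi> p \<in> V" if "p \<in> U" for p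
  proof -
    have p: "p \<in> points M" using chart_subset[OF M U] that by blast
    show ?thesis
      using smooth_map_points[OF F p] base[OF p]
      unfolding points_tangent_bundle by (cases "F p") auto
  qed
  have "U \<inter> F -` Sigma V (tangent_space N) = U \<inter> \<pi> -` V"
    by (intro equalityI subsetI; simp only: mem Int_iff vimage_eq cong: conj_cong)
  moreover have "(Sigma V (tangent_space N), bundle_coords V \<psi>) \<in> atlas (tangent_bundle N)"
    using V unfolding atlas_tangent_bundle by blast
  from smooth_map_chart[OF F U this]
  have "smooth_coord (coords M) (coords N <+> coords N) (\<phi> ` (U \<inter> F -` Sigma V (tangent_space N)))
    (\<lambda>z. bundle_coords V \<psi> (F (inv_into U \<phi> z)))"
    by (simp add: coords_tangent_bundle)
  ultimately have *: "smooth_coord (coords M) (coords N <+> coords N) (\<phi> ` (U \<inter> \<pi> -` V))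
    (\<lambda>z. bundle_coords V \<psi> (F (inv_into U \<phi> z)))" by simp
  have "bundle_coords V \<psi> w (Inr j) = snd w (V, \<psi>) j" for w j
    by (simp add: bundle_coords_def split_beta)
  then show ?thesis
    unfolding smooth_coord_iff using bspec[OF *[unfolded smooth_coord_iff], of "Inr _"] by auto
qed

text \<open>
  Over a smooth base map \<open>\<pi>\<close> the base coordinates of \<open>F\<close> are smooth, so only the fibre coordinates have
  to be examined.
\<close>

lemma smooth_section_localI:
  assumes M: "premanifold M" and N: "premanifold N" and \<pi>: "smooth_map M N \<pi>"
    and base: "\<And>p. p \<in> points M \<Longrightarrow> fst (F p) = \<pi> p"
    and tan: "\<And>p. p \<in> points M \<Longrightarrow> snd (F p) \<in> tangent_space N (\<pi> p)"
    and loc: "\<And>p. p \<in> points M \<Longrightarrow> \<exists>U \<phi> V \<psi> S. (U, \<phi>) \<in> atlas M \<and> p \<in> U \<and> (V, \<psi>) \<in> atlas N \<and>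
      openin (coord_space (coords M)) S \<and> \<phi> p \<in> S \<and> S \<subseteq> \<phi> ` (U \<inter> \<pi> -` V) \<and>
      smooth_coord (coords M) (coords N) S (\<lambda>z. snd (F (inv_into U \<phi> z)) (V, \<psi>))"
  shows "smooth_map M (tangent_bundle N) F"
proof (rule smooth_map_localI[OF M premanifold_tangent_bundle[OF N]])
  have pt: "F p \<in> Sigma A (tangent_space N)" if "p \<in> points M" "\<pi> p \<in> A" for p A
    using base[OF that(1)] tan[OF that(1)] that(2) by (cases "F p") auto
  fix p assume p: "p \<in> points M"
  show "F p \<in> points (tangent_bundle N)"
    unfolding points_tangent_bundle by (rule pt[OF p smooth_map_points[OF \<pi> p]])
  obtain U \<phi> V \<psi> S where U: "(U, \<phi>) \<in> atlas M" "p \<in> U" and V: "(V, \<psi>) \<in> atlas N"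
    and S: "openin (coord_space (coords M)) S" "\<phi> p \<in> S" "S \<subseteq> \<phi> ` (U \<inter> \<pi> -` V)"
    and sm: "smooth_coord (coords M) (coords N) S (\<lambda>z. snd (F (inv_into U \<phi> z)) (V, \<psi>))"
    using loc[OF p] by blast
  have UM: "U \<subseteq> points M" by (rule chart_subset[OF M U(1)])
  have inv: "inv_into U \<phi> z \<in> points M" if "z \<in> S" for z
    using that S(3) UM inv_into_into[of z \<phi> U] by blast
  have b: "smooth_coord (coords M) (coords N) S (\<lambda>z. \<psi> (\<pi> (inv_into U \<phi> z)))"
    using smooth_map_chart[OF \<pi> U(1) V] S(3) by (rule smooth_coord_subset)
  have "smooth_coord (coords M) (coords N <+> coords N) S
      (\<lambda>z. case_sum (\<psi> (\<pi> (inv_into U \<phi> z))) (snd (F (inv_into U \<phi> z)) (V, \<psi>)))"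
    using b sm unfolding smooth_coord_iff by auto
  then have "smooth_coord (coords M) (coords N <+> coords N) S (\<lambda>z. bundle_coords V \<psi> (F (inv_into U \<phi> z)))"
  proof (rule smooth_coord_eqI[OF _ S(1)])
    fix z assume "z \<in> S"
    then show "case_sum (\<psi> (\<pi> (inv_into U \<phi> z))) (snd (F (inv_into U \<phi> z)) (V, \<psi>)) =
        bundle_coords V \<psi> (F (inv_into U \<phi> z))"
      using base[OF inv] by (simp add: bundle_coords_def split_beta)
  qed
  moreover have "(Sigma V (tangent_space N), bundle_coords V \<psi>) \<in> atlas (tangent_bundle N)"
    using V unfolding atlas_tangent_bundle by blast
  moreover have "S \<subseteq> \<phi> ` (U \<inter> F -` Sigma V (tangent_space N))"
  proof
    fix z assume "z \<in> S"
    then obtain q where q: "q \<in> U" "z = \<phi> q" "\<pi> q \<in> V" using S(3) by blast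
    have "q \<in> points M" using q(1) UM by blast
    from pt[OF this q(3)] show "z \<in> \<phi> ` (U \<inter> F -` Sigma V (tangent_space N))"
      using q(1,2) by blast
  qed
  ultimately show "\<exists>U \<phi> V \<psi> S. (U, \<phi>) \<in> atlas M \<and> p \<in> U \<and> (V, \<psi>) \<in> atlas (tangent_bundle N) \<and>
      openin (coord_space (coords M)) S \<and> \<phi> p \<in> S \<and> S \<subseteq> \<phi> ` (U \<inter> F -` V) \<and>
      smooth_coord (coords M) (coords (tangent_bundle N)) S (\<lambda>z. \<psi> (F (inv_into U \<phi> z)))"
    unfolding coords_tangent_bundle using U S(1,2) by blast
qed

lemma smooth_sectionI:
  assumes M: "premanifold M" and N: "premanifold N" and \<pi>: "smooth_map M N \<pi>"
    and base: "\<And>p. p \<in> points M \<Longrightarrow> fst (F p) = \<pi> p"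
    and tan: "\<And>p. p \<in> points M \<Longrightarrow> snd (F p) \<in> tangent_space N (\<pi> p)"
    and ch: "\<And>U \<phi> V \<psi>. (U, \<phi>) \<in> atlas M \<Longrightarrow> (V, \<psi>) \<in> atlas N \<Longrightarrow>
      openin (coord_space (coords M)) (\<phi> ` (U \<inter> \<pi> -` V)) \<Longrightarrow>
      smooth_coord (coords M) (coords N) (\<phi> ` (U \<inter> \<pi> -` V)) (\<lambda>z. snd (F (inv_into U \<phi> z)) (V, \<psi>))"
  shows "smooth_map M (tangent_bundle N) F"
proof (rule smooth_section_localI[OF M N \<pi> base tan])
  fix p assume p: "p \<in> points M"
  obtain U \<phi> where U: "(U, \<phi>) \<in> atlas M" "p \<in> U" using chart_exists[OF M p] .
  obtain V \<psi> where V: "(V, \<psi>) \<in> atlas N" "\<pi> p \<in> V"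
    using chart_exists[OF N smooth_map_points[OF \<pi> p]] .
  have "openin (coord_space (coords M)) (\<phi> ` (U \<inter> \<pi> -` V))"
    by (rule smooth_map_preimage_open[OF M \<pi> U(1) openin_mfd_chart[OF N V(1)]])
  moreover note ch[OF U(1) V(1) this]
  moreover have "\<phi> p \<in> \<phi> ` (U \<inter> \<pi> -` V)" using U V by blast
  ultimately show "\<exists>U \<phi> V \<psi> S. (U, \<phi>) \<in> atlas M \<and> p \<in> U \<and> (V, \<psi>) \<in> atlas N \<and>
      openin (coord_space (coords M)) S \<and> \<phi> p \<in> S \<and> S \<subseteq> \<phi> ` (U \<inter> \<pi> -` V) \<and>
      smooth_coord (coords M) (coords N) S (\<lambda>z. snd (F (inv_into U \<phi> z)) (V, \<psi>))"
    using U V(1) by blast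
qed

text \<open>
  In charts \<open>T g \<circ> F\<close> is \<open>D g (x p) (w p)\<close>, where the base point \<open>x p\<close> and the vector \<open>w p\<close> both depend
  smoothly on \<open>p\<close>.
\<close>

lemma smooth_tangent_map_section:
  assumes M: "premanifold M" and N: "premanifold N" and L: "premanifold L"
    and \<pi>: "smooth_map M N \<pi>" and g: "smooth_map N L g"
    and F: "smooth_map M (tangent_bundle N) F"
    and base: "\<And>p. p \<in> points M \<Longrightarrow> fst (F p) = \<pi> p"
  shows "smooth_map M (tangent_bundle L) (\<lambda>p. tangent_map N L g (F p))"
proof -
  have Fp: "F p = (\<pi> p, snd (F p))" "snd (F p) \<in> tangent_space N (\<pi> p)" if "p \<in> points M" for p
    using smooth_map_points[OF F that] base[OF that]
    unfolding points_tangent_bundle by (cases "F p"; auto)+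
  show ?thesis
  proof (rule smooth_section_localI[OF M L smooth_map_compose[OF M N L \<pi> g]])
    fix p assume p: "p \<in> points M"
    show "fst (tangent_map N L g (F p)) = g (\<pi> p)" using base[OF p] by simp
    show "snd (tangent_map N L g (F p)) \<in> tangent_space L (g (\<pi> p))"
      using tangent_map_in[OF N L g smooth_map_points[OF \<pi> p] Fp(2)[OF p]]
      unfolding Fp(1)[OF p, symmetric] .
    obtain U \<phi> where U: "(U, \<phi>) \<in> atlas M" "p \<in> U" using chart_exists[OF M p] .
    obtain V \<psi> where V: "(V, \<psi>) \<in> atlas N" "\<pi> p \<in> V"
      using chart_exists[OF N smooth_map_points[OF \<pi> p]] .
    obtain W \<xi> where W: "(W, \<xi>) \<in> atlas L" "g (\<pi> p) \<in> W"
      using chart_exists[OF L smooth_map_points[OF g smooth_map_points[OF \<pi> p]]] .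
    let ?R = "\<psi> ` (V \<inter> g -` W)"
    obtain S where S: "openin (coord_space (coords M)) S" "\<phi> p \<in> S"
      "S \<subseteq> \<phi> ` (U \<inter> \<pi> -` V)" "S \<subseteq> \<phi> ` (U \<inter> (\<lambda>p. g (\<pi> p)) -` W)"
      and S': "\<And>z. z \<in> S \<Longrightarrow> \<psi> (\<pi> (inv_into U \<phi> z)) \<in> ?R"
      by (rule smooth_compose_nbhd[OF M N L \<pi> g U V W]) blast
    let ?g = "\<lambda>y. \<xi> (g (inv_into V \<psi> y))"
    have h: "smooth_coord (coords M) (coords N) S (\<lambda>z. \<psi> (\<pi> (inv_into U \<phi> z)))"
      using smooth_map_chart[OF \<pi> U(1) V(1)] S(3) by (rule smooth_coord_subset)
    have "smooth_coord (coords M) (coords N) (\<phi> ` (U \<inter> \<pi> -` V)) (\<lambda>z. snd (F (inv_into U \<phi> z)) (V, \<psi>))"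
      by (rule smooth_section_chart[OF M F _ U(1) V(1)]) (rule base)
    then have w: "smooth_coord (coords M) (coords N) S (\<lambda>z. snd (F (inv_into U \<phi> z)) (V, \<psi>))"
      using S(3) by (rule smooth_coord_subset)
    have "smooth_coord (coords M) (coords L) S (\<lambda>z. jacobian (coords N) (coords L) ?g
        (\<psi> (\<pi> (inv_into U \<phi> z))) (snd (F (inv_into U \<phi> z)) (V, \<psi>)))"
      unfolding smooth_coord_iff
    proof
      fix j assume j: "j \<in> coords L"
      show "smooth_fun (coords M) S (\<lambda>z. jacobian (coords N) (coords L) ?g
        (\<psi> (\<pi> (inv_into U \<phi> z))) (snd (F (inv_into U \<phi> z)) (V, \<psi>)) j)"
        by (rule smooth_fun_jacobian[OF premanifold_finite[OF N] S(1)
              smooth_map_preimage_open[OF N g V(1) openin_mfd_chart[OF L W(1)]]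
              smooth_map_chart[OF g V(1) W(1)] h _ w j])
          (rule S')
    qed
    then have "smooth_coord (coords M) (coords L) S (\<lambda>z. snd (tangent_map N L g (F (inv_into U \<phi> z))) (W, \<xi>))"
    proof (rule smooth_coord_eqI[OF _ S(1)])
      fix z assume z: "z \<in> S"
      obtain q where q: "q \<in> U" "z = \<phi> q" "\<pi> q \<in> V" using z S(3) by blast
      obtain q' where q': "q' \<in> U" "z = \<phi> q'" "g (\<pi> q') \<in> W" using z S(4) by blast
      have inj: "inj_on \<phi> U" by (rule chart_inj[OF M U(1)])
      have "q' = q" using inj q q' by (auto dest: inj_onD)
      moreover have inv: "inv_into U \<phi> z = q" using inj q by simp
      moreover have qM: "q \<in> points M" using q(1) chart_subset[OF M U(1)] by blast
      ultimately show "jacobian (coords N) (coords L) ?g (\<psi> (\<pi> (inv_into U \<phi> z)))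
          (snd (F (inv_into U \<phi> z)) (V, \<psi>)) = snd (tangent_map N L g (F (inv_into U \<phi> z))) (W, \<xi>)"
        using tangent_map_chart[OF N L g V(1) q(3) W(1) _ Fp(2)[OF qM]] q'(3)
        unfolding Fp(1)[OF qM, symmetric] by simp
    qed
    then show "\<exists>U \<phi> V \<psi> S. (U, \<phi>) \<in> atlas M \<and> p \<in> U \<and> (V, \<psi>) \<in> atlas L \<and>
      openin (coord_space (coords M)) S \<and> \<phi> p \<in> S \<and> S \<subseteq> \<phi> ` (U \<inter> (\<lambda>p. g (\<pi> p)) -` V) \<and>
      smooth_coord (coords M) (coords L) S (\<lambda>z. snd (tangent_map N L g (F (inv_into U \<phi> z))) (V, \<psi>))"
      using U W(1) S by blast
  qed
qed


section \<open>Finite products of manifolds\<close>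

text \<open>
  The coordinate map of the product of the charts \<open>c x\<close>.
\<close>

definition prod_coords :: "'x set \<Rightarrow> ('x \<Rightarrow> ('p, 'i) chart) \<Rightarrow> ('x \<Rightarrow> 'p) \<Rightarrow> 'x \<times> 'i \<Rightarrow> real" where
  "prod_coords X c = (\<lambda>q (x, i). if x \<in> X then snd (c x) (q x) i else 0)"

lemma points_prod_mfd: "points (prod_mfd X M) = (\<Pi>\<^sub>E x\<in>X. points (M x))"
  and coords_prod_mfd: "coords (prod_mfd X M) = Sigma X (\<lambda>x. coords (M x))"
  by (simp_all add: prod_mfd_def)

lemma atlas_prod_mfd:
  "(U, \<phi>) \<in> atlas (prod_mfd X M) \<longleftrightarrow>
   (\<exists>c\<in>(\<Pi>\<^sub>E x\<in>X. atlas (M x)). U = (\<Pi>\<^sub>E x\<in>X. fst (c x)) \<and> \<phi> = prod_coords X c)"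
  by (auto simp: prod_mfd_def prod_coords_def)

locale mfd_product =
  fixes X :: "'x set" and M :: "'x \<Rightarrow> ('p, 'i) mfd"
  assumes finite_X: "finite X" and factor: "\<And>x. x \<in> X \<Longrightarrow> premanifold (M x)"
begin

lemma factor_chart: "c \<in> (\<Pi>\<^sub>E x\<in>X. atlas (M x)) \<Longrightarrow> x \<in> X \<Longrightarrow> (fst (c x), snd (c x)) \<in> atlas (M x)"
  by auto

text \<open>
  Product charts turn boxes into boxes.  Openness of chart domains, of overlaps and of their images all
  follow from this description.
\<close>

lemma prod_coords_image:
  assumes c: "c \<in> (\<Pi>\<^sub>E x\<in>X. atlas (M x))" and W: "\<And>x. x \<in> X \<Longrightarrow> W x \<subseteq> fst (c x)"
  shows "prod_coords X c ` (\<Pi>\<^sub>E x\<in>X. W x) =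
    {z \<in> coord_vecs (Sigma X (\<lambda>x. coords (M x))). \<forall>x\<in>X. (\<lambda>i. z (x, i)) \<in> snd (c x) ` W x}"
proof (intro equalityI subsetI)
  fix z assume "z \<in> prod_coords X c ` (\<Pi>\<^sub>E x\<in>X. W x)"
  then obtain q where q: "q \<in> (\<Pi>\<^sub>E x\<in>X. W x)" "z = prod_coords X c q" by blast
  have z: "(\<lambda>i. z (x, i)) = snd (c x) (q x)" if "x \<in> X" for x
    using that by (simp add: q(2) prod_coords_def)
  have qW: "q x \<in> W x" if "x \<in> X" for x using q(1) that by blast
  have "z \<in> coord_vecs (Sigma X (\<lambda>x. coords (M x)))"
    unfolding coord_vecs_def
  proof (intro CollectI allI impI)
    fix k assume k: "k \<notin> Sigma X (\<lambda>x. coords (M x))"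
    obtain x i where xi: "k = (x, i)" by (cases k)
    show "z k = 0"
    proof (cases "x \<in> X")
      case True
      have "q x \<in> fst (c x)" using qW[OF True] W[OF True] by blast
      from chart_in_coord_vecs[OF factor[OF True] factor_chart[OF c True] this]
      show ?thesis using k True by (simp add: xi z[OF True, THEN fun_cong] coord_vecs_def)
    next
      case False
      then show ?thesis by (simp add: xi q(2) prod_coords_def)
    qed
  qed
  then show "z \<in> {z \<in> coord_vecs (Sigma X (\<lambda>x. coords (M x))). \<forall>x\<in>X. (\<lambda>i. z (x, i)) \<in> snd (c x) ` W x}"
    using z qW by simp
next
  fix z assume z: "z \<in> {z \<in> coord_vecs (Sigma X (\<lambda>x. coords (M x))). \<forall>x\<in>X. (\<lambda>i. z (x, i)) \<in> snd (c x) ` W x}"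
  then have "\<forall>x\<in>X. \<exists>p. p \<in> W x \<and> (\<lambda>i. z (x, i)) = snd (c x) p" by blast
  then obtain q where q: "\<And>x. x \<in> X \<Longrightarrow> q x \<in> W x \<and> (\<lambda>i. z (x, i)) = snd (c x) (q x)" by metis
  have "prod_coords X c (restrict q X) = z"
  proof (rule fun_pair_eqI)
    fix x i
    show "prod_coords X c (restrict q X) (x, i) = z (x, i)"
    proof (cases "x \<in> X")
      case True
      then show ?thesis using q[OF True] by (auto simp: prod_coords_def fun_eq_iff)
    next
      case False
      then show ?thesis using z by (simp add: prod_coords_def coord_vecs_def)
    qed
  qed
  moreover have "restrict q X \<in> (\<Pi>\<^sub>E x\<in>X. W x)" using q by auto
  ultimately show "z \<in> prod_coords X c ` (\<Pi>\<^sub>E x\<in>X. W x)" by blast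
qed

lemma slice_in_coord_vecs:
  "z \<in> coord_vecs (Sigma X (\<lambda>x. coords (M x))) \<Longrightarrow> x \<in> X \<Longrightarrow> (\<lambda>i. z (x, i)) \<in> coord_vecs (coords (M x))"
  by (auto simp: coord_vecs_def)

lemma prod_coords_image_open:
  assumes c: "c \<in> (\<Pi>\<^sub>E x\<in>X. atlas (M x))" and W: "\<And>x. x \<in> X \<Longrightarrow> W x \<subseteq> fst (c x)"
    and op: "\<And>x. x \<in> X \<Longrightarrow> openin (coord_space (coords (M x))) (snd (c x) ` W x)"
  shows "openin (coord_space (Sigma X (\<lambda>x. coords (M x)))) (prod_coords X c ` (\<Pi>\<^sub>E x\<in>X. W x))"
proof -
  let ?K = "Sigma X (\<lambda>x. coords (M x))"
  have "openin (coord_space ?K) ((\<Inter>x\<in>X. {z \<in> coord_vecs ?K. (\<lambda>i. z (x, i)) \<in> snd (c x) ` W x}) \<inter> topspace (coord_space ?K))"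
  proof (rule openin_INT[OF finite_X])
    fix x assume x: "x \<in> X"
    show "openin (coord_space ?K) {z \<in> coord_vecs ?K. (\<lambda>i. z (x, i)) \<in> snd (c x) ` W x}"
      by (rule open_reindexed_preimage[OF op[OF x] slice_in_coord_vecs[OF _ x]])
  qed
  moreover have "prod_coords X c ` (\<Pi>\<^sub>E x\<in>X. W x) =
      (\<Inter>x\<in>X. {z \<in> coord_vecs ?K. (\<lambda>i. z (x, i)) \<in> snd (c x) ` W x}) \<inter> topspace (coord_space ?K)"
    by (subst prod_coords_image[OF c]) (use W in auto)
  ultimately show ?thesis by simp
qed

lemma prod_coords_inj:
  assumes c: "c \<in> (\<Pi>\<^sub>E x\<in>X. atlas (M x))"
  shows "inj_on (prod_coords X c) (\<Pi>\<^sub>E x\<in>X. fst (c x))"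
proof (rule inj_onI)
  fix q q' assume q: "q \<in> (\<Pi>\<^sub>E x\<in>X. fst (c x))" and q': "q' \<in> (\<Pi>\<^sub>E x\<in>X. fst (c x))"
    and eq: "prod_coords X c q = prod_coords X c q'"
  have "q x = q' x" if x: "x \<in> X" for x
  proof -
    have "snd (c x) (q x) i = snd (c x) (q' x) i" for i
      using fun_cong[OF eq, of "(x, i)"] x by (simp add: prod_coords_def)
    then have "snd (c x) (q x) = snd (c x) (q' x)" by (rule ext)
    then show ?thesis
      using PiE_mem[OF q x] PiE_mem[OF q' x] by (rule inj_onD[OF chart_inj[OF factor[OF x] factor_chart[OF c x]]])
  qed
  then show "q = q'" using q q' by (blast intro: PiE_ext)
qed

lemma premanifold_prod: "premanifold (prod_mfd X M)"
proof (rule premanifoldI, unfold coords_prod_mfd)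
  let ?K = "Sigma X (\<lambda>x. coords (M x))"
  show "finite ?K" using finite_X premanifold_finite[OF factor] by blast
  show "\<exists>U \<phi>. (U, \<phi>) \<in> atlas (prod_mfd X M) \<and> q \<in> U" if q: "q \<in> points (prod_mfd X M)" for q
  proof -
    have "\<forall>x\<in>X. \<exists>d. d \<in> atlas (M x) \<and> q x \<in> fst d"
    proof
      fix x assume x: "x \<in> X"
      have "q x \<in> points (M x)" using q x unfolding points_prod_mfd by blast
      then obtain U \<phi> where "(U, \<phi>) \<in> atlas (M x)" "q x \<in> U" using chart_exists[OF factor[OF x]] by metis
      then show "\<exists>d. d \<in> atlas (M x) \<and> q x \<in> fst d" by (intro exI[of _ "(U, \<phi>)"]) simp
    qed
    then obtain c where c: "\<And>x. x \<in> X \<Longrightarrow> c x \<in> atlas (M x) \<and> q x \<in> fst (c x)" by metis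
    then have "restrict c X \<in> (\<Pi>\<^sub>E x\<in>X. atlas (M x))" by auto
    moreover have "q \<in> (\<Pi>\<^sub>E x\<in>X. fst (restrict c X x))"
      using c q unfolding points_prod_mfd by (auto simp: PiE_iff)
    ultimately show ?thesis unfolding atlas_prod_mfd by blast
  qed
  fix U \<phi> assume "(U, \<phi>) \<in> atlas (prod_mfd X M)"
  then obtain c where c: "c \<in> (\<Pi>\<^sub>E x\<in>X. atlas (M x))"
    and U: "U = (\<Pi>\<^sub>E x\<in>X. fst (c x))" and \<phi>: "\<phi> = prod_coords X c"
    unfolding atlas_prod_mfd by blast
  note cx = factor_chart[OF c]
  show "U \<subseteq> points (prod_mfd X M)"
    unfolding U points_prod_mfd by (intro PiE_mono chart_subset[OF factor cx])
  show inj: "inj_on \<phi> U" unfolding U \<phi> by (rule prod_coords_inj[OF c])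
  show "openin (coord_space ?K) (\<phi> ` U)"
    unfolding U \<phi> by (rule prod_coords_image_open[OF c order_refl chart_open[OF factor cx]])
  fix V \<psi> assume "(V, \<psi>) \<in> atlas (prod_mfd X M)"
  then obtain d where d: "d \<in> (\<Pi>\<^sub>E x\<in>X. atlas (M x))"
    and V: "V = (\<Pi>\<^sub>E x\<in>X. fst (d x))" and \<psi>: "\<psi> = prod_coords X d"
    unfolding atlas_prod_mfd by blast
  note dx = factor_chart[OF d]
  have Int: "U \<inter> V = (\<Pi>\<^sub>E x\<in>X. fst (c x) \<inter> fst (d x))" unfolding U V by (rule PiE_Int)
  define D where "D = \<phi> ` (U \<inter> V)"
  have D: "openin (coord_space ?K) D"
    unfolding D_def Int \<phi>
    by (rule prod_coords_image_open[OF c Int_lower1 transition_open[OF factor cx dx]])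
  then show "openin (coord_space ?K) (\<phi> ` (U \<inter> V))" unfolding D_def .
  have "smooth_fun ?K D (\<lambda>z. \<psi> (inv_into U \<phi> z) k)" if k: "k \<in> ?K" for k
  proof -
    obtain x i where xi: "k = (x, i)" "x \<in> X" "i \<in> coords (M x)" using k by blast
    let ?t = "\<lambda>y. snd (d x) (inv_into (fst (c x)) (snd (c x)) y)"
    have t: "smooth_fun (coords (M x)) (snd (c x) ` (fst (c x) \<inter> fst (d x))) (\<lambda>y. ?t y i)"
      using transition_smooth[OF factor[OF xi(2)] cx[OF xi(2)] dx[OF xi(2)]] xi(3)
      unfolding smooth_coord_iff by (rule bspec)
    have "smooth_fun ?K D (\<lambda>z. ?t (\<lambda>i. z (x, i)) i)"
    proof (rule smooth_fun_compose[OF premanifold_finite[OF factor[OF xi(2)]] D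
          transition_open[OF factor[OF xi(2)] cx[OF xi(2)] dx[OF xi(2)]] _ _ t])
      show "smooth_coord ?K (coords (M x)) D (\<lambda>z i. z (x, i))"
        by (simp add: smooth_coord_iff smooth_fun_coord)
      show "(\<lambda>i. z (x, i)) \<in> snd (c x) ` (fst (c x) \<inter> fst (d x))" if "z \<in> D" for z
        using that xi(2) unfolding D_def Int \<phi> prod_coords_image[OF c Int_lower1] by blast
    qed
    moreover have "?t (\<lambda>i. z (x, i)) i = \<psi> (inv_into U \<phi> z) k" if z: "z \<in> D" for z
    proof -
      obtain q where q: "q \<in> U" "q \<in> V" "z = \<phi> q" using z unfolding D_def by blast
      have 1: "inv_into U \<phi> z = q" using inj q by simp
      have "(\<lambda>i. z (x, i)) = snd (c x) (q x)" using xi(2) by (simp add: q(3) \<phi> prod_coords_def)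
      moreover have "q x \<in> fst (c x)" using q(1) xi(2) unfolding U by blast
      ultimately have "inv_into (fst (c x)) (snd (c x)) (\<lambda>i. z (x, i)) = q x"
        using chart_inj[OF factor[OF xi(2)] cx[OF xi(2)]] by simp
      then show ?thesis using xi(2) by (simp add: 1 xi(1) \<psi> prod_coords_def)
    qed
    ultimately show ?thesis using smooth_fun_cong[OF D, of "\<lambda>z. ?t (\<lambda>i. z (x, i)) i"] by simp
  qed
  then show "smooth_coord ?K ?K (\<phi> ` (U \<inter> V)) (\<lambda>z. \<psi> (inv_into U \<phi> z))"
    unfolding smooth_coord_iff D_def by blast
qed

lemma prod_chart:
  assumes q: "q \<in> points (prod_mfd X M)"
  obtains c where "c \<in> (\<Pi>\<^sub>E x\<in>X. atlas (M x))" "q \<in> (\<Pi>\<^sub>E x\<in>X. fst (c x))"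
    "(\<Pi>\<^sub>E x\<in>X. fst (c x), prod_coords X c) \<in> atlas (prod_mfd X M)"
proof -
  obtain U \<phi> where "(U, \<phi>) \<in> atlas (prod_mfd X M)" "q \<in> U"
    using chart_exists[OF premanifold_prod q] .
  then show thesis using that unfolding atlas_prod_mfd by blast
qed

text \<open>
  In product charts a projection extracts a block of coordinates, so it is linear.
\<close>

lemma proj_in_charts:
  assumes c: "c \<in> (\<Pi>\<^sub>E x\<in>X. atlas (M x))" and x: "x \<in> X"
    and z: "z \<in> prod_coords X c ` (\<Pi>\<^sub>E x\<in>X. fst (c x))"
  shows "snd (c x) (inv_into (\<Pi>\<^sub>E x\<in>X. fst (c x)) (prod_coords X c) z x) = (\<lambda>i. z (x, i))"
proof -
  obtain q where q: "q \<in> (\<Pi>\<^sub>E x\<in>X. fst (c x))" "z = prod_coords X c q" using z by blast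
  then have "inv_into (\<Pi>\<^sub>E x\<in>X. fst (c x)) (prod_coords X c) z = q"
    using prod_coords_inj[OF c] by simp
  then show ?thesis using x by (simp add: q(2) prod_coords_def)
qed

lemma smooth_proj:
  assumes x: "x \<in> X"
  shows "smooth_map (prod_mfd X M) (M x) (\<lambda>q. q x)"
proof (rule smooth_map_localI[OF premanifold_prod factor[OF x]])
  fix q assume q: "q \<in> points (prod_mfd X M)"
  then show "q x \<in> points (M x)" using x unfolding points_prod_mfd by blast
  obtain c where c: "c \<in> (\<Pi>\<^sub>E x\<in>X. atlas (M x))" and qc: "q \<in> (\<Pi>\<^sub>E x\<in>X. fst (c x))"
    and C: "(\<Pi>\<^sub>E x\<in>X. fst (c x), prod_coords X c) \<in> atlas (prod_mfd X M)"
    using prod_chart[OF q] .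
  let ?U = "\<Pi>\<^sub>E x\<in>X. fst (c x)" and ?\<phi> = "prod_coords X c"
  have S: "openin (coord_space (coords (prod_mfd X M))) (?\<phi> ` ?U)"
    by (rule chart_open[OF premanifold_prod C])
  have "smooth_coord (coords (prod_mfd X M)) (coords (M x)) (?\<phi> ` ?U) (\<lambda>z i. z (x, i))"
    by (simp add: smooth_coord_iff smooth_fun_coord)
  then have "smooth_coord (coords (prod_mfd X M)) (coords (M x)) (?\<phi> ` ?U) (\<lambda>z. snd (c x) (inv_into ?U ?\<phi> z x))"
    by (rule smooth_coord_eqI[OF _ S]) (rule proj_in_charts[OF c x, symmetric])
  moreover have "?\<phi> ` ?U \<subseteq> ?\<phi> ` (?U \<inter> (\<lambda>q. q x) -` fst (c x))" using x by blast
  moreover have "?\<phi> q \<in> ?\<phi> ` ?U" using qc by blast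
  ultimately show "\<exists>U \<phi> V \<psi> S. (U, \<phi>) \<in> atlas (prod_mfd X M) \<and> q \<in> U \<and> (V, \<psi>) \<in> atlas (M x) \<and>
      openin (coord_space (coords (prod_mfd X M))) S \<and> \<phi> q \<in> S \<and> S \<subseteq> \<phi> ` (U \<inter> (\<lambda>q. q x) -` V) \<and>
      smooth_coord (coords (prod_mfd X M)) (coords (M x)) S (\<lambda>z. \<psi> (inv_into U \<phi> z x))"
    using C qc S factor_chart[OF c x] by blast
qed

text \<open>
  The preimage of a product chart is an intersection over \<open>X\<close>, which is open because \<open>X\<close> is finite.
\<close>

lemma smooth_into_prod:
  assumes N: "premanifold N" and f: "\<And>x. x \<in> X \<Longrightarrow> smooth_map N (M x) (\<lambda>p. f p x)"
    and ext: "\<And>p. p \<in> points N \<Longrightarrow> f p \<in> extensional X"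
  shows "smooth_map N (prod_mfd X M) f"
proof (rule smooth_map_localI[OF N premanifold_prod])
  fix p assume p: "p \<in> points N"
  have fp: "f p \<in> points (prod_mfd X M)"
    using smooth_map_points[OF f p] ext[OF p] unfolding points_prod_mfd by (auto simp: PiE_iff)
  then show "f p \<in> points (prod_mfd X M)" .
  obtain U \<phi> where U: "(U, \<phi>) \<in> atlas N" "p \<in> U" using chart_exists[OF N p] .
  obtain c where c: "c \<in> (\<Pi>\<^sub>E x\<in>X. atlas (M x))" and qc: "f p \<in> (\<Pi>\<^sub>E x\<in>X. fst (c x))"
    and C: "(\<Pi>\<^sub>E x\<in>X. fst (c x), prod_coords X c) \<in> atlas (prod_mfd X M)"
    using prod_chart[OF fp] .
  note cx = factor_chart[OF c]
  have inj: "inj_on \<phi> U" by (rule chart_inj[OF N U(1)])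
  have UN: "U \<subseteq> points N" by (rule chart_subset[OF N U(1)])
  let ?V = "\<Pi>\<^sub>E x\<in>X. fst (c x)" and ?\<psi> = "prod_coords X c"
  define S where "S = (\<Inter>x\<in>X. \<phi> ` (U \<inter> (\<lambda>p. f p x) -` fst (c x))) \<inter> \<phi> ` U"
  have "openin (coord_space (coords N)) ((\<Inter>x\<in>X. \<phi> ` (U \<inter> (\<lambda>p. f p x) -` fst (c x))) \<inter> topspace (coord_space (coords N)))"
    by (rule openin_INT[OF finite_X])
      (rule smooth_map_preimage_open[OF N f U(1) openin_mfd_chart[OF factor cx]])
  moreover have "S = ((\<Inter>x\<in>X. \<phi> ` (U \<inter> (\<lambda>p. f p x) -` fst (c x))) \<inter> topspace (coord_space (coords N))) \<inter> \<phi> ` U"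
    using open_coord_subset[OF chart_open[OF N U(1)]] unfolding S_def by auto
  ultimately have S: "openin (coord_space (coords N)) S"
    using chart_open[OF N U(1)] by (simp add: openin_Int)
  have pS: "\<phi> p \<in> S" using qc U(2) unfolding S_def by blast
  have inS: "\<exists>q. q \<in> U \<and> z = \<phi> q \<and> f q \<in> ?V" if z: "z \<in> S" for z
  proof -
    obtain q where q: "q \<in> U" "z = \<phi> q" using z unfolding S_def by blast
    have "f q x \<in> fst (c x)" if x: "x \<in> X" for x
    proof -
      obtain q' where q': "q' \<in> U" "z = \<phi> q'" "f q' x \<in> fst (c x)" using z x unfolding S_def by blast
      have "q' = q" using inj q q' by (auto dest: inj_onD)
      then show ?thesis using q'(3) by simp
    qed
    moreover have "q \<in> points N" using q(1) UN by blast
    ultimately show ?thesis using q ext by (auto simp: PiE_iff)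
  qed
  have "smooth_fun (coords N) S (\<lambda>z. ?\<psi> (f (inv_into U \<phi> z)) k)" if k: "k \<in> coords (prod_mfd X M)" for k
  proof -
    obtain x i where xi: "k = (x, i)" "x \<in> X" "i \<in> coords (M x)" using k unfolding coords_prod_mfd by blast
    have "smooth_fun (coords N) (\<phi> ` (U \<inter> (\<lambda>p. f p x) -` fst (c x))) (\<lambda>z. snd (c x) (f (inv_into U \<phi> z) x) i)"
      using smooth_map_chart[OF f[OF xi(2)] U(1) cx[OF xi(2)]] xi(3) unfolding smooth_coord_iff by (rule bspec)
    moreover have "S \<subseteq> \<phi> ` (U \<inter> (\<lambda>p. f p x) -` fst (c x))" using xi(2) unfolding S_def by blast
    ultimately have "smooth_fun (coords N) S (\<lambda>z. snd (c x) (f (inv_into U \<phi> z) x) i)"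
      by (rule smooth_fun_subset)
    then show ?thesis using xi(2) by (simp add: xi(1) prod_coords_def)
  qed
  then have "smooth_coord (coords N) (coords (prod_mfd X M)) S (\<lambda>z. ?\<psi> (f (inv_into U \<phi> z)))"
    unfolding smooth_coord_iff by blast
  moreover have "S \<subseteq> \<phi> ` (U \<inter> f -` ?V)"
  proof
    fix z assume "z \<in> S"
    then obtain q where "q \<in> U" "z = \<phi> q" "f q \<in> ?V" using inS by blast
    then show "z \<in> \<phi> ` (U \<inter> f -` ?V)" by blast
  qed
  ultimately show "\<exists>U \<phi> V \<psi> S. (U, \<phi>) \<in> atlas N \<and> p \<in> U \<and> (V, \<psi>) \<in> atlas (prod_mfd X M) \<and>
      openin (coord_space (coords N)) S \<and> \<phi> p \<in> S \<and> S \<subseteq> \<phi> ` (U \<inter> f -` V) \<and>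
      smooth_coord (coords N) (coords (prod_mfd X M)) S (\<lambda>z. \<psi> (f (inv_into U \<phi> z)))"
    using U C S pS by blast
qed

text \<open>
  Extraction of a block of coordinates is its own derivative.
\<close>

lemma tangent_proj_chart:
  assumes c: "c \<in> (\<Pi>\<^sub>E x\<in>X. atlas (M x))" and q: "q \<in> (\<Pi>\<^sub>E x\<in>X. fst (c x))"
    and v: "v \<in> tangent_space (prod_mfd X M) q" and x: "x \<in> X"
  shows "snd (tangent_map (prod_mfd X M) (M x) (\<lambda>q. q x) (q, v)) (c x) =
    (\<lambda>i. v (\<Pi>\<^sub>E x\<in>X. fst (c x), prod_coords X c) (x, i))"
proof -
  let ?U = "\<Pi>\<^sub>E x\<in>X. fst (c x)" and ?\<phi> = "prod_coords X c" and ?K = "coords (prod_mfd X M)"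
  have C: "(?U, ?\<phi>) \<in> atlas (prod_mfd X M)" using c unfolding atlas_prod_mfd by blast
  have qx: "q x \<in> fst (c x)" using q x by blast
  let ?v = "v (?U, ?\<phi>)"
  have vK: "?v \<in> coord_vecs ?K" by (rule tangent_in_coord_vecs[OF v C q])
  have "snd (tangent_map (prod_mfd X M) (M x) (\<lambda>q. q x) (q, v)) (fst (c x), snd (c x)) =
    jacobian ?K (coords (M x)) (\<lambda>z. snd (c x) (inv_into ?U ?\<phi> z x)) (?\<phi> q) ?v"
    by (rule tangent_map_chart[OF premanifold_prod factor[OF x] smooth_proj[OF x] C q factor_chart[OF c x] qx v])
  also have "\<dots> = jacobian ?K (coords (M x)) (\<lambda>z i. z (x, i)) (?\<phi> q) ?v"
    by (rule jacobian_cong[OF chart_open[OF premanifold_prod C]])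
      (use q in \<open>simp_all add: proj_in_charts[OF c x]\<close>)
  also have "\<dots> = (\<lambda>i. ?v (x, i))"
  proof
    fix i
    show "jacobian ?K (coords (M x)) (\<lambda>z i. z (x, i)) (?\<phi> q) ?v i = ?v (x, i)"
    proof (cases "i \<in> coords (M x)")
      case True
      have "(\<Sum>k\<in>?K. (if k = (x, i) then 1 else 0) * ?v k) = (\<Sum>k\<in>?K. if k = (x, i) then ?v k else 0)"
        by (rule sum.cong) auto
      also have "\<dots> = ?v (x, i)"
        using True x premanifold_finite[OF premanifold_prod] by (simp add: coords_prod_mfd)
      finally show ?thesis using True by (simp add: jacobian_def partial_deriv_coord)
    next
      case False
      then show ?thesis using vK by (auto simp: jacobian_def coord_vecs_def coords_prod_mfd)
    qed
  qed
  finally show ?thesis by simp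
qed

text \<open>
  The blocks of coordinates seen by the projections together exhaust all coordinates.
\<close>

lemma tangent_prod_eqI:
  assumes q: "q \<in> points (prod_mfd X M)"
    and v: "v \<in> tangent_space (prod_mfd X M) q" and w: "w \<in> tangent_space (prod_mfd X M) q"
    and eq: "\<And>x. x \<in> X \<Longrightarrow> tangent_map (prod_mfd X M) (M x) (\<lambda>q. q x) (q, v) =
      tangent_map (prod_mfd X M) (M x) (\<lambda>q. q x) (q, w)"
  shows "v = w"
proof -
  obtain c where c: "c \<in> (\<Pi>\<^sub>E x\<in>X. atlas (M x))" and qc: "q \<in> (\<Pi>\<^sub>E x\<in>X. fst (c x))"
    and C: "(\<Pi>\<^sub>E x\<in>X. fst (c x), prod_coords X c) \<in> atlas (prod_mfd X M)"
    using prod_chart[OF q] .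
  let ?C = "(\<Pi>\<^sub>E x\<in>X. fst (c x), prod_coords X c)"
  show ?thesis
  proof (rule tangent_eqI[OF v w C qc], rule fun_pair_eqI)
    fix x i
    show "v ?C (x, i) = w ?C (x, i)"
    proof (cases "x \<in> X")
      case True
      have "(\<lambda>i. v ?C (x, i)) = (\<lambda>i. w ?C (x, i))"
        unfolding tangent_proj_chart[OF c qc v True, symmetric] tangent_proj_chart[OF c qc w True, symmetric] eq[OF True] ..
      then show ?thesis by (rule fun_cong)
    next
      case False
      then show ?thesis
        using tangent_in_coord_vecs[OF v C qc] tangent_in_coord_vecs[OF w C qc]
        by (simp add: coord_vecs_def coords_prod_mfd)
    qed
  qed
qed

lemma tangent_prod_exists:
  assumes q: "q \<in> points (prod_mfd X M)" and u: "\<And>x. x \<in> X \<Longrightarrow> u x \<in> tangent_space (M x) (q x)"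
  obtains v where "v \<in> tangent_space (prod_mfd X M) q"
    "\<And>x. x \<in> X \<Longrightarrow> tangent_map (prod_mfd X M) (M x) (\<lambda>q. q x) (q, v) = (q x, u x)"
proof -
  obtain c where c: "c \<in> (\<Pi>\<^sub>E x\<in>X. atlas (M x))" and qc: "q \<in> (\<Pi>\<^sub>E x\<in>X. fst (c x))"
    and C: "(\<Pi>\<^sub>E x\<in>X. fst (c x), prod_coords X c) \<in> atlas (prod_mfd X M)"
    using prod_chart[OF q] .
  note cx = factor_chart[OF c]
  have qx: "q x \<in> fst (c x)" if "x \<in> X" for x using qc that by blast
  define z where "z = (\<lambda>(x, i). if x \<in> X then u x (c x) i else 0)"
  have ux: "u x (c x) \<in> coord_vecs (coords (M x))" if "x \<in> X" for x
    using tangent_in_coord_vecs[OF u[OF that] cx[OF that] qx[OF that]] by simp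
  have "z \<in> coord_vecs (coords (prod_mfd X M))"
    using ux by (auto simp: coord_vecs_def z_def coords_prod_mfd)
  then obtain v where v: "v \<in> tangent_space (prod_mfd X M) q"
    and vz: "v (\<Pi>\<^sub>E x\<in>X. fst (c x), prod_coords X c) = z"
    using tangent_vector_exists[OF premanifold_prod C qc] by metis
  show thesis
  proof (rule that[OF v])
    fix x assume x: "x \<in> X"
    let ?T = "tangent_map (prod_mfd X M) (M x) (\<lambda>q. q x) (q, v)"
    have "snd ?T = u x"
    proof (rule tangent_eqI[OF _ u[OF x] cx[OF x] qx[OF x]])
      show "snd ?T \<in> tangent_space (M x) (q x)"
        by (rule tangent_map_in[OF premanifold_prod factor[OF x] smooth_proj[OF x] q v])
      show "snd ?T (fst (c x), snd (c x)) = u x (fst (c x), snd (c x))"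
        using tangent_proj_chart[OF c qc v x] x by (simp add: vz z_def)
    qed
    then show "?T = (q x, u x)" by (intro prod_eqI) simp_all
  qed
qed

end

lemma smooth_map_cong:
  assumes M: "premanifold M" and N: "premanifold N" and f: "smooth_map M N f"
    and eq: "\<And>p. p \<in> points M \<Longrightarrow> f p = g p"
  shows "smooth_map M N g"
proof (rule smooth_map_localI[OF M N])
  fix p assume p: "p \<in> points M"
  show "g p \<in> points N" using smooth_map_points[OF f p] by (simp add: eq[OF p])
  obtain U \<phi> where U: "(U, \<phi>) \<in> atlas M" "p \<in> U" using chart_exists[OF M p] .
  obtain V \<psi> where V: "(V, \<psi>) \<in> atlas N" "f p \<in> V" using chart_exists[OF N smooth_map_points[OF f p]] .
  have UM: "\<And>q. q \<in> U \<Longrightarrow> f q = g q" using chart_subset[OF M U(1)] eq by blast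
  let ?S = "\<phi> ` (U \<inter> f -` V)"
  have S: "openin (coord_space (coords M)) ?S"
    by (rule smooth_map_preimage_open[OF M f U(1) openin_mfd_chart[OF N V(1)]])
  have "smooth_coord (coords M) (coords N) ?S (\<lambda>z. \<psi> (g (inv_into U \<phi> z)))"
    using smooth_map_chart[OF f U(1) V(1)] S
  proof (rule smooth_coord_eqI)
    fix z assume "z \<in> ?S"
    then have "inv_into U \<phi> z \<in> U" by (intro inv_into_into) blast
    then show "\<psi> (f (inv_into U \<phi> z)) = \<psi> (g (inv_into U \<phi> z))" using UM by simp
  qed
  moreover have "?S \<subseteq> \<phi> ` (U \<inter> g -` V)" using UM by force
  ultimately show "\<exists>U \<phi> V \<psi> S. (U, \<phi>) \<in> atlas M \<and> p \<in> U \<and> (V, \<psi>) \<in> atlas N \<and>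
      openin (coord_space (coords M)) S \<and> \<phi> p \<in> S \<and> S \<subseteq> \<phi> ` (U \<inter> g -` V) \<and>
      smooth_coord (coords M) (coords N) S (\<lambda>z. \<psi> (g (inv_into U \<phi> z)))"
    using U V S by blast
qed


section \<open>Real vector spaces as modules\<close>

text \<open>
  Negatives are the multiples by \<open>-1\<close>, which is why \<open>smult_zero\<close> stands in for the existence of inverses.
\<close>

lemma real_vectorspaceI:
  fixes V :: "(real, 'v) module"
  assumes add_closed: "\<And>u v. u \<in> carrier V \<Longrightarrow> v \<in> carrier V \<Longrightarrow> u \<oplus>\<^bsub>V\<^esub> v \<in> carrier V"
    and zero_closed: "\<zero>\<^bsub>V\<^esub> \<in> carrier V"
    and smult_closed: "\<And>r v. v \<in> carrier V \<Longrightarrow> r \<odot>\<^bsub>V\<^esub> v \<in> carrier V"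
    and assoc: "\<And>u v w. u \<in> carrier V \<Longrightarrow> v \<in> carrier V \<Longrightarrow> w \<in> carrier V \<Longrightarrow>
      (u \<oplus>\<^bsub>V\<^esub> v) \<oplus>\<^bsub>V\<^esub> w = u \<oplus>\<^bsub>V\<^esub> (v \<oplus>\<^bsub>V\<^esub> w)"
    and comm: "\<And>u v. u \<in> carrier V \<Longrightarrow> v \<in> carrier V \<Longrightarrow> u \<oplus>\<^bsub>V\<^esub> v = v \<oplus>\<^bsub>V\<^esub> u"
    and l_zero: "\<And>v. v \<in> carrier V \<Longrightarrow> \<zero>\<^bsub>V\<^esub> \<oplus>\<^bsub>V\<^esub> v = v"
    and l_distr: "\<And>r s v. v \<in> carrier V \<Longrightarrow> (r + s) \<odot>\<^bsub>V\<^esub> v = r \<odot>\<^bsub>V\<^esub> v \<oplus>\<^bsub>V\<^esub> s \<odot>\<^bsub>V\<^esub> v"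
    and r_distr: "\<And>r u v. u \<in> carrier V \<Longrightarrow> v \<in> carrier V \<Longrightarrow>
      r \<odot>\<^bsub>V\<^esub> (u \<oplus>\<^bsub>V\<^esub> v) = r \<odot>\<^bsub>V\<^esub> u \<oplus>\<^bsub>V\<^esub> r \<odot>\<^bsub>V\<^esub> v"
    and smult_assoc: "\<And>r s v. v \<in> carrier V \<Longrightarrow> (r * s) \<odot>\<^bsub>V\<^esub> v = r \<odot>\<^bsub>V\<^esub> (s \<odot>\<^bsub>V\<^esub> v)"
    and smult_one: "\<And>v. v \<in> carrier V \<Longrightarrow> 1 \<odot>\<^bsub>V\<^esub> v = v"
    and smult_zero: "\<And>v. v \<in> carrier V \<Longrightarrow> 0 \<odot>\<^bsub>V\<^esub> v = \<zero>\<^bsub>V\<^esub>"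
  shows "vectorspace real_field V"
proof -
  have "abelian_group V"
  proof (rule abelian_groupI)
    fix v assume v: "v \<in> carrier V"
    have "(-1) \<odot>\<^bsub>V\<^esub> v \<oplus>\<^bsub>V\<^esub> v = (-1 + 1) \<odot>\<^bsub>V\<^esub> v"
      unfolding l_distr[OF v] smult_one[OF v] ..
    then have "(-1) \<odot>\<^bsub>V\<^esub> v \<oplus>\<^bsub>V\<^esub> v = \<zero>\<^bsub>V\<^esub>" by (simp add: smult_zero[OF v])
    then show "\<exists>u\<in>carrier V. u \<oplus>\<^bsub>V\<^esub> v = \<zero>\<^bsub>V\<^esub>" using smult_closed[OF v] by blast
  qed (fact add_closed zero_closed assoc comm l_zero)+
  then have "Module.module real_field V"
    by (intro Module.moduleI class_cring.cring_axioms)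
      (simp_all add: smult_closed l_distr r_distr smult_assoc smult_one)
  then show ?thesis
    unfolding vectorspace_def using class_field.field_axioms by blast
qed

lemma vectorspace_imp_module: "vectorspace K V \<Longrightarrow> Module.module K V"
  by (simp add: vectorspace_def)

lemma real_subspaceI:
  assumes "vectorspace real_field V" "N \<subseteq> carrier V" "\<zero>\<^bsub>V\<^esub> \<in> N"
    and "\<And>v w. v \<in> N \<Longrightarrow> w \<in> N \<Longrightarrow> v \<oplus>\<^bsub>V\<^esub> w \<in> N" "\<And>r v. v \<in> N \<Longrightarrow> r \<odot>\<^bsub>V\<^esub> v \<in> N"
  shows "VectorSpace.subspace real_field N V"
  using assms vectorspace_imp_module[OF assms(1)]
  unfolding VectorSpace.subspace_def submodule_def by blast

lemma real_linear_mapI: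
  assumes "vectorspace real_field V" "vectorspace real_field W"
    and "\<And>v. v \<in> carrier V \<Longrightarrow> h v \<in> carrier W"
    and "\<And>v v'. v \<in> carrier V \<Longrightarrow> v' \<in> carrier V \<Longrightarrow> h (v \<oplus>\<^bsub>V\<^esub> v') = h v \<oplus>\<^bsub>W\<^esub> h v'"
    and "\<And>r v. v \<in> carrier V \<Longrightarrow> h (r \<odot>\<^bsub>V\<^esub> v) = r \<odot>\<^bsub>W\<^esub> h v"
  shows "VectorSpace.linear_map real_field V W h"
  using assms vectorspace_imp_module[OF assms(1)] vectorspace_imp_module[OF assms(2)]
  by (auto simp: VectorSpace.linear_map_def mod_hom_def mod_hom_axioms_def LinearCombinations.module_hom_def)

lemma vectorspace_direct_sum:
  "vectorspace real_field V \<Longrightarrow> vectorspace real_field W \<Longrightarrow> vectorspace real_field (direct_sum V W)"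
  unfolding vectorspace_def using direct_sum_is_module by blast

lemma vectorspace_family_sum:
  assumes V: "\<And>x. x \<in> X \<Longrightarrow> vectorspace real_field (V x)"
  shows "vectorspace real_field (family_sum X V)"
proof (rule real_vectorspaceI)
  let ?S = "family_sum X V"
  note mod = vectorspace_imp_module[OF V]
  have grp: "abelian_group (V x)" if "x \<in> X" for x using mod[OF that] by (simp add: Module.module_def)
  note abelian = abelian_monoid.a_closed[OF abelian_group.axioms(1)[OF grp]]
  show "\<zero>\<^bsub>?S\<^esub> \<in> carrier ?S"
    using abelian_monoid.zero_closed[OF abelian_group.axioms(1)[OF grp]] by (simp add: family_sum_def)
  fix u v w and r s :: real
  assume v: "v \<in> carrier ?S"
  have vx: "v x \<in> carrier (V x)" if "x \<in> X" for x using v that by (auto simp: family_sum_def)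
  have v_ext: "restrict v X = v" using v by (simp add: family_sum_def PiE_restrict)
  have sc: "r \<odot>\<^bsub>V x\<^esub> v x \<in> carrier (V x)" if "x \<in> X" for x r
    using module.smult_closed[OF mod[OF that] _ vx[OF that]] by simp
  show "r \<odot>\<^bsub>?S\<^esub> v \<in> carrier ?S" using sc by (simp add: family_sum_def)
  have restrict_cong: "restrict f X = restrict g X" if "\<And>x. x \<in> X \<Longrightarrow> f x = g x" for f g :: "'a \<Rightarrow> 'b"
    using that by (auto simp: restrict_def fun_eq_iff)
  have "restrict (\<lambda>x. \<zero>\<^bsub>V x\<^esub> \<oplus>\<^bsub>V x\<^esub> v x) X = restrict v X"
    by (rule restrict_cong) (simp add: abelian_monoid.l_zero[OF abelian_group.axioms(1)[OF grp]] vx)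
  then show "\<zero>\<^bsub>?S\<^esub> \<oplus>\<^bsub>?S\<^esub> v = v"
    unfolding v_ext by (simp add: family_sum_def cong: restrict_cong)
  have "restrict (\<lambda>x. (r + s) \<odot>\<^bsub>V x\<^esub> v x) X = restrict (\<lambda>x. r \<odot>\<^bsub>V x\<^esub> v x \<oplus>\<^bsub>V x\<^esub> s \<odot>\<^bsub>V x\<^esub> v x) X"
    by (rule restrict_cong) (use module.smult_l_distr[OF mod] vx in simp)
  then show "(r + s) \<odot>\<^bsub>?S\<^esub> v = r \<odot>\<^bsub>?S\<^esub> v \<oplus>\<^bsub>?S\<^esub> s \<odot>\<^bsub>?S\<^esub> v"
    by (simp add: family_sum_def cong: restrict_cong)
  have "restrict (\<lambda>x. (r * s) \<odot>\<^bsub>V x\<^esub> v x) X = restrict (\<lambda>x. r \<odot>\<^bsub>V x\<^esub> (s \<odot>\<^bsub>V x\<^esub> v x)) X"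
    by (rule restrict_cong) (use module.smult_assoc1[OF mod] vx in simp)
  then show "(r * s) \<odot>\<^bsub>?S\<^esub> v = r \<odot>\<^bsub>?S\<^esub> (s \<odot>\<^bsub>?S\<^esub> v)"
    by (simp add: family_sum_def cong: restrict_cong)
  have "restrict (\<lambda>x. 1 \<odot>\<^bsub>V x\<^esub> v x) X = restrict v X"
    by (rule restrict_cong) (use module.smult_one[OF mod] vx in simp)
  then show "1 \<odot>\<^bsub>?S\<^esub> v = v" unfolding v_ext by (simp add: family_sum_def)
  have "restrict (\<lambda>x. 0 \<odot>\<^bsub>V x\<^esub> v x) X = restrict (\<lambda>x. \<zero>\<^bsub>V x\<^esub>) X"
    by (rule restrict_cong) (use module.smult_l_null[OF mod] vx in simp)
  then show "0 \<odot>\<^bsub>?S\<^esub> v = \<zero>\<^bsub>?S\<^esub>" by (simp add: family_sum_def)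
  assume u: "u \<in> carrier ?S"
  have ux: "u x \<in> carrier (V x)" if "x \<in> X" for x using u that by (auto simp: family_sum_def)
  show "u \<oplus>\<^bsub>?S\<^esub> v \<in> carrier ?S"
    using abelian ux vx by (simp add: family_sum_def)
  have "restrict (\<lambda>x. u x \<oplus>\<^bsub>V x\<^esub> v x) X = restrict (\<lambda>x. v x \<oplus>\<^bsub>V x\<^esub> u x) X"
    by (rule restrict_cong) (rule abelian_monoid.a_comm[OF abelian_group.axioms(1)[OF grp] ux vx])
  then show "u \<oplus>\<^bsub>?S\<^esub> v = v \<oplus>\<^bsub>?S\<^esub> u" by (simp add: family_sum_def)
  have "restrict (\<lambda>x. r \<odot>\<^bsub>V x\<^esub> (u x \<oplus>\<^bsub>V x\<^esub> v x)) X = restrict (\<lambda>x. r \<odot>\<^bsub>V x\<^esub> u x \<oplus>\<^bsub>V x\<^esub> r \<odot>\<^bsub>V x\<^esub> v x) X"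
    by (rule restrict_cong) (use module.smult_r_distr[OF mod] ux vx in simp)
  then show "r \<odot>\<^bsub>?S\<^esub> (u \<oplus>\<^bsub>?S\<^esub> v) = r \<odot>\<^bsub>?S\<^esub> u \<oplus>\<^bsub>?S\<^esub> r \<odot>\<^bsub>?S\<^esub> v"
    by (simp add: family_sum_def cong: restrict_cong)
  assume w: "w \<in> carrier ?S"
  have wx: "w x \<in> carrier (V x)" if "x \<in> X" for x using w that by (auto simp: family_sum_def)
  have "restrict (\<lambda>x. u x \<oplus>\<^bsub>V x\<^esub> v x \<oplus>\<^bsub>V x\<^esub> w x) X = restrict (\<lambda>x. u x \<oplus>\<^bsub>V x\<^esub> (v x \<oplus>\<^bsub>V x\<^esub> w x)) X"
    by (rule restrict_cong) (rule abelian_monoid.a_assoc[OF abelian_group.axioms(1)[OF grp] ux vx wx])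
  then show "(u \<oplus>\<^bsub>?S\<^esub> v) \<oplus>\<^bsub>?S\<^esub> w = u \<oplus>\<^bsub>?S\<^esub> (v \<oplus>\<^bsub>?S\<^esub> w)"
    by (simp add: family_sum_def cong: restrict_cong)
qed


section \<open>The vector space of open systems\<close>

text \<open>
  The regularity of a submersion that makes \<open>Crl\<close> a vector space.  It is separated from
  \<open>surjective_submersion\<close> because products inherit it chart by chart.
\<close>

locale smooth_ssub =
  fixes a :: "('p, 'i, 'q, 'j) ssub"
  assumes tot: "premanifold (tot a)" and st: "premanifold (st a)"
    and proj: "smooth_map (tot a) (st a) (proj a)"
begin

lemma Crl_base: "F \<in> carrier (Crl a) \<Longrightarrow> q \<in> points (tot a) \<Longrightarrow> fst (F q) = proj a q"
  and Crl_smooth: "F \<in> carrier (Crl a) \<Longrightarrow> smooth_map (tot a) (tangent_bundle (st a)) F"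
  by (simp_all add: Crl_def)

lemma Crl_pair:
  assumes "F \<in> carrier (Crl a)" "q \<in> points (tot a)"
  shows "(proj a q, snd (F q)) = F q" "snd (F q) \<in> tangent_space (st a) (proj a q)"
proof -
  show "(proj a q, snd (F q)) = F q" using Crl_base[OF assms] by (intro prod_eqI) simp_all
  show "snd (F q) \<in> tangent_space (st a) (proj a q)"
    using smooth_map_points[OF Crl_smooth[OF assms(1)] assms(2)] Crl_base[OF assms]
    unfolding points_tangent_bundle by (cases "F q") simp
qed

lemma Crl_chart:
  assumes F: "F \<in> carrier (Crl a)" and U: "(U, \<phi>) \<in> atlas (tot a)" and V: "(V, \<psi>) \<in> atlas (st a)"
  shows "smooth_coord (coords (tot a)) (coords (st a)) (\<phi> ` (U \<inter> proj a -` V))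
    (\<lambda>z. snd (F (inv_into U \<phi> z)) (V, \<psi>))"
  by (rule smooth_section_chart[OF tot Crl_smooth[OF F] _ U V]) (rule Crl_base[OF F])

lemma Crl_eqI:
  assumes F: "F \<in> carrier (Crl a)" and G: "G \<in> carrier (Crl a)"
    and eq: "\<And>q. q \<in> points (tot a) \<Longrightarrow> snd (F q) = snd (G q)"
  shows "F = G"
proof (rule extensionalityI)
  show "F \<in> extensional (points (tot a))" "G \<in> extensional (points (tot a))"
    using F G by (simp_all add: Crl_def)
  show "F q = G q" if "q \<in> points (tot a)" for q
    by (rule prod_eqI) (simp_all add: Crl_base[OF F that] Crl_base[OF G that] eq[OF that])
qed

lemma Crl_restrictI:
  assumes tan: "\<And>q. q \<in> points (tot a) \<Longrightarrow> u q \<in> tangent_space (st a) (proj a q)"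
    and ch: "\<And>U \<phi> V \<psi>. (U, \<phi>) \<in> atlas (tot a) \<Longrightarrow> (V, \<psi>) \<in> atlas (st a) \<Longrightarrow>
      openin (coord_space (coords (tot a))) (\<phi> ` (U \<inter> proj a -` V)) \<Longrightarrow>
      smooth_coord (coords (tot a)) (coords (st a)) (\<phi> ` (U \<inter> proj a -` V)) (\<lambda>z. u (inv_into U \<phi> z) (V, \<psi>))"
  shows "(\<lambda>q\<in>points (tot a). (proj a q, u q)) \<in> carrier (Crl a)"
proof -
  have "smooth_map (tot a) (tangent_bundle (st a)) (\<lambda>q. (proj a q, u q))"
    by (rule smooth_sectionI[OF tot st proj]) (simp_all add: tan ch)
  then have "smooth_map (tot a) (tangent_bundle (st a)) (\<lambda>q\<in>points (tot a). (proj a q, u q))"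
    by (rule smooth_map_cong[OF tot premanifold_tangent_bundle[OF st]]) simp
  then show ?thesis by (simp add: Crl_def)
qed

lemma Crl_add_closed:
  assumes F: "F \<in> carrier (Crl a)" and G: "G \<in> carrier (Crl a)"
  shows "F \<oplus>\<^bsub>Crl a\<^esub> G \<in> carrier (Crl a)"
proof -
  have "(\<lambda>q\<in>points (tot a). (proj a q, \<lambda>c i. snd (F q) c i + snd (G q) c i)) \<in> carrier (Crl a)"
  proof (rule Crl_restrictI)
    fix q assume q: "q \<in> points (tot a)"
    show "(\<lambda>c i. snd (F q) c i + snd (G q) c i) \<in> tangent_space (st a) (proj a q)"
      by (rule tangent_space_add[OF Crl_pair(2)[OF F q] Crl_pair(2)[OF G q]])
  next
    fix U \<phi> V \<psi> assume U: "(U, \<phi>) \<in> atlas (tot a)" and V: "(V, \<psi>) \<in> atlas (st a)"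
      and D: "openin (coord_space (coords (tot a))) (\<phi> ` (U \<inter> proj a -` V))"
    show "smooth_coord (coords (tot a)) (coords (st a)) (\<phi> ` (U \<inter> proj a -` V))
       (\<lambda>z i. snd (F (inv_into U \<phi> z)) (V, \<psi>) i + snd (G (inv_into U \<phi> z)) (V, \<psi>) i)"
      using Crl_chart[OF F U V] Crl_chart[OF G U V] smooth_fun_add[OF D]
      unfolding smooth_coord_iff by simp
  qed
  then show ?thesis by (simp add: Crl_def)
qed

lemma Crl_smult_closed:
  assumes F: "F \<in> carrier (Crl a)"
  shows "r \<odot>\<^bsub>Crl a\<^esub> F \<in> carrier (Crl a)"
proof -
  have "(\<lambda>q\<in>points (tot a). (proj a q, \<lambda>c i. r * snd (F q) c i)) \<in> carrier (Crl a)"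
  proof (rule Crl_restrictI)
    fix q assume q: "q \<in> points (tot a)"
    show "(\<lambda>c i. r * snd (F q) c i) \<in> tangent_space (st a) (proj a q)"
      by (rule tangent_space_scale[OF Crl_pair(2)[OF F q]])
  next
    fix U \<phi> V \<psi> assume U: "(U, \<phi>) \<in> atlas (tot a)" and V: "(V, \<psi>) \<in> atlas (st a)"
      and D: "openin (coord_space (coords (tot a))) (\<phi> ` (U \<inter> proj a -` V))"
    show "smooth_coord (coords (tot a)) (coords (st a)) (\<phi> ` (U \<inter> proj a -` V))
       (\<lambda>z i. r * snd (F (inv_into U \<phi> z)) (V, \<psi>) i)"
      using Crl_chart[OF F U V] smooth_fun_mult[OF D smooth_fun_const]
      unfolding smooth_coord_iff by simp
  qed
  then show ?thesis by (simp add: Crl_def)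
qed

lemma Crl_zero_closed: "\<zero>\<^bsub>Crl a\<^esub> \<in> carrier (Crl a)"
proof -
  have "(\<lambda>q\<in>points (tot a). (proj a q, \<lambda>c i. 0)) \<in> carrier (Crl a)"
    by (rule Crl_restrictI) (simp_all add: tangent_space_zero smooth_coord_iff smooth_fun_const)
  then show ?thesis by (simp add: Crl_def)
qed

lemma Crl_add_apply: "q \<in> points (tot a) \<Longrightarrow> (F \<oplus>\<^bsub>Crl a\<^esub> G) q = (proj a q, \<lambda>c i. snd (F q) c i + snd (G q) c i)"
  and Crl_smult_apply: "q \<in> points (tot a) \<Longrightarrow> (r \<odot>\<^bsub>Crl a\<^esub> F) q = (proj a q, \<lambda>c i. r * snd (F q) c i)"
  and Crl_zero_apply: "q \<in> points (tot a) \<Longrightarrow> \<zero>\<^bsub>Crl a\<^esub> q = (proj a q, \<lambda>c i. 0)"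
  by (simp_all add: Crl_def)

lemma vectorspace_Crl: "vectorspace real_field (Crl a)"
  by (rule real_vectorspaceI)
    (auto intro!: Crl_eqI Crl_add_closed Crl_smult_closed Crl_zero_closed
      simp: Crl_add_apply Crl_smult_apply Crl_zero_apply algebra_simps)

end

lemma surjective_submersion_imp_smooth: "surjective_submersion a \<Longrightarrow> smooth_ssub a"
  by (simp add: surjective_submersion_def smooth_ssub_def manifold_imp_premanifold)


section \<open>Relatedness\<close>

locale ssub_morphism = A: smooth_ssub a + B: smooth_ssub b
  for a :: "('p, 'i, 'q, 'j) ssub" and b :: "('p', 'i', 'q', 'j') ssub" +
  fixes f :: "('p, 'p', 'q, 'q') ssub_map"
  assumes f: "map_of_submersions a b f"
begin

lemma smooth_tot: "smooth_map (tot a) (tot b) (map_tot f)"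
  and smooth_st: "smooth_map (st a) (st b) (map_st f)"
  and proj_commute: "q \<in> points (tot a) \<Longrightarrow> proj b (map_tot f q) = map_st f (proj a q)"
  using f by (simp_all add: map_of_submersions_def)

lemma map_tot_points: "q \<in> points (tot a) \<Longrightarrow> map_tot f q \<in> points (tot b)"
  by (rule smooth_map_points[OF smooth_tot])

lemma related_add:
  assumes F: "F \<in> carrier (Crl a)" "F' \<in> carrier (Crl a)"
    and rel: "related a b f F G" "related a b f F' G'"
  shows "related a b f (F \<oplus>\<^bsub>Crl a\<^esub> F') (G \<oplus>\<^bsub>Crl b\<^esub> G')"
  unfolding related_def
proof
  fix q assume q: "q \<in> points (tot a)"
  show "tangent_map (st a) (st b) (map_st f) ((F \<oplus>\<^bsub>Crl a\<^esub> F') q) = (G \<oplus>\<^bsub>Crl b\<^esub> G') (map_tot f q)"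
    using rel q unfolding related_def
    by (intro prod_eqI) (simp_all add: A.Crl_add_apply B.Crl_add_apply map_tot_points proj_commute
        tangent_map_add A.Crl_pair(1)[OF F(1) q] A.Crl_pair(1)[OF F(2) q])
qed

lemma related_smult:
  assumes F: "F \<in> carrier (Crl a)" and rel: "related a b f F G"
  shows "related a b f (r \<odot>\<^bsub>Crl a\<^esub> F) (r \<odot>\<^bsub>Crl b\<^esub> G)"
  unfolding related_def
proof
  fix q assume q: "q \<in> points (tot a)"
  show "tangent_map (st a) (st b) (map_st f) ((r \<odot>\<^bsub>Crl a\<^esub> F) q) = (r \<odot>\<^bsub>Crl b\<^esub> G) (map_tot f q)"
    using rel q unfolding related_def
    by (intro prod_eqI) (simp_all add: A.Crl_smult_apply B.Crl_smult_apply map_tot_points proj_commute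
        tangent_map_scale A.Crl_pair(1)[OF F q])
qed

lemma related_zero: "related a b f \<zero>\<^bsub>Crl a\<^esub> \<zero>\<^bsub>Crl b\<^esub>"
  by (simp add: related_def A.Crl_zero_apply B.Crl_zero_apply map_tot_points proj_commute tangent_map_zero)

lemma linear_relation_Crl_rel: "linear_relation (Crl a) (Crl b) (Crl_rel a b f)"
  unfolding linear_relation_def
proof (rule real_subspaceI[OF vectorspace_direct_sum[OF B.vectorspace_Crl A.vectorspace_Crl]])
  show "\<zero>\<^bsub>direct_sum (Crl b) (Crl a)\<^esub> \<in> Crl_rel a b f"
    by (simp add: direct_sum_def Crl_rel_def A.Crl_zero_closed B.Crl_zero_closed related_zero)
  show "v \<oplus>\<^bsub>direct_sum (Crl b) (Crl a)\<^esub> w \<in> Crl_rel a b f" if "v \<in> Crl_rel a b f" "w \<in> Crl_rel a b f" for v w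
    using that by (auto simp: direct_sum_def Crl_rel_def A.Crl_add_closed B.Crl_add_closed related_add)
  show "r \<odot>\<^bsub>direct_sum (Crl b) (Crl a)\<^esub> v \<in> Crl_rel a b f" if "v \<in> Crl_rel a b f" for r v
    using that by (auto simp: direct_sum_def Crl_rel_def A.Crl_smult_closed B.Crl_smult_closed related_smult)
qed (auto simp: direct_sum_def Crl_rel_def)

end


section \<open>Pullback along an interconnection\<close>

locale interconnected = A: smooth_ssub a + B: smooth_ssub b
  for a :: "('p, 'i, 'q, 'j) ssub" and b :: "('p', 'i', 'q', 'j') ssub" +
  fixes \<phi> :: "('p, 'p', 'q, 'q') ssub_map"
  assumes ic: "interconnection a b \<phi>"
begin

sublocale ssub_morphism a b \<phi>
  using ic by unfold_locales (simp add: interconnection_def)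

definition st_inv :: "'q' \<Rightarrow> 'q" where "st_inv = inv_into (points (st a)) (map_st \<phi>)"

lemma smooth_st_inv: "smooth_map (st b) (st a) st_inv"
  and bij_st: "bij_betw (map_st \<phi>) (points (st a)) (points (st b))"
  using ic by (simp_all add: interconnection_def diffeomorphism_def st_inv_def)

lemma tangent_st_inv:
  assumes w: "w \<in> points (tangent_bundle (st a))"
  shows "tangent_map (st b) (st a) st_inv (tangent_map (st a) (st b) (map_st \<phi>) w) = w"
  unfolding tangent_map_compose[OF A.st B.st A.st smooth_st smooth_st_inv w, symmetric]
proof (rule tangent_map_id[OF A.st w])
  show "st_inv (map_st \<phi> q) = q" if "q \<in> points (st a)" for q
    using bij_st that by (simp add: st_inv_def bij_betw_inv_into_left)
qed

lemma tangent_st_inv_right: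
  assumes w: "w \<in> points (tangent_bundle (st b))"
  shows "tangent_map (st a) (st b) (map_st \<phi>) (tangent_map (st b) (st a) st_inv w) = w"
  unfolding tangent_map_compose[OF B.st A.st B.st smooth_st_inv smooth_st w, symmetric]
proof (rule tangent_map_id[OF B.st w])
  show "map_st \<phi> (st_inv q) = q" if "q \<in> points (st b)" for q
    using bij_st that by (simp add: st_inv_def bij_betw_inv_into_right)
qed

lemma inj_tangent_st: "inj_on (tangent_map (st a) (st b) (map_st \<phi>)) (points (tangent_bundle (st a)))"
  using tangent_st_inv by (rule inj_on_inverseI)

lemma pullback_apply:
  assumes F: "F \<in> carrier (Crl b)" and q: "q \<in> points (tot a)"
  shows "pullback a b \<phi> F q = tangent_map (st b) (st a) st_inv (F (map_tot \<phi> q))"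
proof -
  let ?w = "F (map_tot \<phi> q)"
  have w: "?w \<in> points (tangent_bundle (st b))"
    by (rule smooth_map_points[OF B.Crl_smooth[OF F] map_tot_points[OF q]])
  have "inv_into (points (tangent_bundle (st a))) (tangent_map (st a) (st b) (map_st \<phi>)) ?w =
      tangent_map (st b) (st a) st_inv ?w"
    by (rule inv_into_f_eq[OF inj_tangent_st tangent_map_points[OF B.st A.st smooth_st_inv w]
          tangent_st_inv_right[OF w]])
  then show ?thesis using q by (simp add: pullback_def)
qed

lemma pullback_closed:
  assumes F: "F \<in> carrier (Crl b)"
  shows "pullback a b \<phi> F \<in> carrier (Crl a)"
proof -
  let ?H = "\<lambda>q. tangent_map (st b) (st a) st_inv (F (map_tot \<phi> q))"
  have base: "fst (F (map_tot \<phi> q)) = map_st \<phi> (proj a q)" if "q \<in> points (tot a)" for q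
    using B.Crl_base[OF F map_tot_points[OF that]] proj_commute[OF that] by simp
  have "smooth_map (tot a) (tangent_bundle (st a)) ?H"
    by (rule smooth_tangent_map_section[OF A.tot B.st A.st smooth_map_compose[OF A.tot A.st B.st A.proj smooth_st]
          smooth_st_inv smooth_map_compose[OF A.tot B.tot premanifold_tangent_bundle[OF B.st] smooth_tot B.Crl_smooth[OF F]]])
      (rule base)
  then have "smooth_map (tot a) (tangent_bundle (st a)) (pullback a b \<phi> F)"
    by (rule smooth_map_cong[OF A.tot premanifold_tangent_bundle[OF A.st]]) (simp add: pullback_apply[OF F])
  moreover have "fst (pullback a b \<phi> F q) = proj a q" if q: "q \<in> points (tot a)" for q
    using bij_st smooth_map_points[OF A.proj q]
    by (simp add: pullback_apply[OF F q] base[OF q] st_inv_def bij_betw_inv_into_left)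
  ultimately show ?thesis by (simp add: Crl_def pullback_def)
qed

lemma pullback_related:
  assumes F: "F \<in> carrier (Crl b)"
  shows "related a b \<phi> (pullback a b \<phi> F) F"
  unfolding related_def
proof
  fix q assume q: "q \<in> points (tot a)"
  show "tangent_map (st a) (st b) (map_st \<phi>) (pullback a b \<phi> F q) = F (map_tot \<phi> q)"
    unfolding pullback_apply[OF F q]
    by (rule tangent_st_inv_right[OF smooth_map_points[OF B.Crl_smooth[OF F] map_tot_points[OF q]]])
qed

text \<open>
  Since \<open>T \<phi>\<^sub>s\<^sub>t\<close> is injective, relatedness determines the pullback.  Linearity of the pullback follows,
  because relatedness is preserved by sums and multiples.
\<close>

lemma pullback_unique:
  assumes F: "F \<in> carrier (Crl b)" and H: "H \<in> carrier (Crl a)" and rel: "related a b \<phi> H F"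
  shows "pullback a b \<phi> F = H"
proof (rule A.Crl_eqI[OF pullback_closed[OF F] H])
  fix q assume q: "q \<in> points (tot a)"
  have "tangent_map (st a) (st b) (map_st \<phi>) (H q) = F (map_tot \<phi> q)"
    using rel q by (simp add: related_def)
  then show "snd (pullback a b \<phi> F q) = snd (H q)"
    using tangent_st_inv[OF smooth_map_points[OF A.Crl_smooth[OF H] q]] by (simp add: pullback_apply[OF F q])
qed

lemma pullback_add:
  assumes "F \<in> carrier (Crl b)" "G \<in> carrier (Crl b)"
  shows "pullback a b \<phi> (F \<oplus>\<^bsub>Crl b\<^esub> G) = pullback a b \<phi> F \<oplus>\<^bsub>Crl a\<^esub> pullback a b \<phi> G"
  by (intro pullback_unique A.Crl_add_closed B.Crl_add_closed related_add pullback_closed pullback_related assms)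

lemma pullback_smult:
  assumes "F \<in> carrier (Crl b)"
  shows "pullback a b \<phi> (r \<odot>\<^bsub>Crl b\<^esub> F) = r \<odot>\<^bsub>Crl a\<^esub> pullback a b \<phi> F"
  by (intro pullback_unique A.Crl_smult_closed B.Crl_smult_closed related_smult pullback_closed pullback_related assms)

end


section \<open>Open systems on products\<close>

locale ssub_list =
  fixes X :: "'x set" and \<tau> :: "'x \<Rightarrow> ('p, 'i, 'q, 'j) ssub"
  assumes finite_index: "finite X" and entry: "\<And>x. x \<in> X \<Longrightarrow> smooth_ssub (\<tau> x)"
begin

sublocale Tot: mfd_product X "\<lambda>x. tot (\<tau> x)"
  using finite_index smooth_ssub.tot[OF entry] by unfold_locales

sublocale St: mfd_product X "\<lambda>x. st (\<tau> x)"
  using finite_index smooth_ssub.st[OF entry] by unfold_locales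

lemma tot_prod: "tot (prod_ssub X \<tau>) = prod_mfd X (\<lambda>x. tot (\<tau> x))"
  and st_prod: "st (prod_ssub X \<tau>) = prod_mfd X (\<lambda>x. st (\<tau> x))"
  and proj_prod: "proj (prod_ssub X \<tau>) = (\<lambda>q. \<lambda>x\<in>X. proj (\<tau> x) (q x))"
  by (simp_all add: prod_ssub_def)

lemma points_tot_prod: "q \<in> points (tot (prod_ssub X \<tau>)) \<Longrightarrow> x \<in> X \<Longrightarrow> q x \<in> points (tot (\<tau> x))"
  unfolding tot_prod points_prod_mfd by blast

sublocale P: smooth_ssub "prod_ssub X \<tau>"
proof
  show "premanifold (tot (prod_ssub X \<tau>))" unfolding tot_prod by (rule Tot.premanifold_prod)
  show "premanifold (st (prod_ssub X \<tau>))" unfolding st_prod by (rule St.premanifold_prod)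
  show "smooth_map (tot (prod_ssub X \<tau>)) (st (prod_ssub X \<tau>)) (proj (prod_ssub X \<tau>))"
    unfolding tot_prod st_prod
  proof (rule St.smooth_into_prod[OF Tot.premanifold_prod])
    fix x assume x: "x \<in> X"
    interpret E: smooth_ssub "\<tau> x" by (rule entry[OF x])
    have "smooth_map (prod_mfd X (\<lambda>x. tot (\<tau> x))) (st (\<tau> x)) (\<lambda>q. proj (\<tau> x) (q x))"
      by (rule smooth_map_compose[OF Tot.premanifold_prod E.tot E.st Tot.smooth_proj[OF x] E.proj])
    then show "smooth_map (prod_mfd X (\<lambda>x. tot (\<tau> x))) (st (\<tau> x)) (\<lambda>q. proj (prod_ssub X \<tau>) q x)"
      using x by (simp add: proj_prod)
  qed (simp add: proj_prod)
qed

lemma proj_morphism: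
  assumes x: "x \<in> X"
  shows "ssub_morphism (prod_ssub X \<tau>) (\<tau> x) (prod_proj x)"
proof -
  interpret E: smooth_ssub "\<tau> x" by (rule entry[OF x])
  show ?thesis
  proof
    show "map_of_submersions (prod_ssub X \<tau>) (\<tau> x) (prod_proj x)"
      using Tot.smooth_proj[OF x] St.smooth_proj[OF x] x
      by (simp add: map_of_submersions_def prod_proj_def tot_prod st_prod proj_prod)
  qed
qed

lemma related_proj_iff:
  "related (prod_ssub X \<tau>) (\<tau> x) (prod_proj x) H F \<longleftrightarrow> (\<forall>q\<in>points (tot (prod_ssub X \<tau>)).
     tangent_map (st (prod_ssub X \<tau>)) (st (\<tau> x)) (\<lambda>m. m x) (H q) = F (q x))"
  by (simp add: related_def prod_proj_def)

lemma tangent_prod_unique: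
  assumes w: "w \<in> points (tangent_bundle (st (prod_ssub X \<tau>)))"
    and w': "w' \<in> points (tangent_bundle (st (prod_ssub X \<tau>)))"
    and eq: "\<And>x. x \<in> X \<Longrightarrow> tangent_map (st (prod_ssub X \<tau>)) (st (\<tau> x)) (\<lambda>m. m x) w =
      tangent_map (st (prod_ssub X \<tau>)) (st (\<tau> x)) (\<lambda>m. m x) w'"
  shows "w = w'"
proof -
  obtain m v where m: "w = (m, v)" "m \<in> points (st (prod_ssub X \<tau>))" "v \<in> tangent_space (st (prod_ssub X \<tau>)) m"
    using w unfolding points_tangent_bundle by auto
  obtain m' v' where m': "w' = (m', v')" "m' \<in> points (st (prod_ssub X \<tau>))"
    and v': "v' \<in> tangent_space (st (prod_ssub X \<tau>)) m'"
    using w' unfolding points_tangent_bundle by auto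
  have "m x = m' x" if "x \<in> X" for x
    using arg_cong[OF eq[OF that], of fst] by (simp add: m(1) m'(1))
  then have mm': "m' = m"
    using m(2) m'(2) unfolding st_prod points_prod_mfd by (metis PiE_ext)
  have "v = v'"
    using St.tangent_prod_eqI[of m v v'] m v' eq unfolding m(1) m'(1) mm' st_prod by blast
  then show ?thesis by (simp add: m(1) m'(1) mm')
qed

lemma Crl_sum_entry: "F \<in> carrier (Crl_sum X \<tau>) \<Longrightarrow> x \<in> X \<Longrightarrow> F x \<in> carrier (Crl (\<tau> x))"
  by (auto simp: Crl_sum_def family_sum_def)

lemma vectorspace_Crl_sum: "vectorspace real_field (Crl_sum X \<tau>)"
  unfolding Crl_sum_def by (rule vectorspace_family_sum) (rule smooth_ssub.vectorspace_Crl[OF entry])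

lemma related_proj_unique:
  assumes H: "H \<in> carrier (Crl (prod_ssub X \<tau>))" and H': "H' \<in> carrier (Crl (prod_ssub X \<tau>))"
    and rel: "\<And>x. x \<in> X \<Longrightarrow> related (prod_ssub X \<tau>) (\<tau> x) (prod_proj x) H (F x)"
    and rel': "\<And>x. x \<in> X \<Longrightarrow> related (prod_ssub X \<tau>) (\<tau> x) (prod_proj x) H' (F x)"
  shows "H = H'"
proof (rule P.Crl_eqI[OF H H'])
  fix q assume q: "q \<in> points (tot (prod_ssub X \<tau>))"
  have "H q = H' q"
  proof (rule tangent_prod_unique)
    show "H q \<in> points (tangent_bundle (st (prod_ssub X \<tau>)))"
      by (rule smooth_map_points[OF P.Crl_smooth[OF H] q])
    show "H' q \<in> points (tangent_bundle (st (prod_ssub X \<tau>)))"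
      by (rule smooth_map_points[OF P.Crl_smooth[OF H'] q])
    fix x assume x: "x \<in> X"
    show "tangent_map (st (prod_ssub X \<tau>)) (st (\<tau> x)) (\<lambda>m. m x) (H q) =
        tangent_map (st (prod_ssub X \<tau>)) (st (\<tau> x)) (\<lambda>m. m x) (H' q)"
      using rel[OF x] rel'[OF x] q unfolding related_proj_iff by simp
  qed
  then show "snd (H q) = snd (H' q)" by simp
qed

text \<open>
  Pointwise, the value of the product system at \<open>q\<close> is the tangent vector whose components are the
  vectors \<open>F x (q x)\<close>.  It is smooth because in product charts its block of coordinates with index \<open>x\<close> is
  the fibre coordinate expression of the smooth map \<open>q \<mapsto> F x (q x)\<close>.
\<close>

lemma product_system_exists:
  assumes F: "F \<in> carrier (Crl_sum X \<tau>)"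
  obtains H where "H \<in> carrier (Crl (prod_ssub X \<tau>))"
    "\<And>x. x \<in> X \<Longrightarrow> related (prod_ssub X \<tau>) (\<tau> x) (prod_proj x) H (F x)"
proof -
  let ?T = "tot (prod_ssub X \<tau>)" and ?S = "st (prod_ssub X \<tau>)" and ?p = "proj (prod_ssub X \<tau>)"
  note Fx = Crl_sum_entry[OF F]
  have pS: "?p q \<in> points (prod_mfd X (\<lambda>x. st (\<tau> x)))" if "q \<in> points ?T" for q
    using smooth_map_points[OF P.proj that] unfolding st_prod .
  have pq: "?p q x = proj (\<tau> x) (q x)" if "x \<in> X" for q x using that by (simp add: proj_prod)
  have "\<exists>v. v \<in> tangent_space ?S (?p q) \<and> (\<forall>x\<in>X. tangent_map ?S (st (\<tau> x)) (\<lambda>m. m x) (?p q, v) = F x (q x))"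
    if q: "q \<in> points ?T" for q
  proof -
    have u: "snd (F x (q x)) \<in> tangent_space (st (\<tau> x)) (?p q x)" if x: "x \<in> X" for x
      unfolding pq[OF x] by (rule smooth_ssub.Crl_pair(2)[OF entry[OF x] Fx[OF x] points_tot_prod[OF q x]])
    obtain v where v: "v \<in> tangent_space (prod_mfd X (\<lambda>x. st (\<tau> x))) (?p q)"
      "\<And>x. x \<in> X \<Longrightarrow> tangent_map (prod_mfd X (\<lambda>x. st (\<tau> x))) (st (\<tau> x)) (\<lambda>m. m x) (?p q, v) =
        (?p q x, snd (F x (q x)))"
      by (rule St.tangent_prod_exists[OF pS[OF q], of "\<lambda>x. snd (F x (q x))"]) (use u in blast)+
    have "(?p q x, snd (F x (q x))) = F x (q x)" if x: "x \<in> X" for x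
      unfolding pq[OF x] by (rule smooth_ssub.Crl_pair(1)[OF entry[OF x] Fx[OF x] points_tot_prod[OF q x]])
    then show ?thesis using v unfolding st_prod by auto
  qed
  then obtain u where u: "\<And>q. q \<in> points ?T \<Longrightarrow> u q \<in> tangent_space ?S (?p q)"
    and Tu: "\<And>q x. q \<in> points ?T \<Longrightarrow> x \<in> X \<Longrightarrow> tangent_map ?S (st (\<tau> x)) (\<lambda>m. m x) (?p q, u q) = F x (q x)"
    by metis
  define H where "H = (\<lambda>q\<in>points ?T. (?p q, u q))"
  show thesis
  proof (rule that)
    show "related (prod_ssub X \<tau>) (\<tau> x) (prod_proj x) H (F x)" if "x \<in> X" for x
      unfolding related_proj_iff using Tu that by (simp add: H_def)
    show "H \<in> carrier (Crl (prod_ssub X \<tau>))"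
      unfolding H_def
    proof (rule P.Crl_restrictI)
      show "u q \<in> tangent_space ?S (?p q)" if "q \<in> points ?T" for q by (rule u[OF that])
      fix U \<phi> V \<psi> assume U: "(U, \<phi>) \<in> atlas ?T" and "(V, \<psi>) \<in> atlas ?S"
        and D: "openin (coord_space (coords ?T)) (\<phi> ` (U \<inter> ?p -` V))"
      then obtain d where d: "d \<in> (\<Pi>\<^sub>E x\<in>X. atlas (st (\<tau> x)))"
        and V: "V = (\<Pi>\<^sub>E x\<in>X. fst (d x))" "\<psi> = prod_coords X d"
        unfolding st_prod atlas_prod_mfd by blast
      have "smooth_fun (coords ?T) (\<phi> ` (U \<inter> ?p -` V)) (\<lambda>z. u (inv_into U \<phi> z) (V, \<psi>) k)"
        if k: "k \<in> coords ?S" for k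
      proof -
        obtain x i where xi: "k = (x, i)" "x \<in> X" "i \<in> coords (st (\<tau> x))"
          using k unfolding st_prod coords_prod_mfd by blast
        interpret E: smooth_ssub "\<tau> x" by (rule entry[OF xi(2)])
        have sm: "smooth_map ?T (tangent_bundle (st (\<tau> x))) (\<lambda>q. F x (q x))"
          unfolding tot_prod
          by (rule smooth_map_compose[OF Tot.premanifold_prod E.tot premanifold_tangent_bundle[OF E.st]
                Tot.smooth_proj[OF xi(2)] E.Crl_smooth[OF Fx[OF xi(2)]]])
        have "smooth_coord (coords ?T) (coords (st (\<tau> x))) (\<phi> ` (U \<inter> (\<lambda>q. proj (\<tau> x) (q x)) -` fst (d x)))
            (\<lambda>z. snd (F x (inv_into U \<phi> z x)) (fst (d x), snd (d x)))"
          by (rule smooth_section_chart[OF P.tot sm _ U St.factor_chart[OF d xi(2)]])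
            (rule E.Crl_base[OF Fx[OF xi(2)] points_tot_prod[OF _ xi(2)]])
        then have "smooth_fun (coords ?T) (\<phi> ` (U \<inter> (\<lambda>q. proj (\<tau> x) (q x)) -` fst (d x)))
            (\<lambda>z. snd (F x (inv_into U \<phi> z x)) (d x) i)"
          using xi(3) unfolding smooth_coord_iff by simp
        moreover have "\<phi> ` (U \<inter> ?p -` V) \<subseteq> \<phi> ` (U \<inter> (\<lambda>q. proj (\<tau> x) (q x)) -` fst (d x))"
        proof -
          have "proj (\<tau> x) (q x) \<in> fst (d x)" if "?p q \<in> V" for q
            using PiE_mem[OF that[unfolded V(1)] xi(2)] unfolding pq[OF xi(2)] .
          then show ?thesis by blast
        qed
        ultimately have "smooth_fun (coords ?T) (\<phi> ` (U \<inter> ?p -` V)) (\<lambda>z. snd (F x (inv_into U \<phi> z x)) (d x) i)"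
          by (rule smooth_fun_subset)
        moreover have "snd (F x (inv_into U \<phi> z x)) (d x) i = u (inv_into U \<phi> z) (V, \<psi>) k"
          if zD: "z \<in> \<phi> ` (U \<inter> ?p -` V)" for z
        proof -
          obtain q where q: "q \<in> U" "?p q \<in> V" "z = \<phi> q" using zD by blast
          have qT: "q \<in> points ?T" using chart_subset[OF P.tot U] q(1) by blast
          have inv: "inv_into U \<phi> z = q" using chart_inj[OF P.tot U] q by simp
          show ?thesis
            using St.tangent_proj_chart[OF d _ _ xi(2), of "?p q" "u q"] u[OF qT] q(2) Tu[OF qT xi(2)]
            unfolding inv V xi(1) st_prod by simp
        qed
        ultimately show ?thesis
          using smooth_fun_cong[OF D, of "\<lambda>z. snd (F x (inv_into U \<phi> z x)) (d x) i"] by simp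
      qed
      then show "smooth_coord (coords ?T) (coords ?S) (\<phi> ` (U \<inter> ?p -` V)) (\<lambda>z. u (inv_into U \<phi> z) (V, \<psi>))"
        unfolding smooth_coord_iff by blast
    qed
  qed
qed

lemma Crl_list_unique:
  assumes "H \<in> carrier (Crl (prod_ssub X \<tau>))"
    and "\<And>x. x \<in> X \<Longrightarrow> related (prod_ssub X \<tau>) (\<tau> x) (prod_proj x) H (F x)"
  shows "Crl_list X \<tau> F = H"
  unfolding Crl_list_def
proof (rule the_equality)
  show "H' = H" if "H' \<in> carrier (Crl (prod_ssub X \<tau>)) \<and>
      (\<forall>x\<in>X. related (prod_ssub X \<tau>) (\<tau> x) (prod_proj x) H' (F x))" for H'
    by (rule related_proj_unique[of _ _ F]) (use that assms in blast)+
qed (use assms in blast)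

lemma
  assumes F: "F \<in> carrier (Crl_sum X \<tau>)"
  shows Crl_list_closed: "Crl_list X \<tau> F \<in> carrier (Crl (prod_ssub X \<tau>))"
    and Crl_list_related: "x \<in> X \<Longrightarrow> related (prod_ssub X \<tau>) (\<tau> x) (prod_proj x) (Crl_list X \<tau> F) (F x)"
proof -
  obtain H where H: "H \<in> carrier (Crl (prod_ssub X \<tau>))"
    "\<And>x. x \<in> X \<Longrightarrow> related (prod_ssub X \<tau>) (\<tau> x) (prod_proj x) H (F x)"
    by (rule product_system_exists[OF F]) blast
  have eq: "Crl_list X \<tau> F = H" by (rule Crl_list_unique[OF H])
  show "Crl_list X \<tau> F \<in> carrier (Crl (prod_ssub X \<tau>))" unfolding eq by (rule H(1))
  show "related (prod_ssub X \<tau>) (\<tau> x) (prod_proj x) (Crl_list X \<tau> F) (F x)" if "x \<in> X"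
    unfolding eq by (rule H(2)[OF that])
qed

lemma Crl_sum_add: "x \<in> X \<Longrightarrow> (F \<oplus>\<^bsub>Crl_sum X \<tau>\<^esub> G) x = F x \<oplus>\<^bsub>Crl (\<tau> x)\<^esub> G x"
  and Crl_sum_smult: "x \<in> X \<Longrightarrow> (r \<odot>\<^bsub>Crl_sum X \<tau>\<^esub> F) x = r \<odot>\<^bsub>Crl (\<tau> x)\<^esub> F x"
  and Crl_sum_zero: "x \<in> X \<Longrightarrow> \<zero>\<^bsub>Crl_sum X \<tau>\<^esub> x = \<zero>\<^bsub>Crl (\<tau> x)\<^esub>"
  by (simp_all add: Crl_sum_def family_sum_def)

lemma Crl_list_add:
  assumes F: "F \<in> carrier (Crl_sum X \<tau>)" and G: "G \<in> carrier (Crl_sum X \<tau>)"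
  shows "Crl_list X \<tau> (F \<oplus>\<^bsub>Crl_sum X \<tau>\<^esub> G) = Crl_list X \<tau> F \<oplus>\<^bsub>Crl (prod_ssub X \<tau>)\<^esub> Crl_list X \<tau> G"
proof (rule Crl_list_unique[OF P.Crl_add_closed[OF Crl_list_closed[OF F] Crl_list_closed[OF G]]])
  fix x assume x: "x \<in> X"
  show "related (prod_ssub X \<tau>) (\<tau> x) (prod_proj x)
      (Crl_list X \<tau> F \<oplus>\<^bsub>Crl (prod_ssub X \<tau>)\<^esub> Crl_list X \<tau> G) ((F \<oplus>\<^bsub>Crl_sum X \<tau>\<^esub> G) x)"
    unfolding Crl_sum_add[OF x]
    by (rule ssub_morphism.related_add[OF proj_morphism[OF x] Crl_list_closed[OF F] Crl_list_closed[OF G]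
          Crl_list_related[OF F x] Crl_list_related[OF G x]])
qed

lemma Crl_list_smult:
  assumes F: "F \<in> carrier (Crl_sum X \<tau>)"
  shows "Crl_list X \<tau> (r \<odot>\<^bsub>Crl_sum X \<tau>\<^esub> F) = r \<odot>\<^bsub>Crl (prod_ssub X \<tau>)\<^esub> Crl_list X \<tau> F"
proof (rule Crl_list_unique[OF P.Crl_smult_closed[OF Crl_list_closed[OF F]]])
  fix x assume x: "x \<in> X"
  show "related (prod_ssub X \<tau>) (\<tau> x) (prod_proj x)
      (r \<odot>\<^bsub>Crl (prod_ssub X \<tau>)\<^esub> Crl_list X \<tau> F) ((r \<odot>\<^bsub>Crl_sum X \<tau>\<^esub> F) x)"
    unfolding Crl_sum_smult[OF x]
    by (rule ssub_morphism.related_smult[OF proj_morphism[OF x] Crl_list_closed[OF F] Crl_list_related[OF F x]])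
qed

end


section \<open>Networks\<close>

lemma linear_relation_odot:
  assumes X: "ssub_list X \<tau>" and Y: "ssub_list Y \<mu>" and lm: "list_morphism X \<tau> Y \<mu> \<phi> \<Phi>"
  shows "linear_relation (Crl_sum Y \<mu>) (Crl_sum X \<tau>) (odot X \<tau> Y \<mu> \<phi> \<Phi>)"
proof -
  interpret X: ssub_list X \<tau> by (rule X)
  interpret Y: ssub_list Y \<mu> by (rule Y)
  have \<phi>: "\<phi> x \<in> Y" if "x \<in> X" for x using lm that by (auto simp: list_morphism_def)
  have mor: "ssub_morphism (\<mu> (\<phi> x)) (\<tau> x) (\<Phi> x)" if "x \<in> X" for x
    using lm that X.entry[OF that] Y.entry[OF \<phi>[OF that]]
    by (simp add: ssub_morphism_def ssub_morphism_axioms_def list_morphism_def)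
  let ?D = "direct_sum (Crl_sum X \<tau>) (Crl_sum Y \<mu>)"
  have D: "vectorspace real_field ?D"
    by (rule vectorspace_direct_sum[OF X.vectorspace_Crl_sum Y.vectorspace_Crl_sum])
  interpret M: Module.module real_field "Crl_sum X \<tau>" by (rule vectorspace_imp_module[OF X.vectorspace_Crl_sum])
  interpret N: Module.module real_field "Crl_sum Y \<mu>" by (rule vectorspace_imp_module[OF Y.vectorspace_Crl_sum])
  have odot_iff: "(F, G) \<in> odot X \<tau> Y \<mu> \<phi> \<Phi> \<longleftrightarrow> F \<in> carrier (Crl_sum X \<tau>) \<and> G \<in> carrier (Crl_sum Y \<mu>) \<and>
      (\<forall>x\<in>X. related (\<mu> (\<phi> x)) (\<tau> x) (\<Phi> x) (G (\<phi> x)) (F x))" for F G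
    using X.Crl_sum_entry Y.Crl_sum_entry \<phi> by (auto simp: odot_def Crl_rel_def)
  show ?thesis
    unfolding linear_relation_def
  proof (rule real_subspaceI[OF D])
    show "odot X \<tau> Y \<mu> \<phi> \<Phi> \<subseteq> carrier ?D" by (auto simp: odot_def direct_sum_def)
    have "(\<zero>\<^bsub>Crl_sum X \<tau>\<^esub>, \<zero>\<^bsub>Crl_sum Y \<mu>\<^esub>) \<in> odot X \<tau> Y \<mu> \<phi> \<Phi>"
      unfolding odot_iff using ssub_morphism.related_zero[OF mor] \<phi>
      by (simp add: X.Crl_sum_zero Y.Crl_sum_zero)
    then show "\<zero>\<^bsub>?D\<^esub> \<in> odot X \<tau> Y \<mu> \<phi> \<Phi>" by (simp add: direct_sum_def)
    fix v assume "v \<in> odot X \<tau> Y \<mu> \<phi> \<Phi>"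
    then obtain F G where v: "v = (F, G)" "(F, G) \<in> odot X \<tau> Y \<mu> \<phi> \<Phi>" by (cases v) auto
    then have F: "F \<in> carrier (Crl_sum X \<tau>)" and G: "G \<in> carrier (Crl_sum Y \<mu>)"
      and rel: "\<And>x. x \<in> X \<Longrightarrow> related (\<mu> (\<phi> x)) (\<tau> x) (\<Phi> x) (G (\<phi> x)) (F x)"
      unfolding odot_iff by blast+
    note Gx = Y.Crl_sum_entry[OF G \<phi>]
    have "(r \<odot>\<^bsub>Crl_sum X \<tau>\<^esub> F, r \<odot>\<^bsub>Crl_sum Y \<mu>\<^esub> G) \<in> odot X \<tau> Y \<mu> \<phi> \<Phi>" for r
      unfolding odot_iff
    proof (intro conjI ballI)
      fix x assume x: "x \<in> X"
      show "related (\<mu> (\<phi> x)) (\<tau> x) (\<Phi> x) ((r \<odot>\<^bsub>Crl_sum Y \<mu>\<^esub> G) (\<phi> x)) ((r \<odot>\<^bsub>Crl_sum X \<tau>\<^esub> F) x)"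
        unfolding X.Crl_sum_smult[OF x] Y.Crl_sum_smult[OF \<phi>[OF x]]
        by (rule ssub_morphism.related_smult[OF mor[OF x] Gx[OF x] rel[OF x]])
    qed (use F G in simp_all)
    then show "r \<odot>\<^bsub>?D\<^esub> v \<in> odot X \<tau> Y \<mu> \<phi> \<Phi>" for r by (simp add: direct_sum_def v(1))
    fix w assume "w \<in> odot X \<tau> Y \<mu> \<phi> \<Phi>"
    then obtain F' G' where w: "w = (F', G')" "(F', G') \<in> odot X \<tau> Y \<mu> \<phi> \<Phi>" by (cases w) auto
    then have F': "F' \<in> carrier (Crl_sum X \<tau>)" and G': "G' \<in> carrier (Crl_sum Y \<mu>)"
      and rel': "\<And>x. x \<in> X \<Longrightarrow> related (\<mu> (\<phi> x)) (\<tau> x) (\<Phi> x) (G' (\<phi> x)) (F' x)"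
      unfolding odot_iff by blast+
    have "(F \<oplus>\<^bsub>Crl_sum X \<tau>\<^esub> F', G \<oplus>\<^bsub>Crl_sum Y \<mu>\<^esub> G') \<in> odot X \<tau> Y \<mu> \<phi> \<Phi>"
      unfolding odot_iff
    proof (intro conjI ballI)
      fix x assume x: "x \<in> X"
      show "related (\<mu> (\<phi> x)) (\<tau> x) (\<Phi> x) ((G \<oplus>\<^bsub>Crl_sum Y \<mu>\<^esub> G') (\<phi> x)) ((F \<oplus>\<^bsub>Crl_sum X \<tau>\<^esub> F') x)"
        unfolding X.Crl_sum_add[OF x] Y.Crl_sum_add[OF \<phi>[OF x]]
        by (rule ssub_morphism.related_add[OF mor[OF x] Gx[OF x] Y.Crl_sum_entry[OF G' \<phi>[OF x]] rel[OF x] rel'[OF x]])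
    qed (use F G F' G' in simp_all)
    then show "v \<oplus>\<^bsub>?D\<^esub> w \<in> odot X \<tau> Y \<mu> \<phi> \<Phi>" by (simp add: direct_sum_def v(1) w(1))
  qed
qed

locale smooth_network = L: ssub_list X \<tau> + I: interconnected b "prod_ssub X \<tau>" \<psi>
  for X :: "'x set" and \<tau> :: "'x \<Rightarrow> ('p, 'i, 'q, 'j) ssub"
    and b :: "('pb, 'ib, 'qb, 'jb) ssub" and \<psi> :: "('pb, 'x \<Rightarrow> 'p, 'qb, 'x \<Rightarrow> 'q) ssub_map"
begin

lemma linear_assembly:
  "VectorSpace.linear_map real_field (Crl_sum X \<tau>) (Crl b) (pullback b (prod_ssub X \<tau>) \<psi> \<circ> Crl_list X \<tau>)"
  by (rule real_linear_mapI[OF L.vectorspace_Crl_sum I.A.vectorspace_Crl])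
    (simp_all add: L.Crl_list_closed L.Crl_list_add L.Crl_list_smult
      I.pullback_closed I.pullback_add I.pullback_smult)

end

lemma network_imp_smooth:
  assumes "network X \<tau> b \<psi>"
  shows "smooth_network X \<tau> b \<psi>"
proof -
  have L: "ssub_list X \<tau>"
    using assms surjective_submersion_imp_smooth
    by (auto simp: network_def list_of_submersions_def ssub_list_def)
  interpret L: ssub_list X \<tau> by (rule L)
  have "smooth_ssub b" "interconnection b (prod_ssub X \<tau>) \<psi>"
    using assms surjective_submersion_imp_smooth by (auto simp: network_def)
  then show ?thesis
    using L L.P.smooth_ssub_axioms
    by (simp add: smooth_network_def interconnected_def interconnected_axioms_def)
qed

text \<open>
  A network map takes assembled systems to assembled systems.  The vectors \<open>w1\<close> and \<open>w2\<close> are the two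
  sides of the relatedness equation at \<open>q\<close>; they are compared after applying \<open>T \<psi>\<^sub>s\<^sub>t\<close> and then each
  \<open>T \<pi>\<^sub>x\<close>, where the commuting square of the network map rewrites \<open>\<pi>\<^sub>x \<circ> \<psi> \<circ> f\<close> as
  \<open>\<Phi> x \<circ> \<pi>\<^bsub>\<phi> x\<^esub> \<circ> \<nu>\<close>.
\<close>

lemma related_assembly:
  assumes b: "smooth_network X \<tau> b \<psi>" and c: "smooth_network Y \<mu> c \<nu>"
    and nm: "network_map X \<tau> b \<psi> Y \<mu> c \<nu> \<phi> \<Phi> f"
    and FG: "(F, G) \<in> odot X \<tau> Y \<mu> \<phi> \<Phi>"
  shows "related c b f (pullback c (prod_ssub Y \<mu>) \<nu> (Crl_list Y \<mu> G))
    (pullback b (prod_ssub X \<tau>) \<psi> (Crl_list X \<tau> F))"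
  unfolding related_def
proof
  interpret b: smooth_network X \<tau> b \<psi> by (rule b)
  interpret c: smooth_network Y \<mu> c \<nu> by (rule c)
  interpret f: ssub_morphism c b f
    using nm by unfold_locales (simp add: network_map_def)
  have F: "F \<in> carrier (Crl_sum X \<tau>)" and G: "G \<in> carrier (Crl_sum Y \<mu>)"
    and rel: "\<And>x. x \<in> X \<Longrightarrow> related (\<mu> (\<phi> x)) (\<tau> x) (\<Phi> x) (G (\<phi> x)) (F x)"
    using FG by (auto simp: odot_def Crl_rel_def)
  have \<phi>: "\<phi> x \<in> Y" if "x \<in> X" for x using nm that by (auto simp: network_map_def list_morphism_def)
  have \<Phi>: "map_of_submersions (\<mu> (\<phi> x)) (\<tau> x) (\<Phi> x)" if "x \<in> X" for x
    using nm that by (auto simp: network_map_def list_morphism_def)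
  have sq_tot: "map_tot \<psi> (map_tot f q) x = map_tot (\<Phi> x) (map_tot \<nu> q (\<phi> x))"
    if "q \<in> points (tot c)" "x \<in> X" for q x
    using nm that by (simp add: network_map_def ssub_map_eq_def ssub_comp_def list_map_def)
  have sq_st: "map_st \<psi> (map_st f m) x = map_st (\<Phi> x) (map_st \<nu> m (\<phi> x))"
    if "m \<in> points (st c)" "x \<in> X" for m x
    using nm that by (simp add: network_map_def ssub_map_eq_def ssub_comp_def list_map_def)
  let ?P = "prod_ssub X \<tau>" and ?Q = "prod_ssub Y \<mu>"
  define F' where "F' = Crl_list X \<tau> F"
  define G' where "G' = Crl_list Y \<mu> G"
  have F': "F' \<in> carrier (Crl ?P)" and G': "G' \<in> carrier (Crl ?Q)"
    unfolding F'_def G'_def by (rule b.L.Crl_list_closed[OF F] c.L.Crl_list_closed[OF G])+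
  fix q assume q: "q \<in> points (tot c)"
  define w where "w = pullback c ?Q \<nu> G' q"
  have w: "w \<in> points (tangent_bundle (st c))"
    unfolding w_def by (rule smooth_map_points[OF c.I.A.Crl_smooth[OF c.I.pullback_closed[OF G']] q])
  have T\<nu>: "tangent_map (st c) (st ?Q) (map_st \<nu>) w = G' (map_tot \<nu> q)"
    using c.I.pullback_related[OF G'] q unfolding related_def w_def by blast
  define w1 where "w1 = tangent_map (st c) (st b) (map_st f) w"
  define w2 where "w2 = pullback b ?P \<psi> F' (map_tot f q)"
  have w1: "w1 \<in> points (tangent_bundle (st b))"
    unfolding w1_def by (rule tangent_map_points[OF c.I.A.st b.I.A.st f.smooth_st w])
  have fq: "map_tot f q \<in> points (tot b)" by (rule f.map_tot_points[OF q])
  have w2: "w2 \<in> points (tangent_bundle (st b))"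
    unfolding w2_def by (rule smooth_map_points[OF b.I.A.Crl_smooth[OF b.I.pullback_closed[OF F']] fq])
  let ?T\<psi> = "tangent_map (st b) (st ?P) (map_st \<psi>)"
  have T\<psi>: "?T\<psi> w2 = F' (map_tot \<psi> (map_tot f q))"
    using b.I.pullback_related[OF F'] fq unfolding related_def w2_def by blast
  have "?T\<psi> w1 = ?T\<psi> w2"
  proof (rule b.L.tangent_prod_unique)
    show "?T\<psi> w1 \<in> points (tangent_bundle (st ?P))"
      by (rule tangent_map_points[OF b.I.A.st b.L.P.st b.I.smooth_st w1])
    show "?T\<psi> w2 \<in> points (tangent_bundle (st ?P))"
      by (rule tangent_map_points[OF b.I.A.st b.L.P.st b.I.smooth_st w2])
    fix x assume x: "x \<in> X"
    let ?\<pi>x = "tangent_map (st ?P) (st (\<tau> x)) (\<lambda>m. m x)"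
    let ?\<pi>y = "tangent_map (st ?Q) (st (\<mu> (\<phi> x))) (\<lambda>m. m (\<phi> x))"
    interpret \<Phi>x: ssub_morphism "\<mu> (\<phi> x)" "\<tau> x" "\<Phi> x"
      using \<Phi>[OF x] b.L.entry[OF x] c.L.entry[OF \<phi>[OF x]]
      by (simp add: ssub_morphism_def ssub_morphism_axioms_def)
    have px: "smooth_map (st ?P) (st (\<tau> x)) (\<lambda>m. m x)"
      unfolding b.L.st_prod by (rule b.L.St.smooth_proj[OF x])
    have py: "smooth_map (st ?Q) (st (\<mu> (\<phi> x))) (\<lambda>m. m (\<phi> x))"
      unfolding c.L.st_prod by (rule c.L.St.smooth_proj[OF \<phi>[OF x]])
    note \<nu>y = smooth_map_compose[OF c.I.A.st c.L.P.st \<Phi>x.A.st c.I.smooth_st py]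
    have \<nu>q: "map_tot \<nu> q \<in> points (tot ?Q)" by (rule c.I.map_tot_points[OF q])
    have "?\<pi>x (?T\<psi> w1) = tangent_map (st b) (st (\<tau> x)) (\<lambda>m. map_st \<psi> m x) w1"
      by (rule tangent_map_compose[OF b.I.A.st b.L.P.st \<Phi>x.B.st b.I.smooth_st px w1, symmetric])
    also have "\<dots> = tangent_map (st c) (st (\<tau> x)) (\<lambda>m. map_st \<psi> (map_st f m) x) w"
      unfolding w1_def
      by (rule tangent_map_compose[OF c.I.A.st b.I.A.st \<Phi>x.B.st f.smooth_st
            smooth_map_compose[OF b.I.A.st b.L.P.st \<Phi>x.B.st b.I.smooth_st px] w, symmetric])
    also have "\<dots> = tangent_map (st c) (st (\<tau> x)) (\<lambda>m. map_st (\<Phi> x) (map_st \<nu> m (\<phi> x))) w"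
      using w by (intro tangent_map_cong[OF c.I.A.st]) (auto simp: points_tangent_bundle sq_st x)
    also have "\<dots> = tangent_map (st (\<mu> (\<phi> x))) (st (\<tau> x)) (map_st (\<Phi> x))
        (tangent_map (st c) (st (\<mu> (\<phi> x))) (\<lambda>m. map_st \<nu> m (\<phi> x)) w)"
      by (rule tangent_map_compose[OF c.I.A.st \<Phi>x.A.st \<Phi>x.B.st \<nu>y \<Phi>x.smooth_st w])
    also have "tangent_map (st c) (st (\<mu> (\<phi> x))) (\<lambda>m. map_st \<nu> m (\<phi> x)) w = ?\<pi>y (G' (map_tot \<nu> q))"
      unfolding T\<nu>[symmetric]
      by (rule tangent_map_compose[OF c.I.A.st c.L.P.st \<Phi>x.A.st c.I.smooth_st py w])
    also have "\<dots> = G (\<phi> x) (map_tot \<nu> q (\<phi> x))"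
      using c.L.Crl_list_related[OF G \<phi>[OF x]] \<nu>q unfolding c.L.related_proj_iff G'_def by blast
    also have "tangent_map (st (\<mu> (\<phi> x))) (st (\<tau> x)) (map_st (\<Phi> x)) (G (\<phi> x) (map_tot \<nu> q (\<phi> x))) =
        F x (map_tot (\<Phi> x) (map_tot \<nu> q (\<phi> x)))"
      using rel[OF x] c.L.points_tot_prod[OF \<nu>q \<phi>[OF x]] unfolding related_def by blast
    also have "\<dots> = F x (map_tot \<psi> (map_tot f q) x)" by (simp add: sq_tot[OF q x])
    also have "\<dots> = ?\<pi>x (?T\<psi> w2)"
      using b.L.Crl_list_related[OF F x] b.I.map_tot_points[OF fq]
      unfolding b.L.related_proj_iff T\<psi> F'_def by simp
    finally show "?\<pi>x (?T\<psi> w1) = ?\<pi>x (?T\<psi> w2)" .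
  qed
  then have "w1 = w2" by (rule inj_onD[OF b.I.inj_tangent_st _ w1 w2])
  then show "tangent_map (st c) (st b) (map_st f) (pullback c ?Q \<nu> (Crl_list Y \<mu> G) q) =
      pullback b ?P \<psi> (Crl_list X \<tau> F) (map_tot f q)"
    unfolding w1_def w2_def w_def F'_def G'_def .
qed

theorem theorem9p5:
  fixes X :: "'x set" and \<tau> :: "'x \<Rightarrow> ('p, 'i, 'q, 'j) ssub"
    and Y :: "'y set" and \<mu> :: "'y \<Rightarrow> ('p', 'i', 'q', 'j') ssub"
    and b :: "('pb, 'ib, 'qb, 'jb) ssub" and c :: "('pc, 'ic, 'qc, 'jc) ssub"
    and \<psi> :: "('pb, 'x \<Rightarrow> 'p, 'qb, 'x \<Rightarrow> 'q) ssub_map"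
    and \<nu> :: "('pc, 'y \<Rightarrow> 'p', 'qc, 'y \<Rightarrow> 'q') ssub_map"
    and \<phi> :: "'x \<Rightarrow> 'y" and \<Phi> :: "'x \<Rightarrow> ('p', 'p, 'q', 'q) ssub_map"
    and f :: "('pc, 'pb, 'qc, 'qb) ssub_map"
  assumes "network X \<tau> b \<psi>"
    and "network Y \<mu> c \<nu>"
    and "network_map X \<tau> b \<psi> Y \<mu> c \<nu> \<phi> \<Phi> f"
  shows "two_cell (Crl_sum Y \<mu>) (Crl_sum X \<tau>) (Crl c) (Crl b)
           (odot X \<tau> Y \<mu> \<phi> \<Phi>) (Crl_rel c b f)
           (pullback c (prod_ssub Y \<mu>) \<nu> \<circ> Crl_list Y \<mu>)
           (pullback b (prod_ssub X \<tau>) \<psi> \<circ> Crl_list X \<tau>)"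
  unfolding two_cell_def
proof (intro conjI)
  note nb = network_imp_smooth[OF assms(1)] and nc = network_imp_smooth[OF assms(2)]
  interpret b: smooth_network X \<tau> b \<psi> by (rule nb)
  interpret c: smooth_network Y \<mu> c \<nu> by (rule nc)
  interpret f: ssub_morphism c b f
    using assms(3) by unfold_locales (simp add: network_map_def)
  show "linear_relation (Crl_sum Y \<mu>) (Crl_sum X \<tau>) (odot X \<tau> Y \<mu> \<phi> \<Phi>)"
    using assms(3) by (intro linear_relation_odot b.L.ssub_list_axioms c.L.ssub_list_axioms)
      (simp add: network_map_def)
  show "linear_relation (Crl c) (Crl b) (Crl_rel c b f)" by (rule f.linear_relation_Crl_rel)
  show "VectorSpace.linear_map real_field (Crl_sum Y \<mu>) (Crl c)
      (pullback c (prod_ssub Y \<mu>) \<nu> \<circ> Crl_list Y \<mu>)" by (rule c.linear_assembly)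
  show "VectorSpace.linear_map real_field (Crl_sum X \<tau>) (Crl b)
      (pullback b (prod_ssub X \<tau>) \<psi> \<circ> Crl_list X \<tau>)" by (rule b.linear_assembly)
  show "map_prod (pullback b (prod_ssub X \<tau>) \<psi> \<circ> Crl_list X \<tau>)
      (pullback c (prod_ssub Y \<mu>) \<nu> \<circ> Crl_list Y \<mu>) ` odot X \<tau> Y \<mu> \<phi> \<Phi> \<subseteq> Crl_rel c b f"
  proof (rule image_subsetI)
    fix v assume "v \<in> odot X \<tau> Y \<mu> \<phi> \<Phi>"
    then obtain F G where v: "v = (F, G)" and FG: "(F, G) \<in> odot X \<tau> Y \<mu> \<phi> \<Phi>" by (cases v) auto
    then have "F \<in> carrier (Crl_sum X \<tau>)" "G \<in> carrier (Crl_sum Y \<mu>)" by (auto simp: odot_def)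
    then show "map_prod (pullback b (prod_ssub X \<tau>) \<psi> \<circ> Crl_list X \<tau>)
      (pullback c (prod_ssub Y \<mu>) \<nu> \<circ> Crl_list Y \<mu>) v \<in> Crl_rel c b f"
      using related_assembly[OF nb nc assms(3) FG]
      by (simp add: v Crl_rel_def b.I.pullback_closed b.L.Crl_list_closed
          c.I.pullback_closed c.L.Crl_list_closed)
  qed
qed

end
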